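(* Let $n>2$, let $\mathfrak{K}$ be a field of characteristic different from $2$, and let $\mathfrak{g}$ be an $n$-Filippov algebra over $\mathfrak{K}$ of dimension at least $n$. Then there is a long exact sequence $$\cdots\xrightarrow{\partial}{}_{n}H^{rel}_{k-1}(\mathfrak{g})\to{}_{n}HL_k(\mathfrak{g};\mathfrak{K})\to{}_{n}H^{Lie}_k(\mathfrak{g};\mathfrak{K})\xrightarrow{\partial}{}_{n}H^{rel}_{k-2}(\mathfrak{g})\to\cdots$$ $$\cdots\xrightarrow{\partial}{}_{n}H^{rel}_{0}(\mathfrak{g})\to{}_{n}HL_1(\mathfrak{g};\mathfrak{K})\to{}_{n}H^{Lie}_1(\mathfrak{g};\mathfrak{K})\xrightarrow{\partial}0,$$ $$0\to{}_{n}HL_0(\mathfrak{g};\mathfrak{K})\xrightarrow{\cong}{}_{n}H^{Lie}_0(\mathfrak{g};\mathfrak{K})\to0,$$ in which the maps ${}_{n}HL_k(\mathfrak{g};\mathfrak{K})\to{}_{n}H^{Lie}_k(\mathfrak{g};\mathfrak{K})$ are induced by the canonical projections $\mathfrak{g}\otimes D_n(\mathfrak{g})^{\otimes k}\to\mathfrak{g}\otimes L_n(\mathfrak{g})^{\otimes k}$.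
   Context: All tensor products are over $\mathfrak{K}$. A Leibniz $n$-algebra is a $\mathfrak{K}$-vector space $\mathfrak{g}$ with an $n$-linear operation $[-,\ldots,-]:\mathfrak{g}^{\otimes n}\to\mathfrak{g}$ satisfying $$[[x_1,\ldots,x_n],y_1,\ldots,y_{n-1}]=\sum_{i=1}^n[x_1,\ldots,x_{i-1},[x_i,y_1,\ldots,y_{n-1}],x_{i+1},\ldots,x_n].$$ It is an $n$-Filippov algebra if moreover the operation is anti-symmetric in each pair of variables (equivalently, vanishes whenever two arguments are equal). A Leibniz algebra is a Leibniz $2$-algebra. For an $n$-Filippov algebra $\mathfrak{g}$, $D_n(\mathfrak{g})=\mathfrak{g}^{\otimes(n-1)}$ is a Leibniz algebra with bracket $$[a_1\otimes\cdots\otimes a_{n-1},\,b_1\otimes\cdots\otimes b_{n-1}]=\sum_{i=1}^{n-1}a_1\otimes\cdots\otimes[a_i,b_1,\ldots,b_{n-1}]\otimes\cdots\otimes a_{n-1},$$ and $L_n(\mathfrak{g})=\mathfrak{g}^{\wedge(n-1)}=\Lambda^{n-1}\mathfrak{g}$ is a Leibniz algebra with bracket given by the same formula with $\wedge$ in place of $\otimes$. Both act on $\mathfrak{g}$ by $[x,x_1\otimes\cdots\otimes x_{n-1}]=[x,x_1\wedge\cdots\wedge x_{n-1}]=[x,x_1,\ldots,x_{n-1}]$. For $\mathfrak{h}=D_n(\mathfrak{g})$ or $L_n(\mathfrak{g})$, let $CL_*(\mathfrak{h},\mathfrak{g})$ be the chain complex with $CL_k(\mathfrak{h},\mathfrak{g})=\mathfrak{g}\otimes\mathfrak{h}^{\otimes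 k}$ ($k\ge0$) and Loday differential $$d(v\otimes h_1\otimes\cdots\otimes h_k)=\sum_{1\le j\le k}(-1)^j[v,h_j]\otimes h_1\otimes\cdots\widehat{h_j}\cdots\otimes h_k+\sum_{1\le i<j\le k}(-1)^{j}v\otimes h_1\otimes\cdots\otimes[h_i,h_j]\otimes\cdots\widehat{h_j}\cdots\otimes h_k,$$ where $[h_i,h_j]$ stands in the position of $h_i$. ${}_{n}CL_*(\mathfrak{g}):=CL_*(D_n(\mathfrak{g}),\mathfrak{g})$ has homology ${}_{n}HL_*(\mathfrak{g};\mathfrak{K})$; ${}_{n}C_*(\mathfrak{g}):=CL_*(L_n(\mathfrak{g}),\mathfrak{g})$ has homology ${}_{n}H^{Lie}_*(\mathfrak{g};\mathfrak{K})$. ${}_{n}C^{rel}_*(\mathfrak{g})$ is the complex with ${}_{n}C^{rel}_k(\mathfrak{g}):=\ker[\mathfrak{g}\otimes D_n(\mathfrak{g})^{\otimes(k+1)}\to\mathfrak{g}\otimes L_n(\mathfrak{g})^{\otimes(k+1)}]$, $k\ge0$, the kernel of the canonical projection, with differential the restriction of that of ${}_{n}CL_*(\mathfrak{g})$ (note the degree shift: ${}_{n}C^{rel}_k(\mathfrak{g})\subset{}_{n}CL_{k+1}(\mathfrak{g})$). Its homology is ${}_{n}H^{rel}_*(\mathfrak{g})$. *)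

theory Defs
  imports "HOL-Algebra.AbelCoset" "Jordan_Normal_Form.Missing_VectorSpace"
begin

section \<open>Modules by generators and relations\<close>

definition quotient_module ::
    "('k, 'r) ring_scheme \<Rightarrow> ('k, 'a, 'm) module_scheme \<Rightarrow> 'a set \<Rightarrow> ('k, 'a set) module" where
  "quotient_module K M S =
     \<lparr>carrier = a_rcosets\<^bsub>M\<^esub> S, mult = undefined, one = undefined, zero = S, add = set_add M,
      smult = (\<lambda>a A. \<Union>x\<in>A. S +>\<^bsub>M\<^esub> (a \<odot>\<^bsub>M\<^esub> x))\<rparr>"

definition free_module :: "('k, 'r) ring_scheme \<Rightarrow> 'x set \<Rightarrow> ('k, 'x \<Rightarrow> 'k) module" where
  "free_module K X =
     (ring.func_space K X)
       \<lparr>carrier := {u \<in> carrier (ring.func_space K X). finite {x \<in> X. u x \<noteq> \<zero>\<^bsub>K\<^esub>}}\<rparr>"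

definition generator :: "('k, 'r) ring_scheme \<Rightarrow> 'x set \<Rightarrow> 'x \<Rightarrow> 'x \<Rightarrow> 'k" where
  "generator K X x = (\<lambda>y\<in>X. if y = x then \<one>\<^bsub>K\<^esub> else \<zero>\<^bsub>K\<^esub>)"

definition presented_module ::
    "('k, 'r) ring_scheme \<Rightarrow> 'x set \<Rightarrow> ('x \<Rightarrow> 'k) set \<Rightarrow> ('k, ('x \<Rightarrow> 'k) set) module" where
  "presented_module K X R =
     quotient_module K (free_module K X) (module.span K (free_module K X) R)"

definition generator_class ::
    "('k, 'r) ring_scheme \<Rightarrow> 'x set \<Rightarrow> ('x \<Rightarrow> 'k) set \<Rightarrow> 'x \<Rightarrow> ('x \<Rightarrow> 'k) set" where
  "generator_class K X R x =
     module.span K (free_module K X) R +>\<^bsub>free_module K X\<^esub> generator K X x"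

text \<open>The linear map out of a module presented with generators \<open>X\<close> that sends the class of each
  generator \<open>x\<close> to \<open>f x\<close>. It is meaningful when the linear extension of \<open>f\<close> kills the
  relations, so that it is constant on each coset.\<close>

definition linear_extension ::
    "('k, 'r) ring_scheme \<Rightarrow> 'x set \<Rightarrow> ('k, 'b, 'm) module_scheme \<Rightarrow> ('x \<Rightarrow> 'b) \<Rightarrow> ('x \<Rightarrow> 'k) \<Rightarrow> 'b"
  where
  "linear_extension K X N f u =
     (\<Oplus>\<^bsub>N\<^esub> x \<in> {x \<in> X. u x \<noteq> \<zero>\<^bsub>K\<^esub>}. u x \<odot>\<^bsub>N\<^esub> f x)"

definition presented_lift ::
    "('k, 'r) ring_scheme \<Rightarrow> 'x set \<Rightarrow> ('k, 'b, 'm) module_scheme \<Rightarrow> ('x \<Rightarrow> 'b) \<Rightarrow> ('x \<Rightarrow> 'k) set \<Rightarrow> 'b"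
  where
  "presented_lift K X N f A = the_elem (linear_extension K X N f ` A)"


section \<open>Tensor and exterior powers\<close>

definition tuples :: "('k, 'a, 'm) module_scheme \<Rightarrow> nat \<Rightarrow> 'a list set" where
  "tuples M m = {xs. length xs = m \<and> set xs \<subseteq> carrier M}"

text \<open>For \<open>s\<close> a parametrisation \<open>x \<mapsto> s x \<in> X\<close> of one tensor slot by \<open>M\<close>, the relations
  expressing that the class of \<open>s x\<close> is linear in \<open>x\<close>.\<close>

definition linearity_relations ::
    "('k, 'r) ring_scheme \<Rightarrow> 'x set \<Rightarrow> ('k, 'a, 'm) module_scheme \<Rightarrow> ('a \<Rightarrow> 'x) \<Rightarrow> ('x \<Rightarrow> 'k) set"
  where
  "linearity_relations K X M s =
     {generator K X (s (a \<odot>\<^bsub>M\<^esub> x \<oplus>\<^bsub>M\<^esub> y)) \<ominus>\<^bsub>free_module K X\<^esub>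
        (a \<odot>\<^bsub>free_module K X\<^esub> generator K X (s x) \<oplus>\<^bsub>free_module K X\<^esub> generator K X (s y))
      | a x y. a \<in> carrier K \<and> x \<in> carrier M \<and> y \<in> carrier M}"

definition tensor_relations ::
    "('k, 'r) ring_scheme \<Rightarrow> ('k, 'a, 'm) module_scheme \<Rightarrow> nat \<Rightarrow> ('a list \<Rightarrow> 'k) set" where
  "tensor_relations K M m =
     (\<Union>xs \<in> tuples M m. \<Union>i \<in> {..<m}. linearity_relations K (tuples M m) M (\<lambda>x. xs[i := x]))"

definition alternating_relations ::
    "('k, 'r) ring_scheme \<Rightarrow> ('k, 'a, 'm) module_scheme \<Rightarrow> nat \<Rightarrow> ('a list \<Rightarrow> 'k) set" where
  "alternating_relations K M m =
     {generator K (tuples M m) xs | xs. xs \<in> tuples M m \<and> \<not> distinct xs}"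

definition tensor_power ::
    "('k, 'r) ring_scheme \<Rightarrow> ('k, 'a, 'm) module_scheme \<Rightarrow> nat \<Rightarrow> ('k, ('a list \<Rightarrow> 'k) set) module"
  where
  "tensor_power K M m = presented_module K (tuples M m) (tensor_relations K M m)"

definition tensor ::
    "('k, 'r) ring_scheme \<Rightarrow> ('k, 'a, 'm) module_scheme \<Rightarrow> nat \<Rightarrow> 'a list \<Rightarrow> ('a list \<Rightarrow> 'k) set"
  where
  "tensor K M m = generator_class K (tuples M m) (tensor_relations K M m)"

definition exterior_power ::
    "('k, 'r) ring_scheme \<Rightarrow> ('k, 'a, 'm) module_scheme \<Rightarrow> nat \<Rightarrow> ('k, ('a list \<Rightarrow> 'k) set) module"
  where
  "exterior_power K M m =
     presented_module K (tuples M m) (tensor_relations K M m \<union> alternating_relations K M m)"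

definition wedge ::
    "('k, 'r) ring_scheme \<Rightarrow> ('k, 'a, 'm) module_scheme \<Rightarrow> nat \<Rightarrow> 'a list \<Rightarrow> ('a list \<Rightarrow> 'k) set"
  where
  "wedge K M m =
     generator_class K (tuples M m) (tensor_relations K M m \<union> alternating_relations K M m)"

text \<open>\<open>V \<otimes> W\<^sup>\<otimes>\<^sup>k\<close>, with generators \<open>(v, [w\<^sub>1, \<dots>, w\<^sub>k])\<close> standing for
  \<open>v \<otimes> w\<^sub>1 \<otimes> \<dots> \<otimes> w\<^sub>k\<close>.\<close>

definition mixed_tuples ::
    "('k, 'a, 'm) module_scheme \<Rightarrow> ('k, 'w, 'l) module_scheme \<Rightarrow> nat \<Rightarrow> ('a \<times> 'w list) set" where
  "mixed_tuples V W k = carrier V \<times> tuples W k"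

definition mixed_relations ::
    "('k, 'r) ring_scheme \<Rightarrow> ('k, 'a, 'm) module_scheme \<Rightarrow> ('k, 'w, 'l) module_scheme \<Rightarrow> nat
      \<Rightarrow> ('a \<times> 'w list \<Rightarrow> 'k) set" where
  "mixed_relations K V W k =
     (\<Union>ws \<in> tuples W k. linearity_relations K (mixed_tuples V W k) V (\<lambda>v. (v, ws))) \<union>
     (\<Union>v \<in> carrier V. \<Union>ws \<in> tuples W k. \<Union>i \<in> {..<k}.
        linearity_relations K (mixed_tuples V W k) W (\<lambda>w. (v, ws[i := w])))"

definition mixed_tensor_product ::
    "('k, 'r) ring_scheme \<Rightarrow> ('k, 'a, 'm) module_scheme \<Rightarrow> ('k, 'w, 'l) module_scheme \<Rightarrow> nat
      \<Rightarrow> ('k, ('a \<times> 'w list \<Rightarrow> 'k) set) module" where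
  "mixed_tensor_product K V W k =
     presented_module K (mixed_tuples V W k) (mixed_relations K V W k)"

definition mixed_tensor ::
    "('k, 'r) ring_scheme \<Rightarrow> ('k, 'a, 'm) module_scheme \<Rightarrow> ('k, 'w, 'l) module_scheme \<Rightarrow> nat
      \<Rightarrow> 'a \<times> 'w list \<Rightarrow> ('a \<times> 'w list \<Rightarrow> 'k) set" where
  "mixed_tensor K V W k = generator_class K (mixed_tuples V W k) (mixed_relations K V W k)"


section \<open>Leibniz \<open>n\<close>-algebras and Filippov algebras\<close>

definition multilinear ::
    "('k, 'r) ring_scheme \<Rightarrow> ('k, 'a, 'm) module_scheme \<Rightarrow> nat \<Rightarrow> ('k, 'b, 'l) module_scheme
      \<Rightarrow> ('a list \<Rightarrow> 'b) \<Rightarrow> bool" where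
  "multilinear K M m N f \<longleftrightarrow>
     (\<forall>xs \<in> tuples M m. f xs \<in> carrier N) \<and>
     (\<forall>xs \<in> tuples M m. \<forall>i < m. (\<lambda>x. f (xs[i := x])) \<in> module_hom K M N)"

locale leibniz_n_algebra = vectorspace K g
  for K (structure) and g (structure) +
  fixes n :: nat and br :: "'c list \<Rightarrow> 'c"
  assumes br_multilinear: "multilinear K g n g br"
    and leibniz_identity:
      "\<lbrakk>xs \<in> tuples g n; ys \<in> tuples g (n - 1)\<rbrakk> \<Longrightarrow>
         br (br xs # ys) = (\<Oplus>\<^bsub>g\<^esub> i \<in> {..<n}. br (xs[i := br (xs ! i # ys)]))"

locale filippov_n_algebra = leibniz_n_algebra +
  assumes antisymmetric:
    "\<lbrakk>xs \<in> tuples g n; i < n; j < n; i \<noteq> j\<rbrakk> \<Longrightarrow> br (xs[i := xs ! j, j := xs ! i]) = \<ominus>\<^bsub>g\<^esub> br xs"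

text \<open>In the next two definitions \<open>H\<close> is either \<open>D\<^sub>n(g)\<close> or \<open>L\<^sub>n(g)\<close>, and \<open>p\<close> sends
  \<open>[x\<^sub>1, \<dots>, x\<^sub>n\<^sub>-\<^sub>1]\<close> to the pure tensor, respectively wedge, of its entries.\<close>

definition induced_bracket ::
    "('k, 'r) ring_scheme \<Rightarrow> ('k, 'a, 'm) module_scheme \<Rightarrow> nat \<Rightarrow> ('a list \<Rightarrow> 'a)
      \<Rightarrow> ('k, ('a list \<Rightarrow> 'k) set) module \<Rightarrow> ('a list \<Rightarrow> ('a list \<Rightarrow> 'k) set)
      \<Rightarrow> ('a list \<Rightarrow> 'k) set \<Rightarrow> ('a list \<Rightarrow> 'k) set \<Rightarrow> ('a list \<Rightarrow> 'k) set" where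
  "induced_bracket K g n br H p A B =
     presented_lift K (tuples g (n - 1)) H
       (\<lambda>as. presented_lift K (tuples g (n - 1)) H
          (\<lambda>bs. \<Oplus>\<^bsub>H\<^esub> i \<in> {..<n - 1}. p (as[i := br (as ! i # bs)])) B) A"

definition induced_action ::
    "('k, 'r) ring_scheme \<Rightarrow> ('k, 'a, 'm) module_scheme \<Rightarrow> nat \<Rightarrow> ('a list \<Rightarrow> 'a)
      \<Rightarrow> 'a \<Rightarrow> ('a list \<Rightarrow> 'k) set \<Rightarrow> 'a" where
  "induced_action K g n br v A =
     presented_lift K (tuples g (n - 1)) g (\<lambda>xs. br (v # xs)) A"

definition D_alg ::
    "('k, 'r) ring_scheme \<Rightarrow> ('k, 'a, 'm) module_scheme \<Rightarrow> nat \<Rightarrow> ('k, ('a list \<Rightarrow> 'k) set) module"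
  where
  "D_alg K g n = tensor_power K g (n - 1)"

definition D_bracket ::
    "('k, 'r) ring_scheme \<Rightarrow> ('k, 'a, 'm) module_scheme \<Rightarrow> nat \<Rightarrow> ('a list \<Rightarrow> 'a)
      \<Rightarrow> ('a list \<Rightarrow> 'k) set \<Rightarrow> ('a list \<Rightarrow> 'k) set \<Rightarrow> ('a list \<Rightarrow> 'k) set" where
  "D_bracket K g n br = induced_bracket K g n br (D_alg K g n) (tensor K g (n - 1))"

definition L_alg ::
    "('k, 'r) ring_scheme \<Rightarrow> ('k, 'a, 'm) module_scheme \<Rightarrow> nat \<Rightarrow> ('k, ('a list \<Rightarrow> 'k) set) module"
  where
  "L_alg K g n = exterior_power K g (n - 1)"

definition L_bracket ::
    "('k, 'r) ring_scheme \<Rightarrow> ('k, 'a, 'm) module_scheme \<Rightarrow> nat \<Rightarrow> ('a list \<Rightarrow> 'a)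
      \<Rightarrow> ('a list \<Rightarrow> 'k) set \<Rightarrow> ('a list \<Rightarrow> 'k) set \<Rightarrow> ('a list \<Rightarrow> 'k) set" where
  "L_bracket K g n br = induced_bracket K g n br (L_alg K g n) (wedge K g (n - 1))"

definition D_to_L ::
    "('k, 'r) ring_scheme \<Rightarrow> ('k, 'a, 'm) module_scheme \<Rightarrow> nat
      \<Rightarrow> ('a list \<Rightarrow> 'k) set \<Rightarrow> ('a list \<Rightarrow> 'k) set" where
  "D_to_L K g n = presented_lift K (tuples g (n - 1)) (L_alg K g n) (wedge K g (n - 1))"


section \<open>The Loday complex\<close>

definition delete_nth :: "nat \<Rightarrow> 'x list \<Rightarrow> 'x list" where
  "delete_nth j xs = take j xs @ drop (Suc j) xs"

text \<open>List positions start at 0, so the sign \<open>(-1)\<^sup>j\<close> of the usual formula, with \<open>j\<close> counted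
  from 1, becomes \<open>(-1)\<^sup>j\<^sup>+\<^sup>1\<close>. The value at \<open>k = 0\<close>, where \<open>k - 1 = 0\<close>, is not used as a
  differential.\<close>

definition loday_differential ::
    "('k, 'r) ring_scheme \<Rightarrow> ('k, 'a, 'm) module_scheme \<Rightarrow> ('k, 'h, 'l) module_scheme
      \<Rightarrow> ('h \<Rightarrow> 'h \<Rightarrow> 'h) \<Rightarrow> ('a \<Rightarrow> 'h \<Rightarrow> 'a)
      \<Rightarrow> nat \<Rightarrow> ('a \<times> 'h list \<Rightarrow> 'k) set \<Rightarrow> ('a \<times> 'h list \<Rightarrow> 'k) set" where
  "loday_differential K g H brk act k =
     (let C = mixed_tensor_product K g H (k - 1);
          t = mixed_tensor K g H (k - 1);
          sg = (\<lambda>j. (\<ominus>\<^bsub>K\<^esub> \<one>\<^bsub>K\<^esub>) [^]\<^bsub>K\<^esub> Suc j)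
      in presented_lift K (mixed_tuples g H k) C
           (\<lambda>(v, hs).
              (\<Oplus>\<^bsub>C\<^esub> j \<in> {..<k}. sg j \<odot>\<^bsub>C\<^esub> t (act v (hs ! j), delete_nth j hs)) \<oplus>\<^bsub>C\<^esub>
              (\<Oplus>\<^bsub>C\<^esub> j \<in> {..<k}. \<Oplus>\<^bsub>C\<^esub> i \<in> {..<j}.
                 sg j \<odot>\<^bsub>C\<^esub> t (v, delete_nth j (hs[i := brk (hs ! i) (hs ! j)])))))"

text \<open>Complexes \<open>C\<close> are indexed by \<open>k \<ge> 0\<close>, with \<open>d k\<close> going from degree \<open>k\<close> to degree
  \<open>k - 1\<close>; everything in degree 0 is a cycle.\<close>

definition cycles ::
    "(nat \<Rightarrow> ('k, 'c) module) \<Rightarrow> (nat \<Rightarrow> 'c \<Rightarrow> 'c) \<Rightarrow> nat \<Rightarrow> 'c set" where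
  "cycles C d k = (if k = 0 then carrier (C 0) else a_kernel (C k) (C (k - 1)) (d k))"

definition boundaries ::
    "(nat \<Rightarrow> ('k, 'c) module) \<Rightarrow> (nat \<Rightarrow> 'c \<Rightarrow> 'c) \<Rightarrow> nat \<Rightarrow> 'c set" where
  "boundaries C d k = d (Suc k) ` carrier (C (Suc k))"

definition homology ::
    "('k, 'r) ring_scheme \<Rightarrow> (nat \<Rightarrow> ('k, 'c) module) \<Rightarrow> (nat \<Rightarrow> 'c \<Rightarrow> 'c) \<Rightarrow> nat
      \<Rightarrow> ('k, 'c set) module" where
  "homology K C d k = quotient_module K ((C k)\<lparr>carrier := cycles C d k\<rparr>) (boundaries C d k)"

definition homology_map ::
    "(nat \<Rightarrow> ('k, 'c) module) \<Rightarrow> (nat \<Rightarrow> 'c \<Rightarrow> 'c) \<Rightarrow> (nat \<Rightarrow> 'b \<Rightarrow> 'c) \<Rightarrow> nat \<Rightarrow> 'b set \<Rightarrow> 'c set"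
  where
  "homology_map C d f k Z = the_elem ((\<lambda>z. boundaries C d k +>\<^bsub>C k\<^esub> f k z) ` Z)"


section \<open>The three homology theories of an \<open>n\<close>-Filippov algebra\<close>

definition nCL where
  "nCL K g n k = mixed_tensor_product K g (D_alg K g n) k"

definition nCL_d where
  "nCL_d K g n br =
     loday_differential K g (D_alg K g n) (D_bracket K g n br) (induced_action K g n br)"

definition nC where
  "nC K g n k = mixed_tensor_product K g (L_alg K g n) k"

definition nC_d where
  "nC_d K g n br =
     loday_differential K g (L_alg K g n) (L_bracket K g n br) (induced_action K g n br)"

definition chain_projection where
  "chain_projection K g n k =
     presented_lift K (mixed_tuples g (D_alg K g n) k) (nC K g n k)
       (\<lambda>(v, hs). mixed_tensor K g (L_alg K g n) k (v, map (D_to_L K g n) hs))"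

definition nC_rel where
  "nC_rel K g n k =
     (nCL K g n (Suc k))
       \<lparr>carrier := a_kernel (nCL K g n (Suc k)) (nC K g n (Suc k)) (chain_projection K g n (Suc k))\<rparr>"

definition nC_rel_d where
  "nC_rel_d K g n br k = nCL_d K g n br (Suc k)"

definition nHL where
  "nHL K g n br = homology K (nCL K g n) (nCL_d K g n br)"

definition nHLie where
  "nHLie K g n br = homology K (nC K g n) (nC_d K g n br)"

definition nHrel where
  "nHrel K g n br = homology K (nC_rel K g n) (nC_rel_d K g n br)"

definition HL_to_HLie where
  "HL_to_HLie K g n br = homology_map (nC K g n) (nC_d K g n br) (chain_projection K g n)"

definition exact_at where
  "exact_at A f B h C \<longleftrightarrow> f ` carrier A = a_kernel B C h"

end

theory Submission
  imports Defs
begin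

text \<open>The sequence is the long exact homology sequence of the short exact sequence of complexes \<open>0
  \<rightarrow> ker \<pi> \<rightarrow> CL(D\<^sub>n(g), g) \<rightarrow> CL(L\<^sub>n(g), g) \<rightarrow> 0\<close>, where \<open>\<pi>\<close> is the canonical projection. In degree 0
  both complexes are \<open>g\<close> and \<open>\<pi>\<close> is an isomorphism, so \<open>ker \<pi>\<close> starts in degree 1 and the shifted
  complex of the statement is all of it. This also explains the right end: the last relative term
  is \<open>H\<^sup>r\<^sup>e\<^sup>l\<^sub>0 \<rightarrow> HL\<^sub>1\<close>, which leaves a surjection in degree 1 and a bijection in degree 0. The
  diagram chase is \<open>exact_at_total\<close>, \<open>exact_at_target\<close> and \<open>exact_at_relative\<close>, together with
  \<open>projection_1_surj\<close> and \<open>projection_0_bij\<close>.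

  The substance is that the objects in the sequence exist: tensor and exterior powers are
  quotients of free modules by relations, so every map out of them has to be shown to respect the
  relations, and one needs \<open>d\<^sup>2 = 0\<close> and \<open>\<pi> d = d \<pi>\<close>.

  A map given on generators of a presented module extends linearly as soon as it is linear in each
  slot (\<open>lift_hom\<close>, \<open>mixed_lift_hom\<close>). Conversely, if a linear map with the prescribed values on
  generators is already at hand, it is the lift (\<open>presented_lift_eqI\<close>); this disposes of the
  nested lifts in the bracket. For an exterior power the map must also vanish on tuples with a
  repetition. For fixed \<open>v\<close> the map
  \<open>(x\<^sub>1, \<dots>, x\<^sub>n\<^sub>-\<^sub>1) \<mapsto> [v, x\<^sub>1, \<dots>, x\<^sub>n\<^sub>-\<^sub>1]\<close> does, because an antisymmetric operation
  vanishes on repeated arguments when 2 is invertible (\<open>br_repeated\<close>). The bracket \<open>[A, B]\<close> is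
  obtained from the action of \<open>B\<close> alone: it is the value at \<open>A\<close> of the derivation that extends the
  endomorphism \<open>v \<mapsto> [v, B]\<close> of \<open>g\<close> (\<open>brk_eq_derivation\<close>). So the Leibniz identity of \<open>D\<^sub>n(g)\<close> and
  \<open>L\<^sub>n(g)\<close> reduces to the fact that the commutator of two derivations extends the commutator of
  the endomorphisms (\<open>derivation_commutator\<close>), and the compatibility of bracket and action is the
  fundamental identity of \<open>g\<close> (\<open>act_act\<close>).

  For \<open>d\<^sup>2 = 0\<close> the differential is written recursively. If \<open>x \<otimes> a\<close> denotes \<open>x\<close> with a factor \<open>a\<close>
  appended, and \<open>\<theta>\<^sub>a\<close> is the action of \<open>a\<close> on \<open>V \<otimes> H\<^sup>\<otimes>\<^sup>k\<close> by derivations, then \<open>d(x \<otimes> a) = dx \<otimes> a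
  \<plusminus> \<theta>\<^sub>a x\<close> (\<open>d_append\<close>). By induction on the degree \<open>\<theta>\<close> is a representation (\<open>act_C_commutator\<close>)
  and commutes with \<open>d\<close> (\<open>d_act_C\<close>); the two terms of \<open>d\<^sup>2(x \<otimes> a)\<close> that remain carry opposite
  signs and cancel (\<open>d_d\<close>).\<close>

section \<open>Linear maps\<close>

lemma mod_homI:
  assumes "module K M" "module K N"
    and "\<And>x. x \<in> carrier M \<Longrightarrow> f x \<in> carrier N"
    and "\<And>x y. x \<in> carrier M \<Longrightarrow> y \<in> carrier M \<Longrightarrow> f (x \<oplus>\<^bsub>M\<^esub> y) = f x \<oplus>\<^bsub>N\<^esub> f y"
    and "\<And>a x. a \<in> carrier K \<Longrightarrow> x \<in> carrier M \<Longrightarrow> f (a \<odot>\<^bsub>M\<^esub> x) = a \<odot>\<^bsub>N\<^esub> f x"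
  shows "mod_hom K M N f"
  using assms by (auto simp: mod_hom_def mod_hom_axioms_def module_hom_def)

lemma mod_hom_iff:
  assumes "module K M" "module K N"
  shows "mod_hom K M N f \<longleftrightarrow> f \<in> module_hom K M N"
  using assms by (auto simp: mod_hom_def mod_hom_axioms_def)

lemma
  assumes "mod_hom K M N f"
  shows hom_closed: "x \<in> carrier M \<Longrightarrow> f x \<in> carrier N"
    and hom_add: "x \<in> carrier M \<Longrightarrow> y \<in> carrier M \<Longrightarrow> f (x \<oplus>\<^bsub>M\<^esub> y) = f x \<oplus>\<^bsub>N\<^esub> f y"
    and hom_smult: "a \<in> carrier K \<Longrightarrow> x \<in> carrier M \<Longrightarrow> f (a \<odot>\<^bsub>M\<^esub> x) = a \<odot>\<^bsub>N\<^esub> f x"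
    and hom_zero: "f \<zero>\<^bsub>M\<^esub> = \<zero>\<^bsub>N\<^esub>"
    and hom_minus: "x \<in> carrier M \<Longrightarrow> y \<in> carrier M \<Longrightarrow> f (x \<ominus>\<^bsub>M\<^esub> y) = f x \<ominus>\<^bsub>N\<^esub> f y"
    and hom_dom: "module K M"
    and hom_cod: "module K N"
proof -
  interpret f: mod_hom K M N f by fact
  show "x \<in> carrier M \<Longrightarrow> f x \<in> carrier N"
    and "x \<in> carrier M \<Longrightarrow> y \<in> carrier M \<Longrightarrow> f (x \<oplus>\<^bsub>M\<^esub> y) = f x \<oplus>\<^bsub>N\<^esub> f y"
    and "a \<in> carrier K \<Longrightarrow> x \<in> carrier M \<Longrightarrow> f (a \<odot>\<^bsub>M\<^esub> x) = a \<odot>\<^bsub>N\<^esub> f x"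
    and "f \<zero>\<^bsub>M\<^esub> = \<zero>\<^bsub>N\<^esub>"
    and "x \<in> carrier M \<Longrightarrow> y \<in> carrier M \<Longrightarrow> f (x \<ominus>\<^bsub>M\<^esub> y) = f x \<ominus>\<^bsub>N\<^esub> f y"
    by simp_all
  show "module K M" "module K N" by (rule f.M.module_axioms f.N.module_axioms)+
qed

lemma mod_hom_cong:
  assumes "mod_hom K M N f" "\<And>x. x \<in> carrier M \<Longrightarrow> f x = h x"
  shows "mod_hom K M N h"
proof -
  interpret mod_hom K M N f by fact
  show ?thesis
    by (rule mod_homI) (use assms(2) M.module_axioms N.module_axioms in \<open>auto simp flip: assms(2)\<close>)
qed

lemma mod_hom_comp:
  assumes "mod_hom K M N f" "mod_hom K N P h"
  shows "mod_hom K M P (\<lambda>x. h (f x))"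
proof -
  interpret f: mod_hom K M N f by fact
  interpret h: mod_hom K N P h by fact
  show ?thesis
    by (rule mod_homI) (auto intro: f.M.module_axioms h.N.module_axioms)
qed

lemma mod_hom_zero:
  assumes "module K M" "module K N"
  shows "mod_hom K M N (\<lambda>x. \<zero>\<^bsub>N\<^esub>)"
proof -
  interpret M: module K M by fact
  interpret N: module K N by fact
  show ?thesis by (rule mod_homI) (use assms in auto)
qed

lemma mod_hom_id:
  assumes "module K M"
  shows "mod_hom K M M (\<lambda>x. x)"
  by (rule mod_homI) (use assms in auto)

lemma mod_hom_plus:
  assumes "mod_hom K M N f" "mod_hom K M N h"
  shows "mod_hom K M N (\<lambda>x. f x \<oplus>\<^bsub>N\<^esub> h x)"
proof -
  interpret f: mod_hom K M N f by fact
  interpret h: mod_hom K M N h by fact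
  show ?thesis
    by (rule mod_homI)
      (auto intro: f.M.module_axioms f.N.module_axioms simp: f.N.M.a_ac f.N.smult_r_distr)
qed

lemma mod_hom_scale:
  assumes "mod_hom K M N f" "a \<in> carrier K"
  shows "mod_hom K M N (\<lambda>x. a \<odot>\<^bsub>N\<^esub> f x)"
proof -
  interpret f: mod_hom K M N f by fact
  have "a \<odot>\<^bsub>N\<^esub> (b \<odot>\<^bsub>N\<^esub> f x) = b \<odot>\<^bsub>N\<^esub> (a \<odot>\<^bsub>N\<^esub> f x)"
    if "b \<in> carrier K" "x \<in> carrier M" for b x
    using that assms(2) by (simp add: f.N.smult_assoc1[symmetric] f.M.R.m_comm)
  then show ?thesis
    by (intro mod_homI)
      (use assms(2) in \<open>auto intro: f.M.module_axioms f.N.module_axioms simp: f.N.smult_r_distr\<close>)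
qed

lemma mod_hom_finsum:
  assumes "module K M" "module K N" "finite I" "\<And>i. i \<in> I \<Longrightarrow> mod_hom K M N (f i)"
  shows "mod_hom K M N (\<lambda>x. \<Oplus>\<^bsub>N\<^esub>i\<in>I. f i x)"
  using assms(3,4)
proof (induction I rule: finite_induct)
  case empty
  interpret N: module K N by fact
  show ?case using mod_hom_zero[OF assms(1,2)] by simp
next
  case (insert i I)
  interpret N: module K N by fact
  interpret fi: mod_hom K M N "f i" using insert by auto
  have "mod_hom K M N (\<lambda>x. f i x \<oplus>\<^bsub>N\<^esub> (\<Oplus>\<^bsub>N\<^esub>i\<in>I. f i x))"
    using insert by (intro mod_hom_plus) auto
  then show ?case
  proof (rule mod_hom_cong)
    fix x assume x: "x \<in> carrier M"
    have "f j x \<in> carrier N" if "j \<in> I" for j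
    proof -
      interpret fj: mod_hom K M N "f j" using insert that by auto
      show ?thesis using x by auto
    qed
    then show "f i x \<oplus>\<^bsub>N\<^esub> (\<Oplus>\<^bsub>N\<^esub>i\<in>I. f i x) = (\<Oplus>\<^bsub>N\<^esub>i\<in>insert i I. f i x)"
      using insert x by (subst N.finsum_insert) auto
  qed
qed

lemma finsum_mod_hom:
  assumes "mod_hom K M N f" "\<And>i. i \<in> I \<Longrightarrow> u i \<in> carrier M"
  shows "f (\<Oplus>\<^bsub>M\<^esub>i\<in>I. u i) = (\<Oplus>\<^bsub>N\<^esub>i\<in>I. f (u i))"
proof (cases "finite I")
  case True
  interpret f: mod_hom K M N f by fact
  from True assms(2) show ?thesis
  proof (induction I rule: finite_induct)
    case (insert i I)
    have "f (\<Oplus>\<^bsub>M\<^esub>i\<in>insert i I. u i) = f (u i \<oplus>\<^bsub>M\<^esub> (\<Oplus>\<^bsub>M\<^esub>i\<in>I. u i))"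
      using insert by (subst f.M.M.finsum_insert) auto
    also have "\<dots> = f (u i) \<oplus>\<^bsub>N\<^esub> (\<Oplus>\<^bsub>N\<^esub>i\<in>I. f (u i))"
      using insert by (simp add: f.M.M.finsum_closed)
    also have "\<dots> = (\<Oplus>\<^bsub>N\<^esub>i\<in>insert i I. f (u i))"
      using insert by (subst f.N.M.finsum_insert) auto
    finally show ?case .
  qed simp
next
  case False
  interpret f: mod_hom K M N f by fact
  show ?thesis using False by (simp add: f.M.M.finsum_infinite f.N.M.finsum_infinite)
qed

lemma a_kernel_eq: "a_kernel M N f = {x \<in> carrier M. f x = \<zero>\<^bsub>N\<^esub>}"
  by (auto simp: a_kernel_def kernel_def)

lemma submodule_kernel:
  assumes "mod_hom K M N f"
  shows "submodule K (a_kernel M N f) M"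
  using mod_hom.ker_is_submodule[OF assms] by (simp add: a_kernel_eq mod_hom.ker_def[OF assms])

lemma submodule_image:
  assumes "mod_hom K M N f"
  shows "submodule K (f ` carrier M) N"
  using mod_hom.im_is_submodule[OF assms] by (simp add: mod_hom.im_def[OF assms])

lemma submodule_md:
  assumes "submodule K S M"
  shows "module K (M\<lparr>carrier := S\<rparr>)"
  using module.submodule_is_module[OF submodule.module[OF assms] assms] .

lemma mod_hom_md_dom:
  assumes "mod_hom K M N f" "submodule K S M"
  shows "mod_hom K (M\<lparr>carrier := S\<rparr>) N f"
proof -
  interpret f: mod_hom K M N f by fact
  interpret S: submodule K S M by fact
  have "x \<in> carrier M" if "x \<in> S" for x using S.subset that by auto
  then show ?thesis
    by (intro mod_homI) (use submodule_md[OF assms(2)] f.N.module_axioms in auto)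
qed

lemma mod_hom_md_cod:
  assumes "mod_hom K M N f" "submodule K T N" "\<And>x. x \<in> carrier M \<Longrightarrow> f x \<in> T"
  shows "mod_hom K M (N\<lparr>carrier := T\<rparr>) f"
proof -
  interpret f: mod_hom K M N f by fact
  show ?thesis
    by (intro mod_homI) (use submodule_md[OF assms(2)] f.M.module_axioms assms(3) in auto)
qed

lemma submodule_of_md:
  assumes "submodule K S M" "submodule K T M" "S \<subseteq> T"
  shows "submodule K S (M\<lparr>carrier := T\<rparr>)"
proof -
  interpret S: submodule K S M by fact
  show ?thesis
    by (rule submodule.intro) (use submodule_md[OF assms(2)] assms(3) in auto)
qed

section \<open>Quotient modules\<close>

text \<open>The module axioms are identities, so they pass to any structure that is the image of a
  module under a map compatible with the operations. This avoids computing with sums of cosets.\<close>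

lemma module_of_surjection:
  assumes "module K M" "p ` carrier M = carrier Q" "\<zero>\<^bsub>Q\<^esub> = p \<zero>\<^bsub>M\<^esub>"
    and add: "\<And>x y. x \<in> carrier M \<Longrightarrow> y \<in> carrier M \<Longrightarrow> p x \<oplus>\<^bsub>Q\<^esub> p y = p (x \<oplus>\<^bsub>M\<^esub> y)"
    and smult: "\<And>a x. a \<in> carrier K \<Longrightarrow> x \<in> carrier M \<Longrightarrow> a \<odot>\<^bsub>Q\<^esub> p x = p (a \<odot>\<^bsub>M\<^esub> x)"
  shows "module K Q"
proof -
  interpret M: module K M by fact
  have cring: "cring K" by unfold_locales
  have mem: "p x \<in> carrier Q" if "x \<in> carrier M" for x using that assms(2) by auto
  note facts = add smult mem assms(3) M.add.m_assoc M.smult_l_distr M.smult_r_distr M.smult_assoc1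
  show ?thesis
  proof (rule module_criteria; (intro allI impI ballI)?; (elim conjE)?; (unfold assms(2)[symmetric])?)
    fix v w assume "v \<in> p ` carrier M" "w \<in> p ` carrier M"
    then show "v \<oplus>\<^bsub>Q\<^esub> w = w \<oplus>\<^bsub>Q\<^esub> v" by (auto simp: facts M.add.m_comm)
  next
    fix v assume "v \<in> p ` carrier M"
    then obtain x where "x \<in> carrier M" "v = p x" by auto
    then show "\<exists>neg_v\<in>p ` carrier M. v \<oplus>\<^bsub>Q\<^esub> neg_v = \<zero>\<^bsub>Q\<^esub>"
      by (intro bexI[of _ "p (\<ominus>\<^bsub>M\<^esub> x)"]) (auto simp: add mem assms(3) M.M.r_neg)
  qed (auto simp: facts cring)
qed

lemma submodule_subgroup:
  assumes "submodule K S M"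
  shows "subgroup S (add_monoid M)"
proof -
  interpret S: submodule K S M by fact
  interpret M: module K M by (rule S.module)
  have "\<ominus>\<^bsub>M\<^esub> x \<in> S" if "x \<in> S" for x
    using S.smult_closed[of "\<ominus>\<^bsub>K\<^esub> \<one>\<^bsub>K\<^esub>" x] that subsetD[OF S.subset that]
    by (simp add: M.smult_l_minus)
  then show ?thesis using S.subset by (intro subgroup.intro) (auto simp flip: a_inv_def)
qed

locale module_quotient =
  fixes K and M (structure) and S
  assumes sub: "submodule K S M"
begin

sublocale M: module K M using sub by (rule submodule.module)
sublocale S: submodule K S M by (rule sub)

sublocale S: abelian_subgroup S M
  using submodule_subgroup[OF sub]
  by (intro abelian_subgroupI3 additive_subgroupI M.abelian_group_axioms)

lemma S_carrier: "x \<in> S \<Longrightarrow> x \<in> carrier M"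
  using S.subset by auto

lemma coset_eq_iff:
  assumes "x \<in> carrier M" "y \<in> carrier M"
  shows "S +> x = S +> y \<longleftrightarrow> x \<ominus>\<^bsub>M\<^esub> y \<in> S"
proof
  assume "S +> x = S +> y"
  then have "x \<in> S +> y" using S.a_rcos_self[OF assms(1)] by simp
  then obtain s where s: "s \<in> S" "x = s \<oplus>\<^bsub>M\<^esub> y" by (auto simp: a_r_coset_def')
  then have "x \<ominus>\<^bsub>M\<^esub> y = s" using assms S_carrier[OF s(1)]
    by (simp add: a_minus_def M.add.m_assoc M.M.r_neg)
  then show "x \<ominus>\<^bsub>M\<^esub> y \<in> S" using s by simp
next
  assume "x \<ominus>\<^bsub>M\<^esub> y \<in> S"
  moreover have "x = (x \<ominus>\<^bsub>M\<^esub> y) \<oplus>\<^bsub>M\<^esub> y" using assms by (simp add: a_minus_def M.add.m_assoc M.M.l_neg)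
  ultimately have "x \<in> S +> y" by (auto simp: a_r_coset_def')
  then show "S +> x = S +> y"
    using M.a_repr_independence[OF _ assms(2) S.a_subgroup] by simp
qed

lemma coset_zero_iff: "x \<in> carrier M \<Longrightarrow> S +> x = S \<longleftrightarrow> x \<in> S"
  using M.a_coset_join1[OF _ _ S.a_subgroup] M.a_coset_join2[OF _ S.a_subgroup] by blast

lemma mem_coset: "z \<in> S +> x \<longleftrightarrow> (\<exists>s \<in> S. z = s \<oplus>\<^bsub>M\<^esub> x)"
  by (auto simp: a_r_coset_def')

abbreviation Q where "Q \<equiv> quotient_module K M S"

lemma carrier_Q: "carrier Q = (\<lambda>x. S +> x) ` carrier M"
  by (auto simp: quotient_module_def A_RCOSETS_def')

lemma zero_Q: "\<zero>\<^bsub>Q\<^esub> = S"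
  by (simp add: quotient_module_def)

lemma add_Q:
  assumes "x \<in> carrier M" "y \<in> carrier M"
  shows "(S +> x) \<oplus>\<^bsub>Q\<^esub> (S +> y) = S +> (x \<oplus>\<^bsub>M\<^esub> y)"
  using S.a_rcos_sum[OF assms] by (simp add: quotient_module_def)

text \<open>The union in the definition of the scalar multiplication is constant: for every \<open>z\<close> in the
  coset of \<open>x\<close> the difference \<open>a z - a x\<close> is \<open>a\<close> times an element of \<open>S\<close>.\<close>

lemma smult_Q:
  assumes "a \<in> carrier K" "x \<in> carrier M"
  shows "a \<odot>\<^bsub>Q\<^esub> (S +> x) = S +> (a \<odot>\<^bsub>M\<^esub> x)"
proof -
  have "S +> (a \<odot>\<^bsub>M\<^esub> z) = S +> (a \<odot>\<^bsub>M\<^esub> x)" if "z \<in> S +> x" for z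
  proof -
    obtain s where s: "s \<in> S" "z = s \<oplus>\<^bsub>M\<^esub> x" using \<open>z \<in> S +> x\<close> by (auto simp: mem_coset)
    have "a \<odot>\<^bsub>M\<^esub> z \<ominus>\<^bsub>M\<^esub> a \<odot>\<^bsub>M\<^esub> x = a \<odot>\<^bsub>M\<^esub> s"
      using s S_carrier[OF s(1)] assms
      by (simp add: M.smult_r_distr a_minus_def M.add.m_assoc M.M.r_neg)
    then show ?thesis using s assms S_carrier[OF s(1)] by (subst coset_eq_iff) auto
  qed
  moreover have "x \<in> S +> x" using S.a_rcos_self assms by simp
  ultimately have "(\<lambda>z. S +> (a \<odot>\<^bsub>M\<^esub> z)) ` (S +> x) = {S +> (a \<odot>\<^bsub>M\<^esub> x)}" by blast
  then show ?thesis by (simp add: quotient_module_def)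
qed

lemma module_Q: "module K Q"
proof (rule module_of_surjection[where M = M and p = "\<lambda>x. S +> x"])
  show "module K M" by unfold_locales
  show "\<zero>\<^bsub>Q\<^esub> = S +> \<zero>\<^bsub>M\<^esub>" using S.subset by (simp add: zero_Q)
qed (auto simp: carrier_Q add_Q smult_Q)

lemma coset_hom: "mod_hom K M Q (\<lambda>x. S +> x)"
  by (rule mod_homI) (auto intro: M.module_axioms module_Q simp: carrier_Q add_Q smult_Q)

text \<open>A linear map that kills \<open>S\<close> is constant on cosets, so its image of a coset is a singleton
  and \<^const>\<open>the_elem\<close> picks the induced value. Lifts from presented modules and maps on homology are
  both of this form.\<close>

lemma
  assumes "mod_hom K M N f" "\<And>s. s \<in> S \<Longrightarrow> f s = \<zero>\<^bsub>N\<^esub>"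
  shows factor_map_coset: "\<And>x. x \<in> carrier M \<Longrightarrow> the_elem (f ` (S +> x)) = f x"
    and factor_map_hom: "mod_hom K Q N (\<lambda>Z. the_elem (f ` Z))"
proof -
  interpret f: mod_hom K M N f by fact
  show *: "the_elem (f ` (S +> x)) = f x" if x: "x \<in> carrier M" for x
  proof -
    have "f z = f x" if "z \<in> S +> x" for z
    proof -
      obtain s where s: "s \<in> S" "z = s \<oplus>\<^bsub>M\<^esub> x"
        using \<open>z \<in> S +> x\<close> by (auto simp: mem_coset)
      then show ?thesis using x S_carrier[OF s(1)] assms(2)[OF s(1)] by simp
    qed
    moreover have "x \<in> S +> x" using S.a_rcos_self x by simp
    ultimately have "f ` (S +> x) = {f x}" by blast
    then show ?thesis by simp
  qed
  show "mod_hom K Q N (\<lambda>Z. the_elem (f ` Z))"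
  proof (rule mod_homI)
    show "module K N" by (rule f.N.module_axioms)
    fix A assume "A \<in> carrier Q"
    then obtain x where x: "x \<in> carrier M" "A = S +> x" by (auto simp: carrier_Q)
    show "the_elem (f ` A) \<in> carrier N"
      unfolding x(2) *[OF x(1)] by (rule f.f_im[OF x(1)])
    show "the_elem (f ` (a \<odot>\<^bsub>Q\<^esub> A)) = a \<odot>\<^bsub>N\<^esub> the_elem (f ` A)" if "a \<in> carrier K" for a
      unfolding x(2) smult_Q[OF that x(1)] *[OF x(1)] *[OF M.smult_closed[OF that x(1)]]
      by (rule f.f_smult[OF that x(1)])
    fix B assume "B \<in> carrier Q"
    then obtain y where y: "y \<in> carrier M" "B = S +> y" by (auto simp: carrier_Q)
    show "the_elem (f ` (A \<oplus>\<^bsub>Q\<^esub> B)) = the_elem (f ` A) \<oplus>\<^bsub>N\<^esub> the_elem (f ` B)"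
      unfolding x(2) y(2) add_Q[OF x(1) y(1)] *[OF x(1)] *[OF y(1)] *[OF M.M.a_closed[OF x(1) y(1)]]
      by (rule f.f_add[OF x(1) y(1)])
  qed (rule module_Q)
qed

end

section \<open>Free and presented modules\<close>

lemma carrier_free_module:
  assumes "ring K"
  shows "carrier (free_module K X) = {u \<in> X \<rightarrow>\<^sub>E carrier K. finite {x \<in> X. u x \<noteq> \<zero>\<^bsub>K\<^esub>}}"
  by (simp add: free_module_def ring.func_space_def[OF assms])

lemma free_module_simps:
  assumes "ring K"
  shows "u \<oplus>\<^bsub>free_module K X\<^esub> v = (\<lambda>x\<in>X. u x \<oplus>\<^bsub>K\<^esub> v x)"
    and "a \<odot>\<^bsub>free_module K X\<^esub> u = (\<lambda>x\<in>X. a \<otimes>\<^bsub>K\<^esub> u x)"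
    and "\<zero>\<^bsub>free_module K X\<^esub> = (\<lambda>x\<in>X. \<zero>\<^bsub>K\<^esub>)"
  by (simp_all add: free_module_def ring.func_space_def[OF assms])

lemma module_free_module:
  assumes "cring K"
  shows "module K (free_module K X)"
proof -
  interpret cring K by fact
  interpret F: module K "func_space X" by (rule func_space_is_module)
  let ?S = "\<lambda>u. {x \<in> X. u x \<noteq> \<zero>\<^bsub>K\<^esub>}"
  let ?U = "{u \<in> carrier (func_space X). finite (?S u)}"
  have fs: "carrier (func_space X) = X \<rightarrow>\<^sub>E carrier K"
    "u \<oplus>\<^bsub>func_space X\<^esub> v = (\<lambda>x\<in>X. u x \<oplus>\<^bsub>K\<^esub> v x)"
    "a \<odot>\<^bsub>func_space X\<^esub> u = (\<lambda>x\<in>X. a \<otimes>\<^bsub>K\<^esub> u x)"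
    "\<zero>\<^bsub>func_space X\<^esub> = (\<lambda>x\<in>X. \<zero>\<^bsub>K\<^esub>)" for u v a
    by (simp_all add: func_space_def)
  have "submodule K ?U (func_space X)"
  proof (rule submodule.intro)
    show "module K (func_space X)" by (rule F.module_axioms)
    show "\<zero>\<^bsub>func_space X\<^esub> \<in> ?U" by (simp add: fs)
    show "?U \<subseteq> carrier (func_space X)" by blast
  next
    fix u v assume uv: "u \<in> ?U" "v \<in> ?U"
    have "?S (\<lambda>x\<in>X. u x \<oplus>\<^bsub>K\<^esub> v x) \<subseteq> ?S u \<union> ?S v" by auto
    then have "finite (?S (\<lambda>x\<in>X. u x \<oplus>\<^bsub>K\<^esub> v x))"
      by (rule finite_subset) (use uv in simp)
    moreover have "u \<oplus>\<^bsub>func_space X\<^esub> v \<in> carrier (func_space X)"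
      using uv by (intro F.M.a_closed) blast+
    ultimately show "u \<oplus>\<^bsub>func_space X\<^esub> v \<in> ?U" unfolding fs(2) by simp
  next
    fix a u assume au: "a \<in> carrier K" "u \<in> ?U"
    have "?S (\<lambda>x\<in>X. a \<otimes>\<^bsub>K\<^esub> u x) \<subseteq> ?S u" using au(1) by auto
    then have "finite (?S (\<lambda>x\<in>X. a \<otimes>\<^bsub>K\<^esub> u x))"
      by (rule finite_subset) (use au in simp)
    moreover have "a \<odot>\<^bsub>func_space X\<^esub> u \<in> carrier (func_space X)"
      using au by (intro F.smult_closed) blast+
    ultimately show "a \<odot>\<^bsub>func_space X\<^esub> u \<in> ?U" unfolding fs(3) by simp
  qed
  then show ?thesis
    using submodule_md[of K ?U "func_space X"] by (simp add: free_module_def)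
qed

lemma generator_in_free_module:
  assumes "ring K" "x \<in> X"
  shows "generator K X x \<in> carrier (free_module K X)"
proof -
  interpret ring K by fact
  have "finite {y \<in> X. (if y = x then \<one>\<^bsub>K\<^esub> else \<zero>\<^bsub>K\<^esub>) \<noteq> \<zero>\<^bsub>K\<^esub>}"
    by (rule finite_subset[of _ "{x}"]) auto
  then show ?thesis
    by (auto simp: carrier_free_module[OF assms(1)] generator_def cong: conj_cong)
qed

text \<open>Elements of the free module have finite support; induction on a finite set containing the
  support splits off one generator at a time.\<close>

lemma free_module_span_generators:
  assumes "cring K" "submodule K N (free_module K X)" "\<And>x. x \<in> X \<Longrightarrow> generator K X x \<in> N"
    and "u \<in> carrier (free_module K X)"
  shows "u \<in> N"
proof -
  interpret cring K by fact
  interpret N: submodule K N "free_module K X" by fact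
  note simps = carrier_free_module[OF ring_axioms] free_module_simps[OF ring_axioms]
  have "u \<in> N" if "finite A" "u \<in> X \<rightarrow>\<^sub>E carrier K" "{x \<in> X. u x \<noteq> \<zero>\<^bsub>K\<^esub>} \<subseteq> A" for A u
    using that
  proof (induction A arbitrary: u rule: finite_induct)
    case empty
    then have "u = \<zero>\<^bsub>free_module K X\<^esub>" by (auto simp: simps PiE_def extensional_def restrict_def)
    then show ?case by simp
  next
    case (insert x A)
    show ?case
    proof (cases "x \<in> X")
      case False
      then show ?thesis using insert by (intro insert.IH) auto
    next
      case True
      let ?v = "u(x := \<zero>\<^bsub>K\<^esub>)"
      have v: "?v \<in> N" using insert True by (intro insert.IH) (auto simp: PiE_def extensional_def)
      have "u y \<in> carrier K" if "y \<in> X" for y using insert.prems(1) that by auto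
      then have "u = u x \<odot>\<^bsub>free_module K X\<^esub> generator K X x \<oplus>\<^bsub>free_module K X\<^esub> ?v"
        using insert.prems(1) True
        by (auto simp: simps generator_def PiE_def extensional_def restrict_def fun_eq_iff)
      moreover have "u x \<in> carrier K" using insert.prems(1) True by auto
      ultimately show ?thesis
        using v assms(3)[OF True] N.m_closed N.smult_closed by metis
    qed
  qed
  then show ?thesis using assms(4) by (auto simp: simps)
qed

text \<open>The sum in \<^const>\<open>linear_extension\<close> ranges over the support of \<open>u\<close>, which differs for different
  arguments. Additivity needs a common finite index set.\<close>

lemma linear_extension_superset:
  assumes "module K N" "finite A" "A \<subseteq> X" "{x \<in> X. u x \<noteq> \<zero>\<^bsub>K\<^esub>} \<subseteq> A"
    and "\<And>x. x \<in> X \<Longrightarrow> f x \<in> carrier N" "\<And>x. x \<in> X \<Longrightarrow> u x \<in> carrier K"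
  shows "linear_extension K X N f u = (\<Oplus>\<^bsub>N\<^esub>x\<in>A. u x \<odot>\<^bsub>N\<^esub> f x)"
proof -
  interpret N: module K N by fact
  show ?thesis
    unfolding linear_extension_def
    by (rule N.add.finprod_mono_neutral_cong_left) (use assms in \<open>auto\<close>)
qed

lemma linear_extension_hom:
  assumes "module K N" "\<And>x. x \<in> X \<Longrightarrow> f x \<in> carrier N"
  shows "mod_hom K (free_module K X) N (linear_extension K X N f)"
proof -
  interpret N: module K N by fact
  note simps = carrier_free_module[OF N.R.ring_axioms] free_module_simps[OF N.R.ring_axioms]
  let ?F = "free_module K X" and ?e = "linear_extension K X N f"
  show ?thesis
  proof (rule mod_homI)
    show "module K ?F" by (rule module_free_module) unfold_locales
    show "module K N" by fact
    fix u assume u: "u \<in> carrier ?F"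
    let ?A = "{x \<in> X. u x \<noteq> \<zero>\<^bsub>K\<^esub>}"
    have uK: "u x \<in> carrier K" if "x \<in> X" for x using u that by (auto simp: simps)
    have A: "finite ?A" using u by (simp add: simps)
    show "?e u \<in> carrier N"
      unfolding linear_extension_def using uK assms(2) by (intro N.M.finsum_closed) auto
    show "?e (a \<odot>\<^bsub>?F\<^esub> u) = a \<odot>\<^bsub>N\<^esub> ?e u" if a: "a \<in> carrier K" for a
    proof -
      have "?e (a \<odot>\<^bsub>?F\<^esub> u) = (\<Oplus>\<^bsub>N\<^esub>x\<in>?A. (a \<odot>\<^bsub>?F\<^esub> u) x \<odot>\<^bsub>N\<^esub> f x)"
        using A a uK assms(2) by (intro linear_extension_superset assms) (auto simp: simps)
      also have "\<dots> = (\<Oplus>\<^bsub>N\<^esub>x\<in>?A. a \<odot>\<^bsub>N\<^esub> (u x \<odot>\<^bsub>N\<^esub> f x))"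
        using a uK assms(2) by (intro N.M.finsum_cong') (auto simp: simps N.smult_assoc1)
      also have "\<dots> = a \<odot>\<^bsub>N\<^esub> ?e u"
        using A a uK assms(2) unfolding linear_extension_def by (subst N.finsum_smult_ldistr) auto
      finally show ?thesis .
    qed
    fix v assume v: "v \<in> carrier ?F"
    let ?B = "{x \<in> X. v x \<noteq> \<zero>\<^bsub>K\<^esub>}"
    have vK: "v x \<in> carrier K" if "x \<in> X" for x using v that by (auto simp: simps)
    have B: "finite ?B" using v by (simp add: simps)
    have "?e (u \<oplus>\<^bsub>?F\<^esub> v) = (\<Oplus>\<^bsub>N\<^esub>x\<in>?A \<union> ?B. (u \<oplus>\<^bsub>?F\<^esub> v) x \<odot>\<^bsub>N\<^esub> f x)"
      using A B uK vK assms(2) by (intro linear_extension_superset assms) (auto simp: simps)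
    also have "\<dots> = (\<Oplus>\<^bsub>N\<^esub>x\<in>?A \<union> ?B. u x \<odot>\<^bsub>N\<^esub> f x \<oplus>\<^bsub>N\<^esub> v x \<odot>\<^bsub>N\<^esub> f x)"
      using uK vK assms(2) by (intro N.M.finsum_cong') (auto simp: simps N.smult_l_distr)
    also have "\<dots> = (\<Oplus>\<^bsub>N\<^esub>x\<in>?A \<union> ?B. u x \<odot>\<^bsub>N\<^esub> f x) \<oplus>\<^bsub>N\<^esub> (\<Oplus>\<^bsub>N\<^esub>x\<in>?A \<union> ?B. v x \<odot>\<^bsub>N\<^esub> f x)"
      using uK vK assms(2) by (intro N.M.finsum_addf) auto
    also have "(\<Oplus>\<^bsub>N\<^esub>x\<in>?A \<union> ?B. u x \<odot>\<^bsub>N\<^esub> f x) = ?e u"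
      using A B uK assms(2) by (intro linear_extension_superset[symmetric] assms) auto
    also have "(\<Oplus>\<^bsub>N\<^esub>x\<in>?A \<union> ?B. v x \<odot>\<^bsub>N\<^esub> f x) = ?e v"
      using A B vK assms(2) by (intro linear_extension_superset[symmetric] assms) auto
    finally show "?e (u \<oplus>\<^bsub>?F\<^esub> v) = ?e u \<oplus>\<^bsub>N\<^esub> ?e v" .
  qed
qed

lemma linear_extension_generator:
  assumes "module K N" "\<And>x. x \<in> X \<Longrightarrow> f x \<in> carrier N" "x \<in> X"
  shows "linear_extension K X N f (generator K X x) = f x"
proof -
  interpret N: module K N by fact
  have "linear_extension K X N f (generator K X x) = (\<Oplus>\<^bsub>N\<^esub>y\<in>{x}. generator K X x y \<odot>\<^bsub>N\<^esub> f y)"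
    by (rule linear_extension_superset) (use assms in \<open>auto simp: generator_def\<close>)
  also have "\<dots> = f x" using assms by (subst N.M.finsum_insert) (auto simp: generator_def)
  finally show ?thesis .
qed

locale presentation =
  fixes K and X :: "'x set" and R
  assumes cring: "cring K" and relations: "R \<subseteq> carrier (free_module K X)"
begin

abbreviation F where "F \<equiv> free_module K X"
abbreviation P where "P \<equiv> presented_module K X R"
abbreviation cls where "cls \<equiv> generator_class K X R"

sublocale F: module K F by (rule module_free_module[OF cring])

sublocale q: module_quotient K F "F.span R"
  by (rule module_quotient.intro) (rule F.span_is_submodule[OF relations])

lemma P_eq: "P = q.Q"
  by (simp add: presented_module_def)

sublocale P: module K P
  using q.module_Q by (simp add: P_eq)

lemma generator_closed: "x \<in> X \<Longrightarrow> generator K X x \<in> carrier F"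
  by (rule generator_in_free_module[OF F.R.ring_axioms])

lemma cls_closed [simp]: "x \<in> X \<Longrightarrow> cls x \<in> carrier P"
  using generator_closed by (auto simp: P_eq q.carrier_Q generator_class_def)

lemma coset_hom: "mod_hom K F P (\<lambda>u. F.span R +>\<^bsub>F\<^esub> u)"
  using q.coset_hom by (simp add: P_eq)

text \<open>The classes of the generators generate. Linear maps out of the presented module are
  therefore compared, and shown to be surjective, on generators.\<close>

lemma submodule_eq_carrier:
  assumes "submodule K N P" "\<And>x. x \<in> X \<Longrightarrow> cls x \<in> N"
  shows "N = carrier P"
proof
  interpret N: submodule K N P by fact
  interpret c: mod_hom K F P "\<lambda>u. F.span R +>\<^bsub>F\<^esub> u" by (rule coset_hom)
  show "N \<subseteq> carrier P" by (rule N.subset)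
  have "submodule K {u \<in> carrier F. F.span R +>\<^bsub>F\<^esub> u \<in> N} F"
    by (rule submodule.intro) (auto intro: F.module_axioms)
  moreover have "generator K X x \<in> {u \<in> carrier F. F.span R +>\<^bsub>F\<^esub> u \<in> N}" if "x \<in> X" for x
    using assms(2)[OF that] generator_closed[OF that] by (simp add: generator_class_def)
  ultimately have "F.span R +>\<^bsub>F\<^esub> u \<in> N" if "u \<in> carrier F" for u
    using free_module_span_generators[OF cring _ _ that] by blast
  then show "carrier P \<subseteq> N" by (auto simp: P_eq q.carrier_Q)
qed

lemma hom_eqI:
  assumes "mod_hom K P N f" "mod_hom K P N h" "\<And>x. x \<in> X \<Longrightarrow> f (cls x) = h (cls x)"
    and "A \<in> carrier P"
  shows "f A = h A"
proof -
  interpret f: mod_hom K P N f by fact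
  interpret h: mod_hom K P N h by fact
  have "submodule K {A \<in> carrier P. f A = h A} P"
    by (rule submodule.intro) (auto intro: P.module_axioms)
  from submodule_eq_carrier[OF this] assms(3,4) show ?thesis by auto
qed

lemma hom_surj:
  assumes "mod_hom K M P f" "\<And>x. x \<in> X \<Longrightarrow> cls x \<in> f ` carrier M"
  shows "f ` carrier M = carrier P"
  using submodule_eq_carrier[OF submodule_image[OF assms(1)]] assms(2) by auto

context
  fixes N and f
  assumes N: "module K N" and f: "\<And>x. x \<in> X \<Longrightarrow> f x \<in> carrier N"
    and kills: "\<And>r. r \<in> R \<Longrightarrow> linear_extension K X N f r = \<zero>\<^bsub>N\<^esub>"
begin

lemma linear_extension_span: "u \<in> F.span R \<Longrightarrow> linear_extension K X N f u = \<zero>\<^bsub>N\<^esub>"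
proof -
  note hom = linear_extension_hom[OF N f]
  have "F.span R \<subseteq> a_kernel F N (linear_extension K X N f)"
    by (rule F.span_is_subset[OF _ submodule_kernel[OF hom]])
      (use relations kills in \<open>auto simp: a_kernel_eq\<close>)
  then show "u \<in> F.span R \<Longrightarrow> linear_extension K X N f u = \<zero>\<^bsub>N\<^esub>" by (auto simp: a_kernel_eq)
qed

lemma presented_lift_hom: "mod_hom K P N (presented_lift K X N f)"
  using q.factor_map_hom[OF linear_extension_hom[OF N f] linear_extension_span]
  by (simp add: P_eq presented_lift_def[abs_def])

lemma presented_lift_cls: "x \<in> X \<Longrightarrow> presented_lift K X N f (cls x) = f x"
  using q.factor_map_coset[OF linear_extension_hom[OF N f] linear_extension_span]
    generator_closed linear_extension_generator[OF N f]
  by (simp add: presented_lift_def generator_class_def)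

end

end

lemma linearity_relations_closed:
  assumes "module K M" "\<And>x. x \<in> carrier M \<Longrightarrow> s x \<in> X"
  shows "linearity_relations K X M s \<subseteq> carrier (free_module K X)"
proof -
  interpret M: module K M by fact
  interpret F: module K "free_module K X" by (rule module_free_module) unfold_locales
  show ?thesis
    using assms(2) generator_in_free_module[OF M.R.ring_axioms, of _ X]
    by (auto simp: linearity_relations_def)
qed

text \<open>This turns the condition for a lift to exist into a statement about \<open>f\<close> itself: the
  relations of a slot are respected once \<open>f\<close> is linear in that slot.\<close>

lemma linear_extension_linearity_relation:
  assumes "mod_hom K M N (\<lambda>x. f (s x))" "\<And>x. x \<in> X \<Longrightarrow> f x \<in> carrier N"
    and "\<And>x. x \<in> carrier M \<Longrightarrow> s x \<in> X" "r \<in> linearity_relations K X M s"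
  shows "linear_extension K X N f r = \<zero>\<^bsub>N\<^esub>"
proof -
  let ?F = "free_module K X" and ?e = "linear_extension K X N f"
  interpret M: module K M using assms(1) by (simp add: mod_hom_def)
  have N: "module K N" using assms(1) by (simp add: mod_hom_def)
  interpret N: module K N by (rule N)
  interpret F: module K ?F by (rule module_free_module) (rule M.R.is_cring)
  have e: "mod_hom K ?F N ?e" by (rule linear_extension_hom[OF N assms(2)])
  obtain a x y where axy: "a \<in> carrier K" "x \<in> carrier M" "y \<in> carrier M"
    and r: "r = generator K X (s (a \<odot>\<^bsub>M\<^esub> x \<oplus>\<^bsub>M\<^esub> y)) \<ominus>\<^bsub>?F\<^esub>
        (a \<odot>\<^bsub>?F\<^esub> generator K X (s x) \<oplus>\<^bsub>?F\<^esub> generator K X (s y))"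
    using assms(4) unfolding linearity_relations_def by blast
  have g: "generator K X (s z) \<in> carrier ?F" if "z \<in> carrier M" for z
    by (rule generator_in_free_module[OF M.R.ring_axioms assms(3)[OF that]])
  have eg: "?e (generator K X (s z)) = f (s z)" if "z \<in> carrier M" for z
    by (rule linear_extension_generator[OF N assms(2) assms(3)[OF that]])
  have fs: "f (s z) \<in> carrier N" if "z \<in> carrier M" for z
    by (rule assms(2)[OF assms(3)[OF that]])
  have ax: "a \<odot>\<^bsub>M\<^esub> x \<in> carrier M" using axy by (intro M.smult_closed)
  have l: "a \<odot>\<^bsub>M\<^esub> x \<oplus>\<^bsub>M\<^esub> y \<in> carrier M" using ax axy by (intro M.M.a_closed)
  have ag: "a \<odot>\<^bsub>?F\<^esub> generator K X (s x) \<in> carrier ?F"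
    using axy g by (intro F.smult_closed)
  have "?e r = f (s (a \<odot>\<^bsub>M\<^esub> x \<oplus>\<^bsub>M\<^esub> y)) \<ominus>\<^bsub>N\<^esub> (a \<odot>\<^bsub>N\<^esub> f (s x) \<oplus>\<^bsub>N\<^esub> f (s y))"
    unfolding r hom_minus[OF e g[OF l] F.M.a_closed[OF ag g[OF axy(3)]]]
      hom_add[OF e ag g[OF axy(3)]] hom_smult[OF e axy(1) g[OF axy(2)]]
      eg[OF l] eg[OF axy(2)] eg[OF axy(3)] ..
  also have "f (s (a \<odot>\<^bsub>M\<^esub> x \<oplus>\<^bsub>M\<^esub> y)) = a \<odot>\<^bsub>N\<^esub> f (s x) \<oplus>\<^bsub>N\<^esub> f (s y)"
    using hom_add[OF assms(1) ax axy(3)] hom_smult[OF assms(1) axy(1,2)] by simp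
  finally show ?thesis
    using axy fs by (simp add: N.M.r_neg a_minus_def)
qed

context presentation
begin

text \<open>Each linearity relation imposes additivity and homogeneity at once; taking \<open>a = 1\<close> and \<open>x =
  y = 0\<close> first shows that \<open>s 0\<close> has class 0, and then \<open>y = 0\<close> isolates homogeneity.\<close>

lemma cls_linear:
  assumes "module K M" "\<And>x. x \<in> carrier M \<Longrightarrow> s x \<in> X" "linearity_relations K X M s \<subseteq> R"
  shows "mod_hom K M P (\<lambda>x. cls (s x))"
proof -
  interpret M: module K M by fact
  have s: "generator K X (s x) \<in> carrier F" if "x \<in> carrier M" for x
    by (rule generator_closed[OF assms(2)[OF that]])
  have sP: "cls (s x) \<in> carrier P" if "x \<in> carrier M" for x
    by (rule cls_closed[OF assms(2)[OF that]])
  have *: "cls (s (a \<odot>\<^bsub>M\<^esub> x \<oplus>\<^bsub>M\<^esub> y)) = a \<odot>\<^bsub>P\<^esub> cls (s x) \<oplus>\<^bsub>P\<^esub> cls (s y)"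
    if axy: "a \<in> carrier K" "x \<in> carrier M" "y \<in> carrier M" for a x y
  proof -
    let ?l = "generator K X (s (a \<odot>\<^bsub>M\<^esub> x \<oplus>\<^bsub>M\<^esub> y))"
    let ?r = "a \<odot>\<^bsub>F\<^esub> generator K X (s x) \<oplus>\<^bsub>F\<^esub> generator K X (s y)"
    have l: "?l \<in> carrier F" using axy by (intro s) auto
    have ag: "a \<odot>\<^bsub>F\<^esub> generator K X (s x) \<in> carrier F" using axy s by (intro F.smult_closed)
    have r: "?r \<in> carrier F" using ag s axy by (intro F.M.a_closed)
    have "?l \<ominus>\<^bsub>F\<^esub> ?r \<in> linearity_relations K X M s"
      using axy unfolding linearity_relations_def by blast
    then have "?l \<ominus>\<^bsub>F\<^esub> ?r \<in> F.span R"
      using assms(3) F.in_own_span[OF relations] by blast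
    then have "F.span R +>\<^bsub>F\<^esub> ?l = F.span R +>\<^bsub>F\<^esub> ?r"
      using q.coset_eq_iff[OF l r] by blast
    also have "\<dots> = a \<odot>\<^bsub>P\<^esub> cls (s x) \<oplus>\<^bsub>P\<^esub> cls (s y)"
      using hom_add[OF coset_hom ag s[OF axy(3)]]
        hom_smult[OF coset_hom axy(1) s[OF axy(2)]]
      by (simp add: generator_class_def)
    finally show ?thesis by (simp add: generator_class_def)
  qed
  have zero: "cls (s \<zero>\<^bsub>M\<^esub>) = \<zero>\<^bsub>P\<^esub>"
    using *[of "\<one>\<^bsub>K\<^esub>" "\<zero>\<^bsub>M\<^esub>" "\<zero>\<^bsub>M\<^esub>"] sP[of "\<zero>\<^bsub>M\<^esub>"] by (simp add: P.M.add.r_cancel_one)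
  show ?thesis
  proof (rule mod_homI)
    show "cls (s (x \<oplus>\<^bsub>M\<^esub> y)) = cls (s x) \<oplus>\<^bsub>P\<^esub> cls (s y)" if "x \<in> carrier M" "y \<in> carrier M" for x y
      using *[of "\<one>\<^bsub>K\<^esub>" x y] that sP by simp
    show "cls (s (a \<odot>\<^bsub>M\<^esub> x)) = a \<odot>\<^bsub>P\<^esub> cls (s x)" if "a \<in> carrier K" "x \<in> carrier M" for a x
      using *[of a x "\<zero>\<^bsub>M\<^esub>"] that sP by (simp add: zero)
  qed (use assms(1) P.module_axioms sP in auto)
qed

lemma cls_relation:
  assumes "generator K X x \<in> R" "x \<in> X"
  shows "cls x = \<zero>\<^bsub>P\<^esub>"
proof -
  have "generator K X x \<in> F.span R" using assms(1) F.in_own_span[OF relations] by auto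
  then show ?thesis
    using q.coset_zero_iff[OF generator_closed[OF assms(2)]]
    by (simp add: generator_class_def P_eq q.zero_Q)
qed

end

lemma tuples_update: "xs \<in> tuples M m \<Longrightarrow> x \<in> carrier M \<Longrightarrow> xs[i := x] \<in> tuples M m"
  using set_update_subset_insert[of xs i x] by (auto simp: tuples_def)

lemma tuples_length: "xs \<in> tuples M m \<Longrightarrow> length xs = m"
  by (simp add: tuples_def)

lemma tuples_nth: "xs \<in> tuples M m \<Longrightarrow> i < m \<Longrightarrow> xs ! i \<in> carrier M"
  by (auto simp: tuples_def)

lemma (in abelian_monoid) finsum_swap:
  assumes "finite A" "finite B" "\<And>i j. i \<in> A \<Longrightarrow> j \<in> B \<Longrightarrow> f i j \<in> carrier G"
  shows "(\<Oplus>i\<in>A. \<Oplus>j\<in>B. f i j) = (\<Oplus>j\<in>B. \<Oplus>i\<in>A. f i j)"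
  using assms(1,3)
proof (induction A rule: finite_induct)
  case empty
  then show ?case by simp
next
  case (insert a A)
  have "(\<Oplus>i\<in>insert a A. \<Oplus>j\<in>B. f i j) = (\<Oplus>j\<in>B. f a j) \<oplus> (\<Oplus>j\<in>B. \<Oplus>i\<in>A. f i j)"
    using insert by (subst finsum_insert) (auto intro!: finsum_closed)
  also have "\<dots> = (\<Oplus>j\<in>B. f a j \<oplus> (\<Oplus>i\<in>A. f i j))"
    using insert.prems by (intro finsum_addf[symmetric]) (auto intro!: finsum_closed)
  also have "\<dots> = (\<Oplus>j\<in>B. \<Oplus>i\<in>insert a A. f i j)"
    using insert by (intro finsum_cong') (auto intro!: finsum_closed)
  finally show ?case .
qed

context presentation
begin

text \<open>A linear map \<open>h\<close> defined on the presented module sends relations to 0, so \<open>f\<close>, which agrees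
  with \<open>h\<close> on generators, does as well.\<close>

lemma presented_lift_eqI:
  assumes h: "mod_hom K P N h" and f: "\<And>x. x \<in> X \<Longrightarrow> h (cls x) = f x" and A: "A \<in> carrier P"
  shows "presented_lift K X N f A = h A"
proof -
  have N: "module K N" by (rule hom_cod[OF h])
  interpret N: module K N by (rule N)
  have fN: "f x \<in> carrier N" if "x \<in> X" for x
    using hom_closed[OF h cls_closed[OF that]] f[OF that] by simp
  have hc: "mod_hom K F N (\<lambda>u. h (F.span R +>\<^bsub>F\<^esub> u))"
    by (rule mod_hom_comp[OF coset_hom h])
  have le: "mod_hom K F N (linear_extension K X N f)"
    by (rule linear_extension_hom[OF N fN])
  have hz: "h (F.span R) = \<zero>\<^bsub>N\<^esub>"
    using hom_zero[OF h] by (simp add: P_eq q.zero_Q)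
  have eq: "linear_extension K X N f u = h (F.span R +>\<^bsub>F\<^esub> u)" if "u \<in> carrier F" for u
  proof -
    let ?E = "{u \<in> carrier F. linear_extension K X N f u = h (F.span R +>\<^bsub>F\<^esub> u)}"
    have "submodule K ?E F"
      by (rule submodule.intro)
        (simp_all add: F.module_axioms hom_add[OF hc] hom_add[OF le] hom_smult[OF hc] hom_smult[OF le]
          hz hom_zero[OF le] subset_eq)
    moreover have "generator K X x \<in> ?E" if "x \<in> X" for x
      using linear_extension_generator[OF N fN that] f[OF that] generator_closed[OF that]
      by (simp add: generator_class_def)
    ultimately have "u \<in> ?E" by (rule free_module_span_generators[OF cring _ _ that])
    then show ?thesis by simp
  qed
  have kills: "linear_extension K X N f r = \<zero>\<^bsub>N\<^esub>" if "r \<in> R" for r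
  proof -
    have "r \<in> carrier F" "r \<in> F.span R" using that relations F.in_own_span[OF relations] by auto
    then show ?thesis
      using eq[of r] q.coset_zero_iff[of r] hz by simp
  qed
  show ?thesis
    using hom_eqI[OF presented_lift_hom[OF N fN kills] h _ A] presented_lift_cls[OF N fN kills] f
    by simp
qed

end

section \<open>Tensor and exterior powers\<close>

text \<open>The tensor power (\<open>alt\<close> false) and the exterior power (\<open>alt\<close> true) are treated together; the
  exterior power has the relations for repeated entries in addition.\<close>

locale module_power =
  fixes K and M (structure) and m :: nat and alt :: bool
  assumes module_M: "module K M"
begin

sublocale M: module K M by (rule module_M)

abbreviation X where "X \<equiv> tuples M m"

definition R where
  "R = tensor_relations K M m \<union> (if alt then alternating_relations K M m else {})"

lemma R_closed: "R \<subseteq> carrier (free_module K X)"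
proof -
  have "linearity_relations K X M (\<lambda>x. xs[i := x]) \<subseteq> carrier (free_module K X)" if "xs \<in> X" for xs i
    by (rule linearity_relations_closed[OF module_M]) (rule tuples_update[OF that])
  moreover have "generator K X xs \<in> carrier (free_module K X)" if "xs \<in> X" for xs
    by (rule generator_in_free_module[OF M.R.ring_axioms that])
  ultimately show ?thesis
    unfolding R_def tensor_relations_def alternating_relations_def by auto
qed

sublocale presentation K X R
  by (rule presentation.intro[OF M.R.is_cring R_closed])

lemma cls_slot:
  assumes "xs \<in> X" "i < m"
  shows "mod_hom K M P (\<lambda>x. cls (xs[i := x]))"
proof (rule cls_linear[OF module_M])
  show "xs[i := x] \<in> X" if "x \<in> carrier M" for x by (rule tuples_update[OF assms(1) that])
  show "linearity_relations K X M (\<lambda>x. xs[i := x]) \<subseteq> R"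
    using assms unfolding R_def tensor_relations_def by blast
qed

lemma cls_repeated:
  assumes "alt" "xs \<in> X" "\<not> distinct xs"
  shows "cls xs = \<zero>\<^bsub>P\<^esub>"
proof (rule cls_relation)
  show "generator K X xs \<in> R"
    unfolding R_def alternating_relations_def using assms by auto
qed (rule assms(2))

text \<open>Polarisation: expand the class of a tuple with \<open>y + z\<close> in both positions, where the two
  terms with equal entries vanish.\<close>

lemma cls_antisymmetric:
  assumes alt "xs \<in> X" "i < m" "j < m" "i \<noteq> j" "y \<in> carrier M" "z \<in> carrier M"
  shows "cls (xs[i := y, j := z]) \<oplus>\<^bsub>P\<^esub> cls (xs[i := z, j := y]) = \<zero>\<^bsub>P\<^esub>"
proof -
  have X: "xs[i := a, j := b] \<in> X" if "a \<in> carrier M" "b \<in> carrier M" for a b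
    by (intro tuples_update assms that)
  have rep: "cls (xs[i := a, j := a]) = \<zero>\<^bsub>P\<^esub>" if "a \<in> carrier M" for a
  proof (rule cls_repeated[OF assms(1) X[OF that that]])
    have len: "length xs = m" by (rule tuples_length[OF assms(2)])
    then have "xs[i := a, j := a] ! i = xs[i := a, j := a] ! j" using assms(3-5) by simp
    then show "\<not> distinct (xs[i := a, j := a])"
      using assms(3-5) len unfolding distinct_conv_nth by (metis length_list_update)
  qed
  have l: "cls (xs[i := a \<oplus> b, j := c]) = cls (xs[i := a, j := c]) \<oplus>\<^bsub>P\<^esub> cls (xs[i := b, j := c])"
    if "a \<in> carrier M" "b \<in> carrier M" "c \<in> carrier M" for a b c
    using hom_add[OF cls_slot[OF tuples_update[OF assms(2) that(3), of j] assms(3)] that(1,2)] assms(5)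
    by (simp add: list_update_swap)
  have r: "cls (xs[i := c, j := a \<oplus> b]) = cls (xs[i := c, j := a]) \<oplus>\<^bsub>P\<^esub> cls (xs[i := c, j := b])"
    if "a \<in> carrier M" "b \<in> carrier M" "c \<in> carrier M" for a b c
    using hom_add[OF cls_slot[OF tuples_update[OF assms(2) that(3), of i] assms(4)] that(1,2)] .
  have yz: "y \<oplus> z \<in> carrier M" using assms by simp
  note c = cls_closed[OF X]
  have "\<zero>\<^bsub>P\<^esub> = cls (xs[i := y \<oplus> z, j := y \<oplus> z])" using rep[OF yz] by simp
  also have "\<dots> = (cls (xs[i := y, j := y]) \<oplus>\<^bsub>P\<^esub> cls (xs[i := z, j := y])) \<oplus>\<^bsub>P\<^esub>
      (cls (xs[i := y, j := z]) \<oplus>\<^bsub>P\<^esub> cls (xs[i := z, j := z]))"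
    using assms(6,7) yz by (simp only: l r)
  also have "\<dots> = cls (xs[i := y, j := z]) \<oplus>\<^bsub>P\<^esub> cls (xs[i := z, j := y])"
    using c[OF assms(6,7)] c[OF assms(7,6)] by (simp add: P.M.a_comm rep[OF assms(6)] rep[OF assms(7)])
  finally show ?thesis by simp
qed

lemma
  assumes f: "multilinear K M m N f" and N: "module K N"
    and alternating: "\<And>xs. alt \<Longrightarrow> xs \<in> X \<Longrightarrow> \<not> distinct xs \<Longrightarrow> f xs = \<zero>\<^bsub>N\<^esub>"
  shows lift_hom: "mod_hom K P N (presented_lift K X N f)"
    and lift_cls: "xs \<in> X \<Longrightarrow> presented_lift K X N f (cls xs) = f xs"
proof -
  have fN: "f xs \<in> carrier N" if "xs \<in> X" for xs
    using f that unfolding multilinear_def by blast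
  have kills: "linear_extension K X N f r = \<zero>\<^bsub>N\<^esub>" if r: "r \<in> R" for r
  proof (cases "r \<in> tensor_relations K M m")
    case True
    then obtain xs i where xs: "xs \<in> X" "i < m" "r \<in> linearity_relations K X M (\<lambda>x. xs[i := x])"
      unfolding tensor_relations_def by blast
    then have "mod_hom K M N (\<lambda>x. f (xs[i := x]))"
      using f mod_hom_iff[OF module_M N] unfolding multilinear_def by blast
    then show ?thesis
      by (rule linear_extension_linearity_relation[OF _ fN tuples_update[OF xs(1)] xs(3)])
  next
    case False
    then obtain xs where "alt" "r = generator K X xs" "xs \<in> X" "\<not> distinct xs"
      using r unfolding R_def alternating_relations_def by (auto split: if_splits)
    then show ?thesis using linear_extension_generator[where X = X and f = f and x = xs, OF N fN] alternating by simp
  qed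
  show "mod_hom K P N (presented_lift K X N f)"
    by (rule presented_lift_hom[OF N fN kills])
  show "xs \<in> X \<Longrightarrow> presented_lift K X N f (cls xs) = f xs"
    by (rule presented_lift_cls[OF N fN kills])
qed

lemma multilinearI:
  assumes "\<And>xs. xs \<in> X \<Longrightarrow> f xs \<in> carrier N" "module K N"
    and "\<And>xs i. xs \<in> X \<Longrightarrow> i < m \<Longrightarrow> mod_hom K M N (\<lambda>x. f (xs[i := x]))"
  shows "multilinear K M m N f"
  using assms mod_hom_iff[OF module_M assms(2)] unfolding multilinear_def by blast

subsection \<open>Derivations\<close>

text \<open>\<open>derivation f\<close> is the extension of an endomorphism \<open>f\<close> of \<open>M\<close> to the power of \<open>M\<close> by the
  Leibniz rule, applying \<open>f\<close> to one factor at a time.\<close>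

definition derive_tuple where
  "derive_tuple f xs = (\<Oplus>\<^bsub>P\<^esub>i\<in>{..<m}. cls (xs[i := f (xs ! i)]))"

definition derivation where
  "derivation f = presented_lift K X P (derive_tuple f)"

context
  fixes f assumes f: "mod_hom K M M f"
begin

lemma derive_entry_closed:
  assumes "xs \<in> X" "i < m"
  shows "cls (xs[i := f (xs ! i)]) \<in> carrier P"
  by (intro cls_closed tuples_update assms hom_closed[OF f] tuples_nth[OF assms])

lemma derive_tuple_closed: "xs \<in> X \<Longrightarrow> derive_tuple f xs \<in> carrier P"
  unfolding derive_tuple_def using derive_entry_closed by (intro P.M.finsum_closed) auto

lemma derive_tuple_slot:
  assumes xs: "xs \<in> X" and l: "l < m"
  shows "mod_hom K M P (\<lambda>x. derive_tuple f (xs[l := x]))"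
  unfolding derive_tuple_def
proof (rule mod_hom_finsum[OF module_M P.module_axioms])
  fix i assume "i \<in> {..<m}"
  then have i: "i < m" by simp
  have len: "length xs = m" by (rule tuples_length[OF xs])
  show "mod_hom K M P (\<lambda>x. cls (xs[l := x, i := f (xs[l := x] ! i)]))"
  proof (cases "i = l")
    case True
    then show ?thesis
      using mod_hom_comp[OF f cls_slot[OF xs l]] len l by simp
  next
    case False
    then have "xs[l := x, i := f (xs[l := x] ! i)] = xs[i := f (xs ! i), l := x]" for x
      by (simp add: list_update_swap)
    then show ?thesis
      using cls_slot[OF tuples_update[OF xs hom_closed[OF f tuples_nth[OF xs i]]] l] by simp
  qed
qed simp

text \<open>If the entries at \<open>a\<close> and \<open>b\<close> agree, every summand that leaves both untouched still has a
  repetition, and the two summands at \<open>a\<close> and \<open>b\<close> cancel by antisymmetry.\<close>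

lemma derive_tuple_repeated:
  assumes alt: "alt" and xs: "xs \<in> X" and rep: "\<not> distinct xs"
  shows "derive_tuple f xs = \<zero>\<^bsub>P\<^esub>"
proof -
  have len: "length xs = m" by (rule tuples_length[OF xs])
  obtain a b where ab: "a < m" "b < m" "a \<noteq> b" "xs ! a = xs ! b"
    using rep len by (auto simp: distinct_conv_nth)
  let ?t = "\<lambda>i. cls (xs[i := f (xs ! i)])"
  have t: "?t i \<in> carrier P" if "i < m" for i using derive_entry_closed[OF xs that] .
  have zero: "?t i = \<zero>\<^bsub>P\<^esub>" if "i < m" "i \<noteq> a" "i \<noteq> b" for i
  proof (rule cls_repeated[OF alt])
    show "xs[i := f (xs ! i)] \<in> X" by (intro tuples_update xs hom_closed[OF f] tuples_nth[OF xs] that)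
    have "xs[i := f (xs ! i)] ! a = xs[i := f (xs ! i)] ! b" using that ab by simp
    then show "\<not> distinct (xs[i := f (xs ! i)])" using ab len by (auto simp: distinct_conv_nth)
  qed
  have "derive_tuple f xs = (\<Oplus>\<^bsub>P\<^esub>i\<in>{a, b}. ?t i)"
    unfolding derive_tuple_def
    by (rule P.M.add.finprod_mono_neutral_cong_right) (use ab zero t in auto)
  also have "\<dots> = ?t a \<oplus>\<^bsub>P\<^esub> ?t b"
    using ab(3) t[OF ab(1)] t[OF ab(2)] by (simp add: P.M.finsum_insert[of "{b}"] P.M.finsum_insert[of "{}"])
  also have "\<dots> = cls (xs[a := f (xs ! a), b := xs ! a]) \<oplus>\<^bsub>P\<^esub> cls (xs[a := xs ! a, b := f (xs ! a)])"
    unfolding list_update_swap[OF ab(3), of xs "f (xs ! a)"]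
    using list_update_id[of xs a] list_update_id[of xs b] ab(4) by simp
  also have "\<dots> = \<zero>\<^bsub>P\<^esub>"
    using ab(1-3) xs by (intro cls_antisymmetric alt hom_closed[OF f] tuples_nth)
  finally show ?thesis .
qed

lemma multilinear_derive_tuple: "multilinear K M m P (derive_tuple f)"
  by (rule multilinearI[OF derive_tuple_closed P.module_axioms derive_tuple_slot])

lemma derivation_hom: "mod_hom K P P (derivation f)"
  unfolding derivation_def
  by (rule lift_hom[OF multilinear_derive_tuple P.module_axioms derive_tuple_repeated])

lemma derivation_cls: "xs \<in> X \<Longrightarrow> derivation f (cls xs) = derive_tuple f xs"
  unfolding derivation_def
  by (rule lift_cls[OF multilinear_derive_tuple P.module_axioms derive_tuple_repeated])

end

text \<open>Composing two derivations gives a double sum over the positions of the two endomorphisms.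
  For distinct positions the summand does not depend on the order of composition; on the diagonal
  the two orders differ by \<open>e\<close> applied to one factor.\<close>

lemma derivation_commutator:
  assumes f: "mod_hom K M M f" and h: "mod_hom K M M h" and e: "mod_hom K M M e"
    and comm: "\<And>x. x \<in> carrier M \<Longrightarrow> f (h x) = h (f x) \<oplus> e x"
    and A: "A \<in> carrier P"
  shows "derivation f (derivation h A) = derivation h (derivation f A) \<oplus>\<^bsub>P\<^esub> derivation e A"
proof (rule hom_eqI[OF _ _ _ A])
  show "mod_hom K P P (\<lambda>A. derivation f (derivation h A))"
    by (rule mod_hom_comp[OF derivation_hom[OF h] derivation_hom[OF f]])
  show "mod_hom K P P (\<lambda>A. derivation h (derivation f A) \<oplus>\<^bsub>P\<^esub> derivation e A)"
    by (rule mod_hom_plus[OF mod_hom_comp[OF derivation_hom[OF f] derivation_hom[OF h]] derivation_hom[OF e]])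
  fix xs assume xs: "xs \<in> X"
  have len: "length xs = m" by (rule tuples_length[OF xs])
  have nth: "xs ! i \<in> carrier M" if "i < m" for i by (rule tuples_nth[OF xs that])
  have twice: "derivation u (derivation v (cls xs)) =
      (\<Oplus>\<^bsub>P\<^esub>i\<in>{..<m}. \<Oplus>\<^bsub>P\<^esub>l\<in>{..<m}. cls (xs[i := v (xs ! i), l := u (xs[i := v (xs ! i)] ! l)]))"
    if u: "mod_hom K M M u" and v: "mod_hom K M M v" for u v
  proof -
    have "derivation u (derivation v (cls xs)) = derivation u (\<Oplus>\<^bsub>P\<^esub>i\<in>{..<m}. cls (xs[i := v (xs ! i)]))"
      using derivation_cls[OF v xs] by (simp add: derive_tuple_def)
    also have "\<dots> = (\<Oplus>\<^bsub>P\<^esub>i\<in>{..<m}. derivation u (cls (xs[i := v (xs ! i)])))"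
      using derive_entry_closed[OF v xs] by (intro finsum_mod_hom[OF derivation_hom[OF u]]) auto
    also have "\<dots> = (\<Oplus>\<^bsub>P\<^esub>i\<in>{..<m}. derive_tuple u (xs[i := v (xs ! i)]))"
      using tuples_update[OF xs hom_closed[OF v nth]] derivation_cls[OF u] derive_tuple_closed[OF u]
      by (intro P.M.finsum_cong') auto
    finally show ?thesis by (simp add: derive_tuple_def)
  qed
  \<comment> \<open>\<open>?G i l\<close> is the summand with \<open>h\<close> in position \<open>i\<close> and \<open>f\<close> in position \<open>l\<close>; on the diagonal it is
    the summand of \<open>h\<close> after \<open>f\<close>, so that \<open>?D\<close> is the defect of the other order.\<close>
  let ?G = "\<lambda>i l. if l = i then cls (xs[i := h (f (xs ! i))]) else cls (xs[i := h (xs ! i), l := f (xs ! l)])"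
  let ?D = "\<lambda>i l. if l = i then cls (xs[i := e (xs ! i)]) else \<zero>\<^bsub>P\<^esub>"
  have G: "?G i l \<in> carrier P" if "i < m" "l < m" for i l
    using that xs nth by (auto intro!: cls_closed tuples_update hom_closed[OF f] hom_closed[OF h])
  have E: "cls (xs[i := e (xs ! i)]) \<in> carrier P" if "i < m" for i
    by (rule derive_entry_closed[OF e xs that])
  have 1: "cls (xs[i := h (xs ! i), l := f (xs[i := h (xs ! i)] ! l)]) = ?G i l \<oplus>\<^bsub>P\<^esub> ?D i l"
    if il: "i < m" "l < m" for i l
  proof (cases "l = i")
    case True
    then show ?thesis
      using hom_add[OF cls_slot[OF xs il(1)] hom_closed[OF h hom_closed[OF f nth]] hom_closed[OF e nth]]
        il len comm[OF nth] by simp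
  next
    case False
    then show ?thesis using G[OF il] by simp
  qed
  have 2: "cls (xs[l := f (xs ! l), i := h (xs[l := f (xs ! l)] ! i)]) = ?G i l"
    if il: "i < m" "l < m" for i l
    using il len by (simp add: list_update_swap)
  have "derivation f (derivation h (cls xs)) = (\<Oplus>\<^bsub>P\<^esub>i\<in>{..<m}. \<Oplus>\<^bsub>P\<^esub>l\<in>{..<m}. ?G i l \<oplus>\<^bsub>P\<^esub> ?D i l)"
    unfolding twice[OF f h] using G E 1
    by (intro P.M.finsum_cong' refl) (auto intro!: P.M.finsum_closed)
  also have "\<dots> = (\<Oplus>\<^bsub>P\<^esub>i\<in>{..<m}. (\<Oplus>\<^bsub>P\<^esub>l\<in>{..<m}. ?G i l) \<oplus>\<^bsub>P\<^esub> (\<Oplus>\<^bsub>P\<^esub>l\<in>{..<m}. ?D i l))"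
    using G E by (intro P.M.finsum_cong' refl P.M.finsum_addf) (auto intro!: P.M.finsum_closed)
  also have "\<dots> = (\<Oplus>\<^bsub>P\<^esub>i\<in>{..<m}. \<Oplus>\<^bsub>P\<^esub>l\<in>{..<m}. ?G i l) \<oplus>\<^bsub>P\<^esub> (\<Oplus>\<^bsub>P\<^esub>i\<in>{..<m}. \<Oplus>\<^bsub>P\<^esub>l\<in>{..<m}. ?D i l)"
    using G E by (intro P.M.finsum_addf) (auto intro!: P.M.finsum_closed)
  also have "(\<Oplus>\<^bsub>P\<^esub>i\<in>{..<m}. \<Oplus>\<^bsub>P\<^esub>l\<in>{..<m}. ?D i l) = derivation e (cls xs)"
    unfolding derivation_cls[OF e xs] derive_tuple_def
  proof (intro P.M.finsum_cong' refl)
    show "(\<Oplus>\<^bsub>P\<^esub>l\<in>{..<m}. ?D i l) = cls (xs[i := e (xs ! i)])" if "i \<in> {..<m}" for i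
      using that E P.M.add.finprod_singleton_swap[of i "{..<m}" "\<lambda>_. cls (xs[i := e (xs ! i)])"]
      by simp
  qed (use E in simp)
  also have "(\<Oplus>\<^bsub>P\<^esub>i\<in>{..<m}. \<Oplus>\<^bsub>P\<^esub>l\<in>{..<m}. ?G i l) = (\<Oplus>\<^bsub>P\<^esub>l\<in>{..<m}. \<Oplus>\<^bsub>P\<^esub>i\<in>{..<m}. ?G i l)"
    by (rule P.M.finsum_swap) (use G in auto)
  also have "\<dots> = derivation h (derivation f (cls xs))"
    unfolding twice[OF h f] using G 2
    by (intro P.M.finsum_cong' refl) (auto intro!: P.M.finsum_closed)
  finally show "derivation f (derivation h (cls xs)) =
      derivation h (derivation f (cls xs)) \<oplus>\<^bsub>P\<^esub> derivation e (cls xs)" .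
qed

end

section \<open>Filippov algebras: action and bracket\<close>

locale filippov_power =
  filippov_n_algebra K g n br for K (structure) and g (structure) and n and br :: "'c list \<Rightarrow> 'c" +
  fixes m :: nat and alt :: bool
  assumes n_eq: "n = Suc m"
    and char_not_2: "\<one>\<^bsub>K\<^esub> \<oplus>\<^bsub>K\<^esub> \<one>\<^bsub>K\<^esub> \<noteq> \<zero>\<^bsub>K\<^esub>"
begin

lemma m: "n - 1 = m"
  by (simp add: n_eq)

sublocale pw: module_power K g m alt
  by unfold_locales

abbreviation H where "H \<equiv> pw.P"
abbreviation cls where "cls \<equiv> pw.cls"
abbreviation act where "act \<equiv> induced_action K g n br"
abbreviation brk where "brk \<equiv> induced_bracket K g n br H cls"

lemma Cons_tuple: "v \<in> carrier g \<Longrightarrow> xs \<in> tuples g m \<Longrightarrow> v # xs \<in> tuples g n"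
  by (auto simp: tuples_def n_eq)

lemma br_closed: "xs \<in> tuples g n \<Longrightarrow> br xs \<in> carrier g"
  using br_multilinear unfolding multilinear_def by blast

lemma br_slot: "xs \<in> tuples g n \<Longrightarrow> i < n \<Longrightarrow> mod_hom K g g (\<lambda>x. br (xs[i := x]))"
  using br_multilinear mod_hom_iff[OF pw.module_M pw.module_M] unfolding multilinear_def by blast

text \<open>Swapping the two equal arguments gives \<open>[\<dots>] = - [\<dots>]\<close>, so twice the bracket is 0. This is the
  place where the characteristic matters.\<close>

lemma br_repeated:
  assumes xs: "xs \<in> tuples g n" and rep: "\<not> distinct xs"
  shows "br xs = \<zero>\<^bsub>g\<^esub>"
proof -
  have len: "length xs = n" by (rule tuples_length[OF xs])
  obtain i j where ij: "i < n" "j < n" "i \<noteq> j" "xs ! i = xs ! j"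
    using rep len by (auto simp: distinct_conv_nth)
  have "xs[i := xs ! j, j := xs ! i] = xs"
    using list_update_id[of xs i] list_update_id[of xs j] ij(4) by simp
  then have "br xs = \<ominus>\<^bsub>g\<^esub> br xs"
    using antisymmetric[OF xs ij(1-3)] by simp
  then have "br xs \<oplus>\<^bsub>g\<^esub> br xs = \<zero>\<^bsub>g\<^esub>"
    using br_closed[OF xs] M.r_neg by metis
  then have "(\<one>\<^bsub>K\<^esub> \<oplus>\<^bsub>K\<^esub> \<one>\<^bsub>K\<^esub>) \<odot>\<^bsub>g\<^esub> br xs = \<zero>\<^bsub>g\<^esub>"
    using br_closed[OF xs] by (simp add: smult_l_distr)
  moreover have "inv\<^bsub>K\<^esub> (\<one>\<^bsub>K\<^esub> \<oplus>\<^bsub>K\<^esub> \<one>\<^bsub>K\<^esub>) \<odot>\<^bsub>g\<^esub> ((\<one>\<^bsub>K\<^esub> \<oplus>\<^bsub>K\<^esub> \<one>\<^bsub>K\<^esub>) \<odot>\<^bsub>g\<^esub> br xs) = br xs"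
  proof -
    have u: "\<one>\<^bsub>K\<^esub> \<oplus>\<^bsub>K\<^esub> \<one>\<^bsub>K\<^esub> \<in> Units K" using char_not_2 by (simp add: field_Units)
    then show ?thesis
      using br_closed[OF xs] by (simp add: smult_assoc1[symmetric] R.Units_l_inv)
  qed
  moreover have "inv\<^bsub>K\<^esub> (\<one>\<^bsub>K\<^esub> \<oplus>\<^bsub>K\<^esub> \<one>\<^bsub>K\<^esub>) \<in> carrier K"
    using char_not_2 by (intro R.Units_inv_closed) (simp add: field_Units)
  ultimately show ?thesis by simp
qed

lemma multilinear_br_Cons: "v \<in> carrier g \<Longrightarrow> multilinear K g m g (\<lambda>xs. br (v # xs))"
  by (rule pw.multilinearI)
    (use br_closed Cons_tuple br_slot[of "v # _" "Suc _"] pw.module_M n_eq in auto)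

lemma
  assumes v: "v \<in> carrier g"
  shows act_hom_right: "mod_hom K H g (act v)"
    and act_cls: "xs \<in> tuples g m \<Longrightarrow> act v (cls xs) = br (v # xs)"
proof -
  have rep: "br (v # xs) = \<zero>\<^bsub>g\<^esub>" if "xs \<in> tuples g m" "\<not> distinct xs" for xs
    using br_repeated[OF Cons_tuple[OF v that(1)]] that(2) by simp
  show "mod_hom K H g (act v)"
    unfolding induced_action_def[abs_def] m
    by (rule pw.lift_hom[OF multilinear_br_Cons[OF v] pw.module_M rep])
  show "xs \<in> tuples g m \<Longrightarrow> act v (cls xs) = br (v # xs)"
    unfolding induced_action_def m
    by (rule pw.lift_cls[OF multilinear_br_Cons[OF v] pw.module_M rep])
qed

lemma act_closed: "v \<in> carrier g \<Longrightarrow> A \<in> carrier H \<Longrightarrow> act v A \<in> carrier g"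
  by (rule hom_closed[OF act_hom_right])

lemma br_Cons_hom:
  assumes xs: "xs \<in> tuples g m"
  shows "mod_hom K g g (\<lambda>v. br (v # xs))"
proof -
  have "0 < n" using n_eq by simp
  then have "mod_hom K g g (\<lambda>v. br ((\<zero>\<^bsub>g\<^esub> # xs)[0 := v]))"
    by (rule br_slot[OF Cons_tuple[OF M.zero_closed xs]])
  then show ?thesis by (simp only: list_update_code)
qed

lemma act_hom_left:
  assumes A: "A \<in> carrier H"
  shows "mod_hom K g g (\<lambda>v. act v A)"
proof (rule mod_homI)
  fix v w assume v: "v \<in> carrier g" and w: "w \<in> carrier g"
  then have vw: "v \<oplus>\<^bsub>g\<^esub> w \<in> carrier g" by simp
  show "act (v \<oplus>\<^bsub>g\<^esub> w) A = act v A \<oplus>\<^bsub>g\<^esub> act w A"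
    by (rule pw.hom_eqI[OF act_hom_right[OF vw] mod_hom_plus[OF act_hom_right[OF v] act_hom_right[OF w]] _ A])
      (simp only: act_cls v w vw hom_add[OF br_Cons_hom])
next
  fix a v assume a: "a \<in> carrier K" and v: "v \<in> carrier g"
  then have av: "a \<odot>\<^bsub>g\<^esub> v \<in> carrier g" by simp
  show "act (a \<odot>\<^bsub>g\<^esub> v) A = a \<odot>\<^bsub>g\<^esub> act v A"
    by (rule pw.hom_eqI[OF act_hom_right[OF av] mod_hom_scale[OF act_hom_right[OF v] a] _ A])
      (simp only: act_cls a v av hom_smult[OF br_Cons_hom])
qed (use act_closed A pw.module_M in auto)

lemma brk_cls_hom:
  assumes as: "as \<in> tuples g m"
  shows "mod_hom K H H (\<lambda>B. \<Oplus>\<^bsub>H\<^esub>i\<in>{..<m}. cls (as[i := act (as ! i) B]))"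
proof (rule mod_hom_finsum[OF pw.P.module_axioms pw.P.module_axioms])
  fix i assume "i \<in> {..<m}"
  then have i: "i < m" by simp
  show "mod_hom K H H (\<lambda>B. cls (as[i := act (as ! i) B]))"
    by (rule mod_hom_comp[OF act_hom_right[OF tuples_nth[OF as i]] pw.cls_slot[OF as i]])
qed simp

text \<open>The inner lift, as a function of \<open>B\<close>, is the linear map that applies the action of \<open>B\<close> in
  one slot at a time, since both have the same values on generators. After this replacement the
  outer lift is the derivation itself.\<close>

lemma brk_eq_derivation:
  assumes A: "A \<in> carrier H" and B: "B \<in> carrier H"
  shows "brk A B = pw.derivation (\<lambda>v. act v B) A"
  unfolding induced_bracket_def m
proof (rule pw.presented_lift_eqI[OF pw.derivation_hom[OF act_hom_left[OF B]] _ A])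
  fix as assume as: "as \<in> tuples g m"
  have nth: "as ! i \<in> carrier g" if "i < m" for i by (rule tuples_nth[OF as that])
  have "presented_lift K (tuples g m) H
      (\<lambda>bs. \<Oplus>\<^bsub>H\<^esub>i\<in>{..<m}. cls (as[i := br (as ! i # bs)])) B =
      (\<Oplus>\<^bsub>H\<^esub>i\<in>{..<m}. cls (as[i := act (as ! i) B]))"
  proof (rule pw.presented_lift_eqI[OF brk_cls_hom[OF as] _ B])
    fix bs assume bs: "bs \<in> tuples g m"
    show "(\<Oplus>\<^bsub>H\<^esub>i\<in>{..<m}. cls (as[i := act (as ! i) (cls bs)])) =
        (\<Oplus>\<^bsub>H\<^esub>i\<in>{..<m}. cls (as[i := br (as ! i # bs)]))"
    proof (rule pw.P.M.finsum_cong'[OF refl])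
      show "(\<lambda>i. cls (as[i := br (as ! i # bs)])) \<in> {..<m} \<rightarrow> carrier H"
        using as bs nth by (auto intro!: pw.cls_closed tuples_update br_closed Cons_tuple)
    qed (simp add: act_cls nth bs)
  qed
  then show "pw.derivation (\<lambda>v. act v B) (cls as) = presented_lift K (tuples g m) H
      (\<lambda>bs. \<Oplus>\<^bsub>H\<^esub>i\<in>{..<m}. cls (as[i := br (as ! i # bs)])) B"
    by (simp add: pw.derivation_cls[OF act_hom_left[OF B] as] pw.derive_tuple_def)
qed

lemma brk_hom_left: "B \<in> carrier H \<Longrightarrow> mod_hom K H H (\<lambda>A. brk A B)"
  by (rule mod_hom_cong[OF pw.derivation_hom[OF act_hom_left]]) (simp_all add: brk_eq_derivation)

lemma brk_closed: "A \<in> carrier H \<Longrightarrow> B \<in> carrier H \<Longrightarrow> brk A B \<in> carrier H"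
  by (rule hom_closed[OF brk_hom_left])

lemma brk_cls:
  "as \<in> tuples g m \<Longrightarrow> B \<in> carrier H \<Longrightarrow>
    brk (cls as) B = (\<Oplus>\<^bsub>H\<^esub>i\<in>{..<m}. cls (as[i := act (as ! i) B]))"
  by (simp add: brk_eq_derivation pw.derivation_cls act_hom_left pw.derive_tuple_def)

lemma brk_hom_right:
  assumes A: "A \<in> carrier H"
  shows "mod_hom K H H (brk A)"
proof (rule mod_homI)
  fix B C assume B: "B \<in> carrier H" and C: "C \<in> carrier H"
  then have BC: "B \<oplus>\<^bsub>H\<^esub> C \<in> carrier H" by simp
  show "brk A (B \<oplus>\<^bsub>H\<^esub> C) = brk A B \<oplus>\<^bsub>H\<^esub> brk A C"
    by (rule pw.hom_eqI[OF brk_hom_left[OF BC] mod_hom_plus[OF brk_hom_left[OF B] brk_hom_left[OF C]] _ A])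
      (simp only: brk_cls B C BC hom_add[OF brk_cls_hom])
next
  fix a B assume a: "a \<in> carrier K" and B: "B \<in> carrier H"
  then have aB: "a \<odot>\<^bsub>H\<^esub> B \<in> carrier H" by simp
  show "brk A (a \<odot>\<^bsub>H\<^esub> B) = a \<odot>\<^bsub>H\<^esub> brk A B"
    by (rule pw.hom_eqI[OF brk_hom_left[OF aB] mod_hom_scale[OF brk_hom_left[OF B] a] _ A])
      (simp only: brk_cls a B aB hom_smult[OF brk_cls_hom])
qed (use brk_closed A pw.P.module_axioms in auto)

text \<open>The fundamental identity says this for a generator \<open>B\<close>, and both sides are linear in \<open>B\<close>.\<close>

lemma act_br:
  assumes xs: "xs \<in> tuples g n" and B: "B \<in> carrier H"
  shows "act (br xs) B = (\<Oplus>\<^bsub>g\<^esub>i\<in>{..<n}. br (xs[i := act (xs ! i) B]))"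
proof (rule pw.hom_eqI[OF act_hom_right[OF br_closed[OF xs]] _ _ B])
  have nth: "xs ! i \<in> carrier g" if "i < n" for i by (rule tuples_nth[OF xs that])
  show "mod_hom K H g (\<lambda>B. \<Oplus>\<^bsub>g\<^esub>i\<in>{..<n}. br (xs[i := act (xs ! i) B]))"
  proof (rule mod_hom_finsum[OF pw.P.module_axioms pw.module_M])
    fix i assume "i \<in> {..<n}"
    then have i: "i < n" by simp
    show "mod_hom K H g (\<lambda>B. br (xs[i := act (xs ! i) B]))"
      by (rule mod_hom_comp[OF act_hom_right[OF nth[OF i]] br_slot[OF xs i]])
  qed simp
  fix ys assume ys: "ys \<in> tuples g m"
  have "act (br xs) (cls ys) = (\<Oplus>\<^bsub>g\<^esub>i\<in>{..<n}. br (xs[i := br (xs ! i # ys)]))"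
    using act_cls[OF br_closed[OF xs] ys] leibniz_identity[unfolded m, OF xs ys] by simp
  also have "\<dots> = (\<Oplus>\<^bsub>g\<^esub>i\<in>{..<n}. br (xs[i := act (xs ! i) (cls ys)]))"
  proof (rule M.finsum_cong'[OF refl])
    show "(\<lambda>i. br (xs[i := act (xs ! i) (cls ys)])) \<in> {..<n} \<rightarrow> carrier g"
      using xs ys nth by (auto intro!: br_closed tuples_update act_closed pw.cls_closed)
  qed (simp add: act_cls nth ys)
  finally show "act (br xs) (cls ys) = (\<Oplus>\<^bsub>g\<^esub>i\<in>{..<n}. br (xs[i := act (xs ! i) (cls ys)]))" .
qed

text \<open>For a generator \<open>A\<close> this is \<open>act_br\<close> for the bracket of \<open>v\<close> with the entries of \<open>A\<close>: the
  summand in which \<open>B\<close> acts on \<open>v\<close> gives the first term, the other summands give the bracket \<open>[A,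
  B]\<close>.\<close>

lemma act_act:
  assumes v: "v \<in> carrier g" and A: "A \<in> carrier H" and B: "B \<in> carrier H"
  shows "act (act v A) B = act (act v B) A \<oplus>\<^bsub>g\<^esub> act v (brk A B)"
proof (rule pw.hom_eqI[OF _ _ _ A])
  have vB: "act v B \<in> carrier g" by (rule act_closed[OF v B])
  show "mod_hom K H g (\<lambda>A. act (act v A) B)"
    by (rule mod_hom_comp[OF act_hom_right[OF v] act_hom_left[OF B]])
  show "mod_hom K H g (\<lambda>A. act (act v B) A \<oplus>\<^bsub>g\<^esub> act v (brk A B))"
    by (rule mod_hom_plus[OF act_hom_right[OF vB] mod_hom_comp[OF brk_hom_left[OF B] act_hom_right[OF v]]])
  fix as assume as: "as \<in> tuples g m"
  have nth: "as ! i \<in> carrier g" if "i < m" for i by (rule tuples_nth[OF as that])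
  have t: "v # as[i := act (as ! i) B] \<in> tuples g n" if "i < m" for i
    by (intro Cons_tuple v tuples_update as act_closed nth that B)
  have n: "{..<n} = insert 0 (Suc ` {..<m})"
    by (simp only: n_eq lessThan_Suc_eq_insert_0)
  have "act (act v (cls as)) B = act (br (v # as)) B" by (simp add: act_cls v as)
  also have "\<dots> = (\<Oplus>\<^bsub>g\<^esub>i\<in>{..<n}. br ((v # as)[i := act ((v # as) ! i) B]))"
    by (rule act_br[OF Cons_tuple[OF v as] B])
  also have "\<dots> = br (act v B # as) \<oplus>\<^bsub>g\<^esub>
      (\<Oplus>\<^bsub>g\<^esub>i\<in>Suc ` {..<m}. br ((v # as)[i := act ((v # as) ! i) B]))"
    unfolding n using t br_closed[OF Cons_tuple[OF vB as]] br_closed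
    by (subst M.finsum_insert) auto
  also have "(\<Oplus>\<^bsub>g\<^esub>i\<in>Suc ` {..<m}. br ((v # as)[i := act ((v # as) ! i) B])) =
      (\<Oplus>\<^bsub>g\<^esub>i\<in>{..<m}. br (v # as[i := act (as ! i) B]))"
    using t br_closed by (subst M.finsum_reindex) auto
  also have "\<dots> = (\<Oplus>\<^bsub>g\<^esub>i\<in>{..<m}. act v (cls (as[i := act (as ! i) B])))"
  proof (rule M.finsum_cong'[OF refl])
    show "(\<lambda>i. act v (cls (as[i := act (as ! i) B]))) \<in> {..<m} \<rightarrow> carrier g"
      using as B v nth by (auto intro!: tuples_update act_closed pw.cls_closed)
  qed (simp add: act_cls v tuples_update as act_closed nth B)
  also have "\<dots> = act v (brk (cls as) B)"
    unfolding brk_cls[OF as B]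
    by (rule finsum_mod_hom[OF act_hom_right[OF v], symmetric])
      (use as B nth in \<open>auto intro!: tuples_update act_closed pw.cls_closed\<close>)
  also have "br (act v B # as) = act (act v B) (cls as)" by (simp add: act_cls vB as)
  finally show "act (act v (cls as)) B = act (act v B) (cls as) \<oplus>\<^bsub>g\<^esub> act v (brk (cls as) B)" .
qed

lemma brk_brk:
  assumes A: "A \<in> carrier H" and B: "B \<in> carrier H" and C: "C \<in> carrier H"
  shows "brk (brk A B) C = brk (brk A C) B \<oplus>\<^bsub>H\<^esub> brk A (brk B C)"
  using pw.derivation_commutator[OF act_hom_left[OF C] act_hom_left[OF B] act_hom_left[OF brk_closed[OF B C]] act_act[OF _ B C] A]
  by (simp add: brk_eq_derivation[symmetric] A B C brk_closed)

end

section \<open>The modules \<open>V \<otimes> H\<^sup>\<otimes>\<^sup>k\<close>\<close>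

definition mixed_multilinear where
  "mixed_multilinear K V H k N f \<longleftrightarrow>
     (\<forall>v \<in> carrier V. \<forall>hs \<in> tuples H k. f (v, hs) \<in> carrier N) \<and>
     (\<forall>hs \<in> tuples H k. mod_hom K V N (\<lambda>v. f (v, hs))) \<and>
     (\<forall>v \<in> carrier V. \<forall>hs \<in> tuples H k. \<forall>i < k. mod_hom K H N (\<lambda>h. f (v, hs[i := h])))"

lemma mixed_multilinearI:
  assumes "\<And>v hs. v \<in> carrier V \<Longrightarrow> hs \<in> tuples H k \<Longrightarrow> f (v, hs) \<in> carrier N"
    and "\<And>hs. hs \<in> tuples H k \<Longrightarrow> mod_hom K V N (\<lambda>v. f (v, hs))"
    and "\<And>v hs i. v \<in> carrier V \<Longrightarrow> hs \<in> tuples H k \<Longrightarrow> i < k \<Longrightarrow> mod_hom K H N (\<lambda>h. f (v, hs[i := h]))"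
  shows "mixed_multilinear K V H k N f"
  using assms unfolding mixed_multilinear_def by blast

lemma mixed_multilinearD:
  assumes "mixed_multilinear K V H k N f"
  shows "\<And>v hs. v \<in> carrier V \<Longrightarrow> hs \<in> tuples H k \<Longrightarrow> f (v, hs) \<in> carrier N"
    and "\<And>hs. hs \<in> tuples H k \<Longrightarrow> mod_hom K V N (\<lambda>v. f (v, hs))"
    and "\<And>v hs i. v \<in> carrier V \<Longrightarrow> hs \<in> tuples H k \<Longrightarrow> i < k \<Longrightarrow> mod_hom K H N (\<lambda>h. f (v, hs[i := h]))"
  using assms unfolding mixed_multilinear_def by blast+

lemma mixed_multilinear_plus:
  assumes N: "module K N"
    and f: "mixed_multilinear K V H k N f" and h: "mixed_multilinear K V H k N h"
  shows "mixed_multilinear K V H k N (\<lambda>x. f x \<oplus>\<^bsub>N\<^esub> h x)"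
proof -
  interpret N: module K N by (rule N)
  show ?thesis
    by (intro mixed_multilinearI mod_hom_plus N.M.a_closed mixed_multilinearD[OF f] mixed_multilinearD[OF h])
qed

lemma mixed_multilinear_scale:
  assumes N: "module K N" and f: "mixed_multilinear K V H k N f" and a: "a \<in> carrier K"
  shows "mixed_multilinear K V H k N (\<lambda>x. a \<odot>\<^bsub>N\<^esub> f x)"
proof -
  interpret N: module K N by (rule N)
  show ?thesis
    by (intro mixed_multilinearI mod_hom_scale N.smult_closed mixed_multilinearD[OF f] a)
qed

lemma mixed_multilinear_finsum:
  assumes "module K N" "module K V" "module K H" "finite I"
    and f: "\<And>i. i \<in> I \<Longrightarrow> mixed_multilinear K V H k N (f i)"
  shows "mixed_multilinear K V H k N (\<lambda>x. \<Oplus>\<^bsub>N\<^esub>i\<in>I. f i x)"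
proof -
  interpret N: module K N by fact
  show ?thesis
  proof (rule mixed_multilinearI)
    fix v hs assume "v \<in> carrier V" "hs \<in> tuples H k"
    then show "(\<Oplus>\<^bsub>N\<^esub>i\<in>I. f i (v, hs)) \<in> carrier N"
      using mixed_multilinearD(1)[OF f] by (intro N.M.finsum_closed) auto
  next
    fix hs assume "hs \<in> tuples H k"
    then show "mod_hom K V N (\<lambda>v. \<Oplus>\<^bsub>N\<^esub>i\<in>I. f i (v, hs))"
      by (intro mod_hom_finsum assms(1,2,4) mixed_multilinearD(2)[OF f])
  next
    fix v hs j assume "v \<in> carrier V" "hs \<in> tuples H k" "j < k"
    then show "mod_hom K H N (\<lambda>h. \<Oplus>\<^bsub>N\<^esub>i\<in>I. f i (v, hs[j := h]))"
      by (intro mod_hom_finsum assms(1,3,4) mixed_multilinearD(3)[OF f])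
  qed
qed

locale mixed_power =
  fixes K and V and H and k :: nat
  assumes module_V: "module K V" and module_H: "module K H"
begin

sublocale V: module K V by (rule module_V)
sublocale H: module K H by (rule module_H)

lemma mixed_relations_closed:
  "mixed_relations K V H k \<subseteq> carrier (free_module K (mixed_tuples V H k))"
proof -
  have "linearity_relations K (mixed_tuples V H k) V (\<lambda>v. (v, ws))
      \<subseteq> carrier (free_module K (mixed_tuples V H k))" if "ws \<in> tuples H k" for ws
    by (rule linearity_relations_closed[OF module_V]) (use that in \<open>simp add: mixed_tuples_def\<close>)
  moreover have "linearity_relations K (mixed_tuples V H k) H (\<lambda>w. (v, ws[i := w]))
      \<subseteq> carrier (free_module K (mixed_tuples V H k))" if "v \<in> carrier V" "ws \<in> tuples H k" for v ws i
    by (rule linearity_relations_closed[OF module_H])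
      (use that tuples_update[OF that(2)] in \<open>simp add: mixed_tuples_def\<close>)
  ultimately show ?thesis unfolding mixed_relations_def by blast
qed

sublocale presentation K "mixed_tuples V H k" "mixed_relations K V H k"
  by (rule presentation.intro[OF V.R.is_cring mixed_relations_closed])

lemma cring_K: "cring K"
  by (rule V.R.is_cring)

lemma mixed_tuple: "v \<in> carrier V \<Longrightarrow> hs \<in> tuples H k \<Longrightarrow> (v, hs) \<in> mixed_tuples V H k"
  by (simp add: mixed_tuples_def)

lemma mixed_multilinear_cls: "mixed_multilinear K V H k P cls"
proof (rule mixed_multilinearI)
  show "cls (v, hs) \<in> carrier P" if "v \<in> carrier V" "hs \<in> tuples H k" for v hs
    by (rule cls_closed[OF mixed_tuple[OF that]])
  show "mod_hom K V P (\<lambda>v. cls (v, hs))" if "hs \<in> tuples H k" for hs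
  proof (rule cls_linear[OF module_V])
    show "linearity_relations K (mixed_tuples V H k) V (\<lambda>v. (v, hs)) \<subseteq> mixed_relations K V H k"
      using that unfolding mixed_relations_def by blast
  qed (rule mixed_tuple[OF _ that])
  show "mod_hom K H P (\<lambda>h. cls (v, hs[i := h]))" if "v \<in> carrier V" "hs \<in> tuples H k" "i < k" for v hs i
  proof (rule cls_linear[OF module_H])
    show "linearity_relations K (mixed_tuples V H k) H (\<lambda>h. (v, hs[i := h])) \<subseteq> mixed_relations K V H k"
      using that unfolding mixed_relations_def by blast
  qed (rule mixed_tuple[OF that(1) tuples_update[OF that(2)]])
qed

lemma
  assumes f: "mixed_multilinear K V H k N f" and N: "module K N"
  shows mixed_lift_hom: "mod_hom K P N (presented_lift K (mixed_tuples V H k) N f)"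
    and mixed_lift_cls: "v \<in> carrier V \<Longrightarrow> hs \<in> tuples H k \<Longrightarrow>
      presented_lift K (mixed_tuples V H k) N f (cls (v, hs)) = f (v, hs)"
proof -
  let ?X = "mixed_tuples V H k"
  have fN: "f x \<in> carrier N" if "x \<in> ?X" for x
    using that mixed_multilinearD(1)[OF f] by (auto simp: mixed_tuples_def)
  have kills: "linear_extension K ?X N f r = \<zero>\<^bsub>N\<^esub>" if r: "r \<in> mixed_relations K V H k" for r
  proof -
    consider (left) ws where "ws \<in> tuples H k" "r \<in> linearity_relations K ?X V (\<lambda>v. (v, ws))"
      | (right) v ws i where "v \<in> carrier V" "ws \<in> tuples H k" "i < k"
          "r \<in> linearity_relations K ?X H (\<lambda>w. (v, ws[i := w]))"
      using r unfolding mixed_relations_def by blast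
    then show ?thesis
    proof cases
      case left
      show ?thesis
        by (rule linear_extension_linearity_relation[OF mixed_multilinearD(2)[OF f left(1)] fN _ left(2)])
          (assumption | rule mixed_tuple[OF _ left(1)])+
    next
      case right
      show ?thesis
        by (rule linear_extension_linearity_relation[OF mixed_multilinearD(3)[OF f right(1-3)] fN _ right(4)])
          (assumption | rule mixed_tuple[OF right(1) tuples_update[OF right(2)]])+
    qed
  qed
  show "mod_hom K P N (presented_lift K ?X N f)"
    by (rule presented_lift_hom[OF N fN kills])
  show "presented_lift K ?X N f (cls (v, hs)) = f (v, hs)" if "v \<in> carrier V" "hs \<in> tuples H k"
    by (rule presented_lift_cls[OF N fN kills mixed_tuple[OF that]])
qed

lemma mixed_eqI:
  assumes "mod_hom K P N f" "mod_hom K P N h" "x \<in> carrier P"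
    and "\<And>v hs. v \<in> carrier V \<Longrightarrow> hs \<in> tuples H k \<Longrightarrow> f (cls (v, hs)) = h (cls (v, hs))"
  shows "f x = h x"
  by (rule hom_eqI[OF assms(1,2) _ assms(3)]) (use assms(4) in \<open>auto simp: mixed_tuples_def\<close>)

end

section \<open>The Loday complex of a representation\<close>

lemma delete_nth_append: "j < length xs \<Longrightarrow> delete_nth j (xs @ [a]) = delete_nth j xs @ [a]"
  by (simp add: delete_nth_def)

lemma delete_nth_last: "delete_nth (length xs) (xs @ [a]) = xs"
  by (simp add: delete_nth_def)

lemma delete_nth_tuple: "hs \<in> tuples H (Suc k) \<Longrightarrow> j < Suc k \<Longrightarrow> delete_nth j hs \<in> tuples H k"
  using set_take_subset[of j hs] set_drop_subset[of "Suc j" hs]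
  by (auto simp: tuples_def delete_nth_def)

lemma delete_nth_update_eq: "delete_nth j (hs[j := w]) = delete_nth j hs"
  by (simp add: delete_nth_def)

lemma delete_nth_update_less: "l < j \<Longrightarrow> delete_nth j (hs[l := w]) = (delete_nth j hs)[l := w]"
  by (cases "l < length hs") (simp_all add: delete_nth_def take_update_swap list_update_append)

lemma delete_nth_update_greater:
  "j < l \<Longrightarrow> l < length hs \<Longrightarrow> delete_nth j (hs[l := w]) = (delete_nth j hs)[l - 1 := w]"
proof -
  assume "j < l" "l < length hs"
  then have "min (length hs) j = j" "\<not> l - 1 < j" "l - 1 - j = l - Suc j" "Suc j \<le> l" "j \<le> l"
    by linarith+
  then show ?thesis
    by (simp add: delete_nth_def list_update_append drop_update_swap del: One_nat_def)
qed

lemma tuples_append: "hs \<in> tuples H k \<Longrightarrow> a \<in> carrier H \<Longrightarrow> hs @ [a] \<in> tuples H (Suc k)"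
  by (auto simp: tuples_def)

lemma tuples_Suc_cases:
  assumes "hs \<in> tuples H (Suc k)"
  obtains hs' a where "hs = hs' @ [a]" "hs' \<in> tuples H k" "a \<in> carrier H"
  using assms by (cases hs rule: rev_cases) (auto simp: tuples_def)

text \<open>A Leibniz algebra \<open>H\<close> acting from the right on \<open>V\<close>. These two identities are what makes the
  Loday differential square to zero.\<close>

locale leibniz_representation =
  fixes K and V and H and act and brk
  assumes module_V: "module K V" and module_H: "module K H"
    and act_left: "\<And>h. h \<in> carrier H \<Longrightarrow> mod_hom K V V (\<lambda>v. act v h)"
    and act_right: "\<And>v. v \<in> carrier V \<Longrightarrow> mod_hom K H V (act v)"
    and brk_left: "\<And>b. b \<in> carrier H \<Longrightarrow> mod_hom K H H (\<lambda>a. brk a b)"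
    and brk_right: "\<And>a. a \<in> carrier H \<Longrightarrow> mod_hom K H H (brk a)"
    and act_act: "\<And>v a b. \<lbrakk>v \<in> carrier V; a \<in> carrier H; b \<in> carrier H\<rbrakk> \<Longrightarrow>
      act (act v a) b = act (act v b) a \<oplus>\<^bsub>V\<^esub> act v (brk a b)"
    and brk_brk: "\<And>a b c. \<lbrakk>a \<in> carrier H; b \<in> carrier H; c \<in> carrier H\<rbrakk> \<Longrightarrow>
      brk (brk a b) c = brk (brk a c) b \<oplus>\<^bsub>H\<^esub> brk a (brk b c)"
begin

abbreviation C where "C k \<equiv> mixed_tensor_product K V H k"
abbreviation t where "t k \<equiv> mixed_tensor K V H k"
abbreviation d where "d k \<equiv> loday_differential K V H brk act k"

lemma act_closed: "v \<in> carrier V \<Longrightarrow> h \<in> carrier H \<Longrightarrow> act v h \<in> carrier V"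
  by (rule hom_closed[OF act_right])

lemma brk_closed: "a \<in> carrier H \<Longrightarrow> b \<in> carrier H \<Longrightarrow> brk a b \<in> carrier H"
  by (rule hom_closed[OF brk_right])

lemma mixed: "mixed_power K V H"
  by (rule mixed_power.intro[OF module_V module_H])

lemma presentation_C: "presentation K (mixed_tuples V H k) (mixed_relations K V H k)"
  by (rule presentation.intro[OF mixed_power.cring_K[OF mixed] mixed_power.mixed_relations_closed[OF mixed]])

lemma module_C: "module K (C k)"
  unfolding mixed_tensor_product_def presented_module_def
  by (rule module_quotient.module_Q) (rule module_quotient.intro,
      rule module.span_is_submodule[OF module_free_module[OF mixed_power.cring_K[OF mixed]]
          mixed_power.mixed_relations_closed[OF mixed]])

lemma t_multilinear: "mixed_multilinear K V H k (C k) (t k)"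
  using mixed_power.mixed_multilinear_cls[OF mixed]
  by (simp add: mixed_tensor_product_def mixed_tensor_def[abs_def])

lemmas t_closed = mixed_multilinearD(1)[OF t_multilinear]
lemmas t_left = mixed_multilinearD(2)[OF t_multilinear]
lemmas t_slot = mixed_multilinearD(3)[OF t_multilinear]

lemma
  assumes "mixed_multilinear K V H k N f" "module K N"
  shows lift_C_hom: "mod_hom K (C k) N (presented_lift K (mixed_tuples V H k) N f)"
    and lift_C_t: "v \<in> carrier V \<Longrightarrow> hs \<in> tuples H k \<Longrightarrow>
      presented_lift K (mixed_tuples V H k) N f (t k (v, hs)) = f (v, hs)"
  using mixed_power.mixed_lift_hom[OF mixed assms] mixed_power.mixed_lift_cls[OF mixed assms]
  by (simp_all add: mixed_tensor_product_def mixed_tensor_def)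

lemma C_eqI:
  assumes "mod_hom K (C k) N f" "mod_hom K (C k) N h" "x \<in> carrier (C k)"
    and "\<And>v hs. v \<in> carrier V \<Longrightarrow> hs \<in> tuples H k \<Longrightarrow> f (t k (v, hs)) = h (t k (v, hs))"
  shows "f x = h x"
  using mixed_power.mixed_eqI[OF mixed, of k N f h x] assms
  by (simp add: mixed_tensor_product_def mixed_tensor_def)

lemma t_left_comp: "mod_hom K U V f \<Longrightarrow> hs \<in> tuples H k \<Longrightarrow> mod_hom K U (C k) (\<lambda>u. t k (f u, hs))"
  by (rule mod_hom_comp[OF _ t_left])

lemma t_slot_comp:
  "mod_hom K U H f \<Longrightarrow> v \<in> carrier V \<Longrightarrow> hs \<in> tuples H k \<Longrightarrow> i < k \<Longrightarrow>
    mod_hom K U (C k) (\<lambda>u. t k (v, hs[i := f u]))"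
  by (rule mod_hom_comp[OF _ t_slot])

subsection \<open>The differential\<close>

definition sg where "sg j = (\<ominus>\<^bsub>K\<^esub> \<one>\<^bsub>K\<^esub>) [^]\<^bsub>K\<^esub> Suc j"

lemma sg_closed: "sg j \<in> carrier K"
proof -
  interpret V: module K V by (rule module_V)
  show ?thesis by (simp add: sg_def)
qed

lemma sg_Suc:
  assumes "module K N" "x \<in> carrier N"
  shows "sg (Suc j) \<odot>\<^bsub>N\<^esub> x = \<ominus>\<^bsub>N\<^esub> (sg j \<odot>\<^bsub>N\<^esub> x)"
proof -
  interpret N: module K N by fact
  have "sg (Suc j) = \<ominus>\<^bsub>K\<^esub> sg j"
    unfolding sg_def nat_pow_Suc[of _ _ "Suc j"] by (simp add: N.R.r_minus)
  then show ?thesis using assms(2) sg_closed by (simp add: N.smult_l_minus)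
qed

text \<open>The differential of \<open>v \<otimes> h\<^sub>1 \<otimes> \<dots> \<otimes> h\<^sub>k\<close> has summands in which one factor \<open>h\<^sub>j\<close> is removed
  after having acted on \<open>v\<close> or on an earlier factor \<open>h\<^sub>i\<close>; both are multilinear separately.\<close>

definition act_term where
  "act_term k j = (\<lambda>(v, hs). t k (act v (hs ! j), delete_nth j hs))"

definition brk_term where
  "brk_term k j i = (\<lambda>(v, hs). t k (v, delete_nth j (hs[i := brk (hs ! i) (hs ! j)])))"

definition loday_sum where
  "loday_sum k x = (\<Oplus>\<^bsub>C k\<^esub>j\<in>{..<Suc k}. sg j \<odot>\<^bsub>C k\<^esub> act_term k j x) \<oplus>\<^bsub>C k\<^esub>
     (\<Oplus>\<^bsub>C k\<^esub>j\<in>{..<Suc k}. \<Oplus>\<^bsub>C k\<^esub>i\<in>{..<j}. sg j \<odot>\<^bsub>C k\<^esub> brk_term k j i x)"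

lemma d_eq: "d (Suc k) = presented_lift K (mixed_tuples V H (Suc k)) (C k) (loday_sum k)"
  by (simp add: loday_differential_def Let_def loday_sum_def[abs_def] act_term_def brk_term_def sg_def
      case_prod_unfold)

lemma act_term_multilinear:
  assumes j: "j < Suc k"
  shows "mixed_multilinear K V H (Suc k) (C k) (act_term k j)"
proof (rule mixed_multilinearI)
  fix v hs assume v: "v \<in> carrier V" and hs: "hs \<in> tuples H (Suc k)"
  show "act_term k j (v, hs) \<in> carrier (C k)"
    unfolding act_term_def prod.case
    by (intro t_closed act_closed v tuples_nth[OF hs j] delete_nth_tuple[OF hs j])
next
  fix hs assume hs: "hs \<in> tuples H (Suc k)"
  show "mod_hom K V (C k) (\<lambda>v. act_term k j (v, hs))"
    unfolding act_term_def prod.case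
    by (intro t_left_comp act_left tuples_nth[OF hs j] delete_nth_tuple[OF hs j])
next
  fix v hs l assume v: "v \<in> carrier V" and hs: "hs \<in> tuples H (Suc k)" and l: "l < Suc k"
  have len: "length hs = Suc k" by (rule tuples_length[OF hs])
  have av: "act v (hs ! j) \<in> carrier V" by (rule act_closed[OF v tuples_nth[OF hs j]])
  note del = delete_nth_tuple[OF hs j]
  consider "l = j" | "l < j" | "j < l" by linarith
  then show "mod_hom K H (C k) (\<lambda>h. act_term k j (v, hs[l := h]))"
  proof cases
    case 1
    then show ?thesis
      unfolding act_term_def prod.case using len j
      by (simp add: delete_nth_update_eq t_left_comp[OF act_right[OF v] del])
  next
    case 2
    then show ?thesis
      unfolding act_term_def prod.case using j
      by (simp add: delete_nth_update_less t_slot[OF av del])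
  next
    case 3
    then show ?thesis
      unfolding act_term_def prod.case using l len
      by (simp add: delete_nth_update_greater t_slot[OF av del])
  qed
qed

lemma brk_term_multilinear:
  assumes j: "j < Suc k" and i: "i < j"
  shows "mixed_multilinear K V H (Suc k) (C k) (brk_term k j i)"
proof (rule mixed_multilinearI)
  have i': "i < Suc k" using i j by simp
  have ik: "i < k" using i j by simp
  have closed: "delete_nth j (hs[i := brk (hs ! i) (hs ! j)]) \<in> tuples H k" if hs: "hs \<in> tuples H (Suc k)" for hs
    by (intro delete_nth_tuple j tuples_update hs brk_closed tuples_nth[OF hs] i')
  show "brk_term k j i (v, hs) \<in> carrier (C k)" if "v \<in> carrier V" "hs \<in> tuples H (Suc k)" for v hs
    unfolding brk_term_def prod.case by (intro t_closed that closed)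
  show "mod_hom K V (C k) (\<lambda>v. brk_term k j i (v, hs))" if "hs \<in> tuples H (Suc k)" for hs
    unfolding brk_term_def prod.case by (intro t_left that closed)
  fix v hs l assume v: "v \<in> carrier V" and hs: "hs \<in> tuples H (Suc k)" and l: "l < Suc k"
  have len: "length hs = Suc k" by (rule tuples_length[OF hs])
  note del = delete_nth_tuple[OF hs j]
  note hi = tuples_nth[OF hs i'] and hj = tuples_nth[OF hs j]
  have upd: "delete_nth j (hs[i := w]) = (delete_nth j hs)[i := w]" for w
    by (rule delete_nth_update_less[OF i])
  have up: "(delete_nth j hs)[i := brk (hs ! i) (hs ! j)] \<in> tuples H k"
    using closed[OF hs] by (simp add: upd)
  consider "l = i" | "l = j" | "l \<noteq> i" "l < j" | "l \<noteq> i" "j < l" by linarith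
  then show "mod_hom K H (C k) (\<lambda>h. brk_term k j i (v, hs[l := h]))"
  proof cases
    case 1
    then show ?thesis
      unfolding brk_term_def prod.case using len i i' t_slot_comp[OF brk_left[OF hj] v del ik]
      by (simp add: upd)
  next
    case 2
    then have "delete_nth j ((hs[l := h])[i := brk (hs[l := h] ! i) (hs[l := h] ! j)]) =
        (delete_nth j hs)[i := brk (hs ! i) h]" for h
      using i j len by (simp add: delete_nth_update_less delete_nth_update_eq)
    then show ?thesis
      unfolding brk_term_def prod.case using t_slot_comp[OF brk_right[OF hi] v del ik] by simp
  next
    case 3
    then have "delete_nth j ((hs[l := h])[i := brk (hs[l := h] ! i) (hs[l := h] ! j)]) =
        ((delete_nth j hs)[i := brk (hs ! i) (hs ! j)])[l := h]" for h
      using i j len by (simp add: delete_nth_update_less list_update_swap)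
    then show ?thesis
      unfolding brk_term_def prod.case using t_slot[OF v up, of l] 3 j by simp
  next
    case 4
    then have "delete_nth j ((hs[l := h])[i := brk (hs[l := h] ! i) (hs[l := h] ! j)]) =
        ((delete_nth j hs)[i := brk (hs ! i) (hs ! j)])[l - 1 := h]" for h
      using i j l len by (simp add: delete_nth_update_less delete_nth_update_greater list_update_swap)
    then show ?thesis
      unfolding brk_term_def prod.case using t_slot[OF v up, of "l - 1"] 4 l by simp
  qed
qed

lemma loday_sum_multilinear: "mixed_multilinear K V H (Suc k) (C k) (loday_sum k)"
  unfolding loday_sum_def
  by (intro mixed_multilinear_plus mixed_multilinear_finsum mixed_multilinear_scale
      act_term_multilinear brk_term_multilinear module_C module_V module_H sg_closed)
    simp_all

lemma d_hom: "mod_hom K (C (Suc k)) (C k) (d (Suc k))"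
  unfolding d_eq by (rule lift_C_hom[OF loday_sum_multilinear module_C])

lemma d_t: "v \<in> carrier V \<Longrightarrow> hs \<in> tuples H (Suc k) \<Longrightarrow> d (Suc k) (t (Suc k) (v, hs)) = loday_sum k (v, hs)"
  unfolding d_eq by (rule lift_C_t[OF loday_sum_multilinear module_C])

subsection \<open>Appending a factor, and the action on the complex\<close>

definition append_factor where
  "append_factor k a = presented_lift K (mixed_tuples V H k) (C (Suc k)) (\<lambda>(v, hs). t (Suc k) (v, hs @ [a]))"

lemma append_multilinear:
  assumes a: "a \<in> carrier H"
  shows "mixed_multilinear K V H k (C (Suc k)) (\<lambda>(v, hs). t (Suc k) (v, hs @ [a]))"
proof (rule mixed_multilinearI; unfold prod.case)
  fix v hs i assume "v \<in> carrier V" "hs \<in> tuples H k" "i < k"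
  then show "mod_hom K H (C (Suc k)) (\<lambda>h. t (Suc k) (v, hs[i := h] @ [a]))"
    using t_slot[of v "hs @ [a]" "Suc k" i] tuples_append[OF _ a, of hs k] tuples_length[of hs H k]
    by (simp add: list_update_append)
qed (intro t_closed t_left tuples_append a | assumption)+

lemma append_hom: "a \<in> carrier H \<Longrightarrow> mod_hom K (C k) (C (Suc k)) (append_factor k a)"
  unfolding append_factor_def by (rule lift_C_hom[OF append_multilinear module_C])

lemma append_t: "a \<in> carrier H \<Longrightarrow> v \<in> carrier V \<Longrightarrow> hs \<in> tuples H k \<Longrightarrow>
    append_factor k a (t k (v, hs)) = t (Suc k) (v, hs @ [a])"
  unfolding append_factor_def using lift_C_t[OF append_multilinear module_C] by simp

lemma append_closed: "a \<in> carrier H \<Longrightarrow> x \<in> carrier (C k) \<Longrightarrow> append_factor k a x \<in> carrier (C (Suc k))"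
  by (rule hom_closed[OF append_hom])

text \<open>Appending factors generates the next degree, which allows inductions on the degree.\<close>

lemma C_Suc_eqI:
  assumes f: "mod_hom K (C (Suc k)) N f" and h: "mod_hom K (C (Suc k)) N h" and x: "x \<in> carrier (C (Suc k))"
    and eq: "\<And>a y. a \<in> carrier H \<Longrightarrow> y \<in> carrier (C k) \<Longrightarrow> f (append_factor k a y) = h (append_factor k a y)"
  shows "f x = h x"
proof (rule C_eqI[OF f h x])
  fix v hs assume v: "v \<in> carrier V" and "hs \<in> tuples H (Suc k)"
  then obtain hs' a where hs: "hs = hs' @ [a]" "hs' \<in> tuples H k" "a \<in> carrier H"
    by (rule_tac tuples_Suc_cases)
  show "f (t (Suc k) (v, hs)) = h (t (Suc k) (v, hs))"
    using eq[OF hs(3) t_closed[OF v hs(2)]] append_t[OF hs(3) v hs(2)] hs(1) by simp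
qed

lemma append_plus:
  assumes "a \<in> carrier H" "b \<in> carrier H" "x \<in> carrier (C k)"
  shows "append_factor k (a \<oplus>\<^bsub>H\<^esub> b) x = append_factor k a x \<oplus>\<^bsub>C (Suc k)\<^esub> append_factor k b x"
proof -
  interpret H: module K H by (rule module_H)
  have ab: "a \<oplus>\<^bsub>H\<^esub> b \<in> carrier H" using assms by simp
  show ?thesis
  proof (rule C_eqI[OF append_hom[OF ab] mod_hom_plus[OF append_hom[OF assms(1)] append_hom[OF assms(2)]] assms(3)])
    fix v hs assume v: "v \<in> carrier V" and hs: "hs \<in> tuples H k"
    have "mod_hom K H (C (Suc k)) (\<lambda>h. t (Suc k) (v, hs @ [h]))"
      using t_slot[OF v tuples_append[OF hs assms(1)], of k] tuples_length[OF hs]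
      by (simp add: list_update_append)
    from hom_add[OF this assms(1,2)]
    show "append_factor k (a \<oplus>\<^bsub>H\<^esub> b) (t k (v, hs)) =
        append_factor k a (t k (v, hs)) \<oplus>\<^bsub>C (Suc k)\<^esub> append_factor k b (t k (v, hs))"
      by (simp only: append_t[OF ab v hs] append_t[OF assms(1) v hs] append_t[OF assms(2) v hs])
  qed
qed

text \<open>The action of \<open>H\<close> on \<open>V \<otimes> H\<^sup>\<otimes>\<^sup>k\<close> by the Leibniz rule.\<close>

definition act_sum where
  "act_sum k b = (\<lambda>(v, hs). t k (act v b, hs) \<oplus>\<^bsub>C k\<^esub> (\<Oplus>\<^bsub>C k\<^esub>i\<in>{..<k}. t k (v, hs[i := brk (hs ! i) b])))"

definition act_C where
  "act_C k b = presented_lift K (mixed_tuples V H k) (C k) (act_sum k b)"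

lemma act_sum_multilinear:
  assumes b: "b \<in> carrier H"
  shows "mixed_multilinear K V H k (C k) (act_sum k b)"
proof -
  have 1: "mixed_multilinear K V H k (C k) (\<lambda>(v, hs). t k (act v b, hs))"
  proof (rule mixed_multilinearI; unfold prod.case)
    show "t k (act v b, hs) \<in> carrier (C k)" if "v \<in> carrier V" "hs \<in> tuples H k" for v hs
      by (intro t_closed act_closed that b)
    show "mod_hom K V (C k) (\<lambda>v. t k (act v b, hs))" if "hs \<in> tuples H k" for hs
      by (intro t_left_comp act_left b that)
    show "mod_hom K H (C k) (\<lambda>h. t k (act v b, hs[i := h]))" if "v \<in> carrier V" "hs \<in> tuples H k" "i < k" for v hs i
      by (intro t_slot act_closed that b)
  qed
  have 2: "mixed_multilinear K V H k (C k) (\<lambda>(v, hs). t k (v, hs[i := brk (hs ! i) b]))" if i: "i < k" for i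
  proof (rule mixed_multilinearI; unfold prod.case)
    have up: "hs[i := brk (hs ! i) b] \<in> tuples H k" if hs: "hs \<in> tuples H k" for hs
      by (intro tuples_update hs brk_closed tuples_nth[OF hs i] b)
    show "t k (v, hs[i := brk (hs ! i) b]) \<in> carrier (C k)" if "v \<in> carrier V" "hs \<in> tuples H k" for v hs
      by (intro t_closed up that)
    show "mod_hom K V (C k) (\<lambda>v. t k (v, hs[i := brk (hs ! i) b]))" if "hs \<in> tuples H k" for hs
      by (intro t_left up that)
    fix v hs l assume v: "v \<in> carrier V" and hs: "hs \<in> tuples H k" and l: "l < k"
    show "mod_hom K H (C k) (\<lambda>h. t k (v, hs[l := h, i := brk (hs[l := h] ! i) b]))"
    proof (cases "l = i")
      case True
      then show ?thesis using t_slot_comp[OF brk_left[OF b] v hs i] tuples_length[OF hs] i by simp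
    next
      case False
      then show ?thesis using t_slot[OF v up[OF hs] l] by (simp add: list_update_swap)
    qed
  qed
  have "mixed_multilinear K V H k (C k) (\<lambda>x. (case x of (v, hs) \<Rightarrow> t k (act v b, hs)) \<oplus>\<^bsub>C k\<^esub>
      (\<Oplus>\<^bsub>C k\<^esub>i\<in>{..<k}. case x of (v, hs) \<Rightarrow> t k (v, hs[i := brk (hs ! i) b])))"
    using 2 by (intro mixed_multilinear_plus mixed_multilinear_finsum module_C module_V module_H 1) simp_all
  then show ?thesis by (simp add: act_sum_def case_prod_unfold)
qed

lemma act_C_hom: "b \<in> carrier H \<Longrightarrow> mod_hom K (C k) (C k) (act_C k b)"
  unfolding act_C_def by (rule lift_C_hom[OF act_sum_multilinear module_C])

lemma act_C_t: "b \<in> carrier H \<Longrightarrow> v \<in> carrier V \<Longrightarrow> hs \<in> tuples H k \<Longrightarrow>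
    act_C k b (t k (v, hs)) = t k (act v b, hs) \<oplus>\<^bsub>C k\<^esub> (\<Oplus>\<^bsub>C k\<^esub>i\<in>{..<k}. t k (v, hs[i := brk (hs ! i) b]))"
  unfolding act_C_def using lift_C_t[OF act_sum_multilinear module_C] by (simp add: act_sum_def)

lemma act_C_closed: "b \<in> carrier H \<Longrightarrow> x \<in> carrier (C k) \<Longrightarrow> act_C k b x \<in> carrier (C k)"
  by (rule hom_closed[OF act_C_hom])

lemma act_C_append:
  assumes b: "b \<in> carrier H" and a: "a \<in> carrier H" and x: "x \<in> carrier (C k)"
  shows "act_C (Suc k) b (append_factor k a x) =
    append_factor k a (act_C k b x) \<oplus>\<^bsub>C (Suc k)\<^esub> append_factor k (brk a b) x"
proof -
  interpret C: module K "C (Suc k)" by (rule module_C)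
  have ab: "brk a b \<in> carrier H" by (rule brk_closed[OF a b])
  show ?thesis
  proof (rule C_eqI[OF mod_hom_comp[OF append_hom[OF a] act_C_hom[OF b]]
        mod_hom_plus[OF mod_hom_comp[OF act_C_hom[OF b] append_hom[OF a]] append_hom[OF ab]] x])
    fix v hs assume v: "v \<in> carrier V" and hs: "hs \<in> tuples H k"
    have len: "length hs = k" by (rule tuples_length[OF hs])
    have vb: "act v b \<in> carrier V" by (rule act_closed[OF v b])
    note ha = tuples_append[OF hs a]
    have up: "hs[i := brk (hs ! i) b] \<in> tuples H k" if "i < k" for i
      by (intro tuples_update hs brk_closed tuples_nth[OF hs that] b)
    let ?s = "\<lambda>i. t (Suc k) (v, hs[i := brk (hs ! i) b] @ [a])"
    have s: "?s i \<in> carrier (C (Suc k))" if "i < k" for i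
      by (intro t_closed v tuples_append up that a)
    have last: "t (Suc k) (v, hs @ [brk a b]) \<in> carrier (C (Suc k))"
      by (intro t_closed v tuples_append hs ab)
    have first: "t (Suc k) (act v b, hs @ [a]) \<in> carrier (C (Suc k))"
      by (intro t_closed vb ha)
    have "(\<Oplus>\<^bsub>C (Suc k)\<^esub>i\<in>{..<Suc k}. t (Suc k) (v, (hs @ [a])[i := brk ((hs @ [a]) ! i) b])) =
        t (Suc k) (v, hs @ [brk a b]) \<oplus>\<^bsub>C (Suc k)\<^esub> (\<Oplus>\<^bsub>C (Suc k)\<^esub>i\<in>{..<k}. ?s i)"
      unfolding lessThan_Suc
    proof (subst C.M.finsum_insert)
      show "(\<lambda>i. t (Suc k) (v, (hs @ [a])[i := brk ((hs @ [a]) ! i) b])) \<in> {..<k} \<rightarrow> carrier (C (Suc k))"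
        using s len by (simp add: Pi_def list_update_append nth_append)
      show "t (Suc k) (v, (hs @ [a])[k := brk ((hs @ [a]) ! k) b]) \<in> carrier (C (Suc k))"
        using last len by (simp add: list_update_append nth_append)
      have "(\<Oplus>\<^bsub>C (Suc k)\<^esub>i\<in>{..<k}. t (Suc k) (v, (hs @ [a])[i := brk ((hs @ [a]) ! i) b])) =
          (\<Oplus>\<^bsub>C (Suc k)\<^esub>i\<in>{..<k}. ?s i)"
        by (rule C.M.finsum_cong'[OF refl])
          (use s len in \<open>simp_all add: Pi_def list_update_append nth_append\<close>)
      then show "t (Suc k) (v, (hs @ [a])[k := brk ((hs @ [a]) ! k) b]) \<oplus>\<^bsub>C (Suc k)\<^esub>
          (\<Oplus>\<^bsub>C (Suc k)\<^esub>i\<in>{..<k}. t (Suc k) (v, (hs @ [a])[i := brk ((hs @ [a]) ! i) b])) =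
          t (Suc k) (v, hs @ [brk a b]) \<oplus>\<^bsub>C (Suc k)\<^esub> (\<Oplus>\<^bsub>C (Suc k)\<^esub>i\<in>{..<k}. ?s i)"
        using len by (simp add: list_update_append nth_append)
    qed simp_all
    moreover have "append_factor k a (\<Oplus>\<^bsub>C k\<^esub>i\<in>{..<k}. t k (v, hs[i := brk (hs ! i) b])) =
        (\<Oplus>\<^bsub>C (Suc k)\<^esub>i\<in>{..<k}. ?s i)"
    proof -
      have "append_factor k a (\<Oplus>\<^bsub>C k\<^esub>i\<in>{..<k}. t k (v, hs[i := brk (hs ! i) b])) =
          (\<Oplus>\<^bsub>C (Suc k)\<^esub>i\<in>{..<k}. append_factor k a (t k (v, hs[i := brk (hs ! i) b])))"
        by (rule finsum_mod_hom[OF append_hom[OF a]]) (simp add: t_closed v up)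
      also have "\<dots> = (\<Oplus>\<^bsub>C (Suc k)\<^esub>i\<in>{..<k}. ?s i)"
        by (rule C.M.finsum_cong'[OF refl]) (use s in \<open>simp_all add: append_t a v up\<close>)
      finally show ?thesis .
    qed
    moreover have "(\<Oplus>\<^bsub>C k\<^esub>i\<in>{..<k}. t k (v, hs[i := brk (hs ! i) b])) \<in> carrier (C k)"
    proof -
      interpret Ck: module K "C k" by (rule module_C)
      show ?thesis by (rule Ck.M.finsum_closed) (simp add: Pi_def t_closed v up)
    qed
    moreover have "(\<Oplus>\<^bsub>C (Suc k)\<^esub>i\<in>{..<k}. ?s i) \<in> carrier (C (Suc k))"
      by (rule C.M.finsum_closed) (use s in simp)
    ultimately show "act_C (Suc k) b (append_factor k a (t k (v, hs))) =
        append_factor k a (act_C k b (t k (v, hs))) \<oplus>\<^bsub>C (Suc k)\<^esub> append_factor k (brk a b) (t k (v, hs))"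
      using first last
      by (simp add: append_t a v hs ab act_C_t b ha hom_add[OF append_hom[OF a]] t_closed vb C.M.a_ac)
  qed
qed

text \<open>In degree 0 this is the representation identity of \<open>V\<close>. Expanding both sides on \<open>y \<otimes> a\<close> in a
  higher degree, the mixed terms agree, the terms in which both elements act on \<open>y\<close> agree by
  induction, and those in which both act on \<open>a\<close> agree by the Leibniz identity of \<open>H\<close>.\<close>

lemma act_C_commutator:
  assumes b: "b \<in> carrier H" and c: "c \<in> carrier H" and x: "x \<in> carrier (C k)"
  shows "act_C k c (act_C k b x) = act_C k b (act_C k c x) \<oplus>\<^bsub>C k\<^esub> act_C k (brk b c) x"
  using x
proof (induction k arbitrary: x)
  case 0
  interpret C: module K "C 0" by (rule module_C)
  note bc = brk_closed[OF b c]
  show ?case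
  proof (rule C_eqI[OF mod_hom_comp[OF act_C_hom[OF b] act_C_hom[OF c]]
        mod_hom_plus[OF mod_hom_comp[OF act_C_hom[OF c] act_C_hom[OF b]] act_C_hom[OF bc]] 0])
    fix v hs assume v: "v \<in> carrier V" and hs: "hs \<in> tuples H 0"
    have vb: "act v b \<in> carrier V" and vc: "act v c \<in> carrier V" and vbc: "act v (brk b c) \<in> carrier V"
      by (intro act_closed v b c bc)+
    have act_t: "act_C 0 h (t 0 (w, hs)) = t 0 (act w h, hs)" if "h \<in> carrier H" "w \<in> carrier V" for h w
      using that act_C_t[OF that hs] t_closed[OF act_closed[OF that(2,1)] hs] by simp
    have "t 0 (act (act v b) c, hs) = t 0 (act (act v c) b, hs) \<oplus>\<^bsub>C 0\<^esub> t 0 (act v (brk b c), hs)"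
      unfolding act_act[OF v b c] by (rule hom_add[OF t_left[OF hs] act_closed[OF vc b] vbc])
    then show "act_C 0 c (act_C 0 b (t 0 (v, hs))) =
        act_C 0 b (act_C 0 c (t 0 (v, hs))) \<oplus>\<^bsub>C 0\<^esub> act_C 0 (brk b c) (t 0 (v, hs))"
      by (simp only: act_t b c bc v vb vc)
  qed
next
  case (Suc k)
  interpret C: module K "C (Suc k)" by (rule module_C)
  interpret Ck: module K "C k" by (rule module_C)
  note bc = brk_closed[OF b c]
  show ?case
  proof (rule C_Suc_eqI[OF mod_hom_comp[OF act_C_hom[OF b] act_C_hom[OF c]]
        mod_hom_plus[OF mod_hom_comp[OF act_C_hom[OF c] act_C_hom[OF b]] act_C_hom[OF bc]] Suc.prems])
    fix a y assume a: "a \<in> carrier H" and y: "y \<in> carrier (C k)"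
    let ?ap = "append_factor k" and ?th = "act_C k" and ?Th = "act_C (Suc k)"
    note ab = brk_closed[OF a b] and ac = brk_closed[OF a c]
    note abc = brk_closed[OF ab c] and acb = brk_closed[OF ac b] and a_bc = brk_closed[OF a bc]
    note yb = act_C_closed[OF b y] and yc = act_C_closed[OF c y]
    note ycb = act_C_closed[OF b yc] and ybc = act_C_closed[OF bc y]
    have expand: "?Th q (?Th p (?ap a y)) = (?ap a (?th q (?th p y)) \<oplus>\<^bsub>C (Suc k)\<^esub> ?ap (brk a q) (?th p y)) \<oplus>\<^bsub>C (Suc k)\<^esub>
        (?ap (brk a p) (?th q y) \<oplus>\<^bsub>C (Suc k)\<^esub> ?ap (brk (brk a p) q) y)"
      if p: "p \<in> carrier H" and q: "q \<in> carrier H" for p q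
      using brk_closed[OF a p] act_C_closed[OF p y]
      by (simp add: act_C_append a p q y hom_add[OF act_C_hom[OF q]] append_closed)
    have "?Th c (?Th b (?ap a y)) = (?ap a (?th b (?th c y) \<oplus>\<^bsub>C k\<^esub> ?th (brk b c) y) \<oplus>\<^bsub>C (Suc k)\<^esub> ?ap (brk a c) (?th b y)) \<oplus>\<^bsub>C (Suc k)\<^esub>
        (?ap (brk a b) (?th c y) \<oplus>\<^bsub>C (Suc k)\<^esub> ?ap (brk (brk a c) b \<oplus>\<^bsub>H\<^esub> brk a (brk b c)) y)"
      unfolding expand[OF b c] Suc.IH[OF y] brk_brk[OF a b c] ..
    also have "\<dots> = ?Th b (?Th c (?ap a y)) \<oplus>\<^bsub>C (Suc k)\<^esub> ?Th (brk b c) (?ap a y)"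
      unfolding expand[OF c b] act_C_append[OF bc a y] append_plus[OF acb a_bc y]
        hom_add[OF append_hom[OF a] ycb ybc]
      using append_closed[OF a ycb] append_closed[OF a ybc] append_closed[OF ac yb]
        append_closed[OF ab yc] append_closed[OF acb y] append_closed[OF a_bc y]
      by (simp add: C.M.a_ac)
    finally show "?Th c (?Th b (?ap a y)) = ?Th b (?Th c (?ap a y)) \<oplus>\<^bsub>C (Suc k)\<^esub> ?Th (brk b c) (?ap a y)" .
  qed
qed

lemma d_append_0:
  assumes a: "a \<in> carrier H" and x: "x \<in> carrier (C 0)"
  shows "d (Suc 0) (append_factor 0 a x) = sg 0 \<odot>\<^bsub>C 0\<^esub> act_C 0 a x"
proof -
  interpret C: module K "C 0" by (rule module_C)
  show ?thesis
  proof (rule C_eqI[OF mod_hom_comp[OF append_hom[OF a] d_hom] mod_hom_scale[OF act_C_hom[OF a] sg_closed] x])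
    fix v hs assume v: "v \<in> carrier V" and hs: "hs \<in> tuples H 0"
    have "hs = []" using hs by (simp add: tuples_def)
    moreover have "t 0 (act v a, []) \<in> carrier (C 0)"
      by (intro t_closed act_closed v a) (simp add: tuples_def)
    ultimately show "d (Suc 0) (append_factor 0 a (t 0 (v, hs))) = sg 0 \<odot>\<^bsub>C 0\<^esub> act_C 0 a (t 0 (v, hs))"
      unfolding append_t[OF a v hs] d_t[OF v tuples_append[OF hs a]] act_C_t[OF a v hs]
      using sg_closed
      by (simp add: loday_sum_def act_term_def delete_nth_def lessThan_Suc C.M.finsum_insert)
  qed
qed

text \<open>The summands for the last position \<open>j = k + 1\<close> of \<open>v \<otimes> h\<^sub>1 \<otimes> \<dots> \<otimes> h\<^sub>k\<^sub>+\<^sub>1 \<otimes> a\<close> are the ones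
  where \<open>a\<close> is removed after acting on one of the other factors; together they form the action of
  \<open>a\<close>. The remaining summands leave \<open>a\<close> in place.\<close>

lemma loday_sum_append:
  assumes v: "v \<in> carrier V" and hs: "hs \<in> tuples H (Suc k)" and a: "a \<in> carrier H"
  shows "loday_sum (Suc k) (v, hs @ [a]) =
    append_factor k a (loday_sum k (v, hs)) \<oplus>\<^bsub>C (Suc k)\<^esub> sg (Suc k) \<odot>\<^bsub>C (Suc k)\<^esub> act_C (Suc k) a (t (Suc k) (v, hs))"
proof -
  interpret C: module K "C (Suc k)" by (rule module_C)
  interpret Ck: module K "C k" by (rule module_C)
  let ?C = "C (Suc k)"
  have len: "length hs = Suc k" by (rule tuples_length[OF hs])
  note ap = append_hom[OF a, of k]
  have aj: "act_term k j (v, hs) \<in> carrier (C k)" if "j < Suc k" for j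
    by (rule mixed_multilinearD(1)[OF act_term_multilinear[OF that] v hs])
  have bji: "brk_term k j i (v, hs) \<in> carrier (C k)" if "j < Suc k" "i < j" for j i
    by (rule mixed_multilinearD(1)[OF brk_term_multilinear[OF that] v hs])
  have act_low: "act_term (Suc k) j (v, hs @ [a]) = append_factor k a (act_term k j (v, hs))"
    if j: "j < Suc k" for j
    unfolding act_term_def prod.case
    using len j by (simp add: append_t a act_closed v tuples_nth[OF hs j] delete_nth_tuple[OF hs j]
        delete_nth_append nth_append)
  have act_top: "act_term (Suc k) (Suc k) (v, hs @ [a]) = t (Suc k) (act v a, hs)"
    unfolding act_term_def prod.case using len delete_nth_last[of hs a] by (simp add: nth_append)
  have brk_low: "brk_term (Suc k) j i (v, hs @ [a]) = append_factor k a (brk_term k j i (v, hs))"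
    if j: "j < Suc k" and i: "i < j" for j i
  proof -
    have "hs[i := brk (hs ! i) (hs ! j)] \<in> tuples H (Suc k)"
      using i j by (intro tuples_update hs brk_closed tuples_nth[OF hs]) simp_all
    then show ?thesis
      unfolding brk_term_def prod.case
      using len j i delete_nth_append[of j "hs[i := brk (hs ! i) (hs ! j)]" a]
      by (simp add: append_t a v delete_nth_tuple nth_append list_update_append)
  qed
  have brk_top: "brk_term (Suc k) (Suc k) i (v, hs @ [a]) = t (Suc k) (v, hs[i := brk (hs ! i) a])"
    if i: "i < Suc k" for i
    unfolding brk_term_def prod.case
    using len i delete_nth_last[of "hs[i := brk (hs ! i) a]" a] by (simp add: nth_append list_update_append)
  let ?A = "\<lambda>j. sg j \<odot>\<^bsub>C k\<^esub> act_term k j (v, hs)"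
  let ?B = "\<lambda>j i. sg j \<odot>\<^bsub>C k\<^esub> brk_term k j i (v, hs)"
  let ?S = "\<Oplus>\<^bsub>?C\<^esub>i\<in>{..<Suc k}. t (Suc k) (v, hs[i := brk (hs ! i) a])"
  have A: "?A j \<in> carrier (C k)" if "j < Suc k" for j using aj[OF that] sg_closed by simp
  have B: "?B j i \<in> carrier (C k)" if "j < Suc k" "i < j" for j i using bji[OF that] sg_closed by simp
  have BS: "(\<Oplus>\<^bsub>C k\<^esub>i\<in>{..<j}. ?B j i) \<in> carrier (C k)" if "j < Suc k" for j
    by (rule Ck.M.finsum_closed) (use B[OF that] in simp)
  have AS: "(\<Oplus>\<^bsub>C k\<^esub>j\<in>{..<Suc k}. ?A j) \<in> carrier (C k)"
    by (rule Ck.M.finsum_closed) (use A in simp)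
  have BSS: "(\<Oplus>\<^bsub>C k\<^esub>j\<in>{..<Suc k}. \<Oplus>\<^bsub>C k\<^esub>i\<in>{..<j}. ?B j i) \<in> carrier (C k)"
    by (rule Ck.M.finsum_closed) (use BS in simp)
  have top: "t (Suc k) (act v a, hs) \<in> carrier ?C" by (intro t_closed act_closed v a hs)
  have s: "t (Suc k) (v, hs[i := brk (hs ! i) a]) \<in> carrier ?C" if "i < Suc k" for i
    by (intro t_closed v tuples_update hs brk_closed tuples_nth[OF hs that] a)
  have S: "?S \<in> carrier ?C" by (rule C.M.finsum_closed) (use s in simp)
  have lowA: "sg j \<odot>\<^bsub>?C\<^esub> act_term (Suc k) j (v, hs @ [a]) = append_factor k a (?A j)" if "j < Suc k" for j
    unfolding act_low[OF that] by (rule hom_smult[OF ap sg_closed aj[OF that], symmetric])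
  have lowB: "sg j \<odot>\<^bsub>?C\<^esub> brk_term (Suc k) j i (v, hs @ [a]) = append_factor k a (?B j i)"
    if "j < Suc k" "i < j" for j i
    unfolding brk_low[OF that] by (rule hom_smult[OF ap sg_closed bji[OF that], symmetric])
  have sumA: "(\<Oplus>\<^bsub>?C\<^esub>j\<in>{..<Suc (Suc k)}. sg j \<odot>\<^bsub>?C\<^esub> act_term (Suc k) j (v, hs @ [a])) =
      sg (Suc k) \<odot>\<^bsub>?C\<^esub> t (Suc k) (act v a, hs) \<oplus>\<^bsub>?C\<^esub> append_factor k a (\<Oplus>\<^bsub>C k\<^esub>j\<in>{..<Suc k}. ?A j)"
    (is "?lhs = _")
  proof -
    have low: "(\<Oplus>\<^bsub>?C\<^esub>j\<in>{..<Suc k}. sg j \<odot>\<^bsub>?C\<^esub> act_term (Suc k) j (v, hs @ [a])) =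
        append_factor k a (\<Oplus>\<^bsub>C k\<^esub>j\<in>{..<Suc k}. ?A j)"
    proof -
      have "append_factor k a (\<Oplus>\<^bsub>C k\<^esub>j\<in>{..<Suc k}. ?A j) = (\<Oplus>\<^bsub>?C\<^esub>j\<in>{..<Suc k}. append_factor k a (?A j))"
        by (rule finsum_mod_hom[OF ap]) (use A in simp)
      also have "\<dots> = (\<Oplus>\<^bsub>?C\<^esub>j\<in>{..<Suc k}. sg j \<odot>\<^bsub>?C\<^esub> act_term (Suc k) j (v, hs @ [a]))"
      proof (rule C.M.finsum_cong'[OF refl])
        show "(\<lambda>j. sg j \<odot>\<^bsub>?C\<^esub> act_term (Suc k) j (v, hs @ [a])) \<in> {..<Suc k} \<rightarrow> carrier ?C"
          using lowA append_closed[OF a A] by simp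
      qed (use lowA in simp)
      finally show ?thesis by simp
    qed
    have "?lhs = sg (Suc k) \<odot>\<^bsub>?C\<^esub> act_term (Suc k) (Suc k) (v, hs @ [a]) \<oplus>\<^bsub>?C\<^esub>
        (\<Oplus>\<^bsub>?C\<^esub>j\<in>{..<Suc k}. sg j \<odot>\<^bsub>?C\<^esub> act_term (Suc k) j (v, hs @ [a]))"
      unfolding lessThan_Suc[of "Suc k"]
    proof (rule C.M.finsum_insert)
      show "(\<lambda>j. sg j \<odot>\<^bsub>?C\<^esub> act_term (Suc k) j (v, hs @ [a])) \<in> {..<Suc k} \<rightarrow> carrier ?C"
        using lowA append_closed[OF a A] by simp
      show "sg (Suc k) \<odot>\<^bsub>?C\<^esub> act_term (Suc k) (Suc k) (v, hs @ [a]) \<in> carrier ?C"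
        unfolding act_top using top sg_closed by simp
    qed simp_all
    then show ?thesis unfolding low act_top .
  qed
  have sumB: "(\<Oplus>\<^bsub>?C\<^esub>j\<in>{..<Suc (Suc k)}. \<Oplus>\<^bsub>?C\<^esub>i\<in>{..<j}. sg j \<odot>\<^bsub>?C\<^esub> brk_term (Suc k) j i (v, hs @ [a])) =
      sg (Suc k) \<odot>\<^bsub>?C\<^esub> ?S \<oplus>\<^bsub>?C\<^esub> append_factor k a (\<Oplus>\<^bsub>C k\<^esub>j\<in>{..<Suc k}. \<Oplus>\<^bsub>C k\<^esub>i\<in>{..<j}. ?B j i)"
    (is "?lhs = _")
  proof -
    let ?T = "\<lambda>j. \<Oplus>\<^bsub>?C\<^esub>i\<in>{..<j}. sg j \<odot>\<^bsub>?C\<^esub> brk_term (Suc k) j i (v, hs @ [a])"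
    have low: "?T j = append_factor k a (\<Oplus>\<^bsub>C k\<^esub>i\<in>{..<j}. ?B j i)" if j: "j < Suc k" for j
    proof -
      have "append_factor k a (\<Oplus>\<^bsub>C k\<^esub>i\<in>{..<j}. ?B j i) = (\<Oplus>\<^bsub>?C\<^esub>i\<in>{..<j}. append_factor k a (?B j i))"
        by (rule finsum_mod_hom[OF ap]) (use B[OF j] in simp)
      also have "\<dots> = ?T j"
      proof (rule C.M.finsum_cong'[OF refl])
        show "(\<lambda>i. sg j \<odot>\<^bsub>?C\<^esub> brk_term (Suc k) j i (v, hs @ [a])) \<in> {..<j} \<rightarrow> carrier ?C"
          using lowB[OF j] append_closed[OF a B[OF j]] by simp
      qed (use lowB[OF j] in simp)
      finally show ?thesis by simp
    qed
    have top: "?T (Suc k) = sg (Suc k) \<odot>\<^bsub>?C\<^esub> ?S"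
    proof -
      have "sg (Suc k) \<odot>\<^bsub>?C\<^esub> ?S =
          (\<Oplus>\<^bsub>?C\<^esub>i\<in>{..<Suc k}. sg (Suc k) \<odot>\<^bsub>?C\<^esub> t (Suc k) (v, hs[i := brk (hs ! i) a]))"
        by (rule C.finsum_smult_ldistr) (use s sg_closed in simp_all)
      also have "\<dots> = ?T (Suc k)"
      proof (rule C.M.finsum_cong'[OF refl])
        show "(\<lambda>i. sg (Suc k) \<odot>\<^bsub>?C\<^esub> brk_term (Suc k) (Suc k) i (v, hs @ [a])) \<in> {..<Suc k} \<rightarrow> carrier ?C"
          using brk_top s sg_closed by simp
      qed (use brk_top in simp)
      finally show ?thesis by simp
    qed
    have "(\<Oplus>\<^bsub>?C\<^esub>j\<in>{..<Suc k}. ?T j) = append_factor k a (\<Oplus>\<^bsub>C k\<^esub>j\<in>{..<Suc k}. \<Oplus>\<^bsub>C k\<^esub>i\<in>{..<j}. ?B j i)"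
    proof -
      have "append_factor k a (\<Oplus>\<^bsub>C k\<^esub>j\<in>{..<Suc k}. \<Oplus>\<^bsub>C k\<^esub>i\<in>{..<j}. ?B j i) =
          (\<Oplus>\<^bsub>?C\<^esub>j\<in>{..<Suc k}. append_factor k a (\<Oplus>\<^bsub>C k\<^esub>i\<in>{..<j}. ?B j i))"
        by (rule finsum_mod_hom[OF ap]) (use BS in simp)
      also have "\<dots> = (\<Oplus>\<^bsub>?C\<^esub>j\<in>{..<Suc k}. ?T j)"
      proof (rule C.M.finsum_cong'[OF refl])
        show "?T \<in> {..<Suc k} \<rightarrow> carrier ?C"
          using low append_closed[OF a BS] by simp
      qed (use low in simp)
      finally show ?thesis by simp
    qed
    moreover have "?lhs = ?T (Suc k) \<oplus>\<^bsub>?C\<^esub> (\<Oplus>\<^bsub>?C\<^esub>j\<in>{..<Suc k}. ?T j)"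
      unfolding lessThan_Suc[of "Suc k"]
    proof (rule C.M.finsum_insert)
      show "?T \<in> {..<Suc k} \<rightarrow> carrier ?C" using low append_closed[OF a BS] by simp
      show "?T (Suc k) \<in> carrier ?C"
        unfolding top by (rule C.smult_closed[OF sg_closed S])
    qed simp_all
    ultimately show ?thesis unfolding top by simp
  qed
  have "loday_sum (Suc k) (v, hs @ [a]) =
      (sg (Suc k) \<odot>\<^bsub>?C\<^esub> t (Suc k) (act v a, hs) \<oplus>\<^bsub>?C\<^esub> append_factor k a (\<Oplus>\<^bsub>C k\<^esub>j\<in>{..<Suc k}. ?A j)) \<oplus>\<^bsub>?C\<^esub>
      (sg (Suc k) \<odot>\<^bsub>?C\<^esub> ?S \<oplus>\<^bsub>?C\<^esub> append_factor k a (\<Oplus>\<^bsub>C k\<^esub>j\<in>{..<Suc k}. \<Oplus>\<^bsub>C k\<^esub>i\<in>{..<j}. ?B j i))"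
    unfolding loday_sum_def[of "Suc k"] sumA sumB ..
  also have "\<dots> = append_factor k a (loday_sum k (v, hs)) \<oplus>\<^bsub>?C\<^esub>
      sg (Suc k) \<odot>\<^bsub>?C\<^esub> act_C (Suc k) a (t (Suc k) (v, hs))"
    unfolding act_C_t[OF a v hs] C.smult_r_distr[OF sg_closed top S] loday_sum_def[of k]
      hom_add[OF ap AS BSS]
    using append_closed[OF a AS] append_closed[OF a BSS] C.smult_closed[OF sg_closed top]
      C.smult_closed[OF sg_closed S]
    by (simp only: C.M.a_ac C.M.a_closed)
  finally show ?thesis .
qed

lemma d_append:
  assumes a: "a \<in> carrier H" and x: "x \<in> carrier (C (Suc k))"
  shows "d (Suc (Suc k)) (append_factor (Suc k) a x) =
    append_factor k a (d (Suc k) x) \<oplus>\<^bsub>C (Suc k)\<^esub> sg (Suc k) \<odot>\<^bsub>C (Suc k)\<^esub> act_C (Suc k) a x"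
proof (rule C_eqI[OF mod_hom_comp[OF append_hom[OF a] d_hom]
      mod_hom_plus[OF mod_hom_comp[OF d_hom append_hom[OF a]] mod_hom_scale[OF act_C_hom[OF a] sg_closed]] x])
  fix v hs assume v: "v \<in> carrier V" and hs: "hs \<in> tuples H (Suc k)"
  show "d (Suc (Suc k)) (append_factor (Suc k) a (t (Suc k) (v, hs))) =
      append_factor k a (d (Suc k) (t (Suc k) (v, hs))) \<oplus>\<^bsub>C (Suc k)\<^esub>
      sg (Suc k) \<odot>\<^bsub>C (Suc k)\<^esub> act_C (Suc k) a (t (Suc k) (v, hs))"
    unfolding append_t[OF a v hs] d_t[OF v tuples_append[OF hs a]] d_t[OF v hs]
    by (rule loday_sum_append[OF v hs a])
qed

lemma d_closed: "x \<in> carrier (C (Suc k)) \<Longrightarrow> d (Suc k) x \<in> carrier (C k)"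
  by (rule hom_closed[OF d_hom])

text \<open>Write an element as \<open>y \<otimes> a\<close> and expand with \<open>d_append\<close> and \<open>act_C_append\<close>. The difference of
  the two sides is, up to sign, the failure of \<open>\<theta>\<close> to be a representation on \<open>y\<close>, which is 0.\<close>

lemma d_act_C:
  assumes b: "b \<in> carrier H" and x: "x \<in> carrier (C (Suc k))"
  shows "d (Suc k) (act_C (Suc k) b x) = act_C k b (d (Suc k) x)"
  using x
proof (induction k arbitrary: x)
  case 0
  interpret C: module K "C 0" by (rule module_C)
  show ?case
  proof (rule C_Suc_eqI[OF mod_hom_comp[OF act_C_hom[OF b] d_hom] mod_hom_comp[OF d_hom act_C_hom[OF b]] 0])
    fix a y assume a: "a \<in> carrier H" and y: "y \<in> carrier (C 0)"
    note ab = brk_closed[OF a b] and yb = act_C_closed[OF b y] and ya = act_C_closed[OF a y]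
    have "d (Suc 0) (act_C (Suc 0) b (append_factor 0 a y)) =
        sg 0 \<odot>\<^bsub>C 0\<^esub> act_C 0 a (act_C 0 b y) \<oplus>\<^bsub>C 0\<^esub> sg 0 \<odot>\<^bsub>C 0\<^esub> act_C 0 (brk a b) y"
      unfolding act_C_append[OF b a y] hom_add[OF d_hom append_closed[OF a yb] append_closed[OF ab y]]
        d_append_0[OF a yb] d_append_0[OF ab y] ..
    also have "\<dots> = act_C 0 b (d (Suc 0) (append_factor 0 a y))"
      unfolding d_append_0[OF a y] hom_smult[OF act_C_hom[OF b] sg_closed ya] act_C_commutator[OF a b y]
      by (rule C.smult_r_distr[OF sg_closed act_C_closed[OF a yb] act_C_closed[OF ab y], symmetric])
    finally show "d (Suc 0) (act_C (Suc 0) b (append_factor 0 a y)) = act_C 0 b (d (Suc 0) (append_factor 0 a y))" .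
  qed
next
  case (Suc k)
  interpret C: module K "C (Suc k)" by (rule module_C)
  let ?C = "C (Suc k)" and ?s = "sg (Suc k)"
  show ?case
  proof (rule C_Suc_eqI[OF mod_hom_comp[OF act_C_hom[OF b] d_hom] mod_hom_comp[OF d_hom act_C_hom[OF b]] Suc.prems])
    fix a y assume a: "a \<in> carrier H" and y: "y \<in> carrier ?C"
    note ab = brk_closed[OF a b] and yb = act_C_closed[OF b y] and ya = act_C_closed[OF a y]
      and dy = d_closed[OF y]
    note c1 = append_closed[OF a act_C_closed[OF b dy]] and c2 = append_closed[OF ab dy]
      and c3 = C.smult_closed[OF sg_closed act_C_closed[OF a yb]]
      and c4 = C.smult_closed[OF sg_closed act_C_closed[OF ab y]]
    have "d (Suc (Suc k)) (act_C (Suc (Suc k)) b (append_factor (Suc k) a y)) =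
        (append_factor k a (act_C k b (d (Suc k) y)) \<oplus>\<^bsub>?C\<^esub> ?s \<odot>\<^bsub>?C\<^esub> act_C (Suc k) a (act_C (Suc k) b y)) \<oplus>\<^bsub>?C\<^esub>
        (append_factor k (brk a b) (d (Suc k) y) \<oplus>\<^bsub>?C\<^esub> ?s \<odot>\<^bsub>?C\<^esub> act_C (Suc k) (brk a b) y)"
      unfolding act_C_append[OF b a y] hom_add[OF d_hom append_closed[OF a yb] append_closed[OF ab y]]
        d_append[OF a yb] d_append[OF ab y] Suc.IH[OF y] ..
    also have "\<dots> = (append_factor k a (act_C k b (d (Suc k) y)) \<oplus>\<^bsub>?C\<^esub> append_factor k (brk a b) (d (Suc k) y)) \<oplus>\<^bsub>?C\<^esub>
        (?s \<odot>\<^bsub>?C\<^esub> act_C (Suc k) a (act_C (Suc k) b y) \<oplus>\<^bsub>?C\<^esub> ?s \<odot>\<^bsub>?C\<^esub> act_C (Suc k) (brk a b) y)"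
      using c1 c2 c3 c4 by (simp only: C.M.a_ac C.M.a_closed)
    also have "\<dots> = act_C (Suc k) b (d (Suc (Suc k)) (append_factor (Suc k) a y))"
      unfolding d_append[OF a y] hom_add[OF act_C_hom[OF b] append_closed[OF a dy] C.smult_closed[OF sg_closed ya]]
        hom_smult[OF act_C_hom[OF b] sg_closed ya] act_C_commutator[OF a b y] act_C_append[OF b a dy]
        C.smult_r_distr[OF sg_closed act_C_closed[OF a yb] act_C_closed[OF ab y]] ..
    finally show "d (Suc (Suc k)) (act_C (Suc (Suc k)) b (append_factor (Suc k) a y)) =
        act_C (Suc k) b (d (Suc (Suc k)) (append_factor (Suc k) a y))" .
  qed
qed

text \<open>On \<open>y \<otimes> a\<close> the first term of \<open>d_append\<close> contributes \<open>(d d y) \<otimes> a\<close>, which vanishes by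
  induction, and a multiple of \<open>\<theta>\<^sub>a d y\<close>; the second contributes the same multiple of \<open>d \<theta>\<^sub>a y =
  \<theta>\<^sub>a d y\<close> with the opposite sign. In the lowest degree the term that needs induction is absent.\<close>

theorem d_d:
  assumes x: "x \<in> carrier (C (Suc (Suc k)))"
  shows "d (Suc k) (d (Suc (Suc k)) x) = \<zero>\<^bsub>C k\<^esub>"
  using x
proof (induction k arbitrary: x)
  case 0
  interpret C: module K "C 0" by (rule module_C)
  interpret C1: module K "C (Suc 0)" by (rule module_C)
  show ?case
  proof (rule C_Suc_eqI[OF mod_hom_comp[OF d_hom d_hom] mod_hom_zero[OF module_C module_C] 0])
    fix a y assume a: "a \<in> carrier H" and y: "y \<in> carrier (C (Suc 0))"
    note dy = d_closed[OF y] and ya = act_C_closed[OF a y]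
    note ady = act_C_closed[OF a dy]
    show "d (Suc 0) (d (Suc (Suc 0)) (append_factor (Suc 0) a y)) = \<zero>\<^bsub>C 0\<^esub>"
      unfolding d_append[OF a y] hom_add[OF d_hom append_closed[OF a dy] C1.smult_closed[OF sg_closed ya]]
        hom_smult[OF d_hom sg_closed ya] d_act_C[OF a y] d_append_0[OF a dy] sg_Suc[OF module_C ady]
      by (rule C.M.r_neg[OF C.smult_closed[OF sg_closed ady]])
  qed
next
  case (Suc k)
  interpret C: module K "C (Suc k)" by (rule module_C)
  interpret C1: module K "C (Suc (Suc k))" by (rule module_C)
  show ?case
  proof (rule C_Suc_eqI[OF mod_hom_comp[OF d_hom d_hom] mod_hom_zero[OF module_C module_C] Suc.prems])
    fix a y assume a: "a \<in> carrier H" and y: "y \<in> carrier (C (Suc (Suc k)))"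
    note dy = d_closed[OF y] and ya = act_C_closed[OF a y]
    note ady = act_C_closed[OF a dy]
    show "d (Suc (Suc k)) (d (Suc (Suc (Suc k))) (append_factor (Suc (Suc k)) a y)) = \<zero>\<^bsub>C (Suc k)\<^esub>"
      unfolding d_append[OF a y] hom_add[OF d_hom append_closed[OF a dy] C1.smult_closed[OF sg_closed ya]]
        hom_smult[OF d_hom sg_closed ya] d_act_C[OF a y] d_append[OF a dy] sg_Suc[where j = "Suc k", OF module_C ady]
        Suc.IH[OF y] hom_zero[OF append_hom[OF a]] C.M.l_zero[OF C.smult_closed[OF sg_closed ady]]
      by (rule C.M.r_neg[OF C.smult_closed[OF sg_closed ady]])
  qed
qed

end

section \<open>Surjections of representations\<close>

locale representation_surjection =
  A: leibniz_representation K V H act brk + B: leibniz_representation K V L act' brk'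
  for K and V and H and act and brk and L and act' and brk' +
  fixes q
  assumes q_hom: "mod_hom K H L q"
    and q_act: "\<And>v h. v \<in> carrier V \<Longrightarrow> h \<in> carrier H \<Longrightarrow> act' v (q h) = act v h"
    and q_brk: "\<And>a b. a \<in> carrier H \<Longrightarrow> b \<in> carrier H \<Longrightarrow> q (brk a b) = brk' (q a) (q b)"
    and q_surj: "q ` carrier H = carrier L"
begin

definition chain_map where
  "chain_map k = presented_lift K (mixed_tuples V H k) (B.C k) (\<lambda>(v, hs). B.t k (v, map q hs))"

lemma map_tuple: "hs \<in> tuples H k \<Longrightarrow> map q hs \<in> tuples L k"
  using hom_closed[OF q_hom] by (auto simp: tuples_def)

lemma chain_map_multilinear: "mixed_multilinear K V H k (B.C k) (\<lambda>(v, hs). B.t k (v, map q hs))"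
proof (rule mixed_multilinearI; unfold prod.case)
  show "B.t k (v, map q hs) \<in> carrier (B.C k)" if "v \<in> carrier V" "hs \<in> tuples H k" for v hs
    by (intro B.t_closed that map_tuple)
  show "mod_hom K V (B.C k) (\<lambda>v. B.t k (v, map q hs))" if "hs \<in> tuples H k" for hs
    by (intro B.t_left that map_tuple)
  show "mod_hom K H (B.C k) (\<lambda>h. B.t k (v, map q (hs[i := h])))"
    if "v \<in> carrier V" "hs \<in> tuples H k" "i < k" for v hs i
    unfolding map_update by (intro B.t_slot_comp q_hom that map_tuple)
qed

lemma chain_map_hom: "mod_hom K (A.C k) (B.C k) (chain_map k)"
  unfolding chain_map_def by (rule A.lift_C_hom[OF chain_map_multilinear B.module_C])

lemma chain_map_t: "v \<in> carrier V \<Longrightarrow> hs \<in> tuples H k \<Longrightarrow> chain_map k (A.t k (v, hs)) = B.t k (v, map q hs)"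
  unfolding chain_map_def using A.lift_C_t[OF chain_map_multilinear B.module_C] by simp

lemma chain_map_surj: "chain_map k ` carrier (A.C k) = carrier (B.C k)"
proof -
  interpret P: presentation K "mixed_tuples V L k" "mixed_relations K V L k"
    by (rule B.presentation_C)
  have hom: "mod_hom K (A.C k) P.P (chain_map k)"
    using chain_map_hom[of k] by (simp add: mixed_tensor_product_def[of K V L])
  have "P.cls x \<in> chain_map k ` carrier (A.C k)" if x: "x \<in> mixed_tuples V L k" for x
  proof -
    obtain v ls where vl: "x = (v, ls)" "v \<in> carrier V" "ls \<in> tuples L k"
      using x by (auto simp: mixed_tuples_def)
    let ?r = "inv_into (carrier H) q"
    have r: "?r l \<in> carrier H" "q (?r l) = l" if "l \<in> carrier L" for l
      using that q_surj inv_into_into[of l q "carrier H"] f_inv_into_f[of l q "carrier H"] by simp_all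
    have ls: "set ls \<subseteq> carrier L" "length ls = k" using vl(3) by (simp_all add: tuples_def)
    have "map q (map ?r ls) = ls"
      unfolding map_map comp_def by (rule map_idI) (use r(2) ls(1) in blast)
    moreover have hs: "map ?r ls \<in> tuples H k"
    proof -
      have "?r l \<in> carrier H" if "l \<in> set ls" for l using r(1) ls(1) that by blast
      then show ?thesis using ls(2) by (simp add: tuples_def image_subset_iff)
    qed
    ultimately have "P.cls x = chain_map k (A.t k (v, map ?r ls))"
      using chain_map_t[OF vl(2) hs] vl(1) by (simp add: mixed_tensor_def)
    then show ?thesis using A.t_closed[OF vl(2) hs] by simp
  qed
  from P.hom_surj[OF hom this] show ?thesis by (simp add: mixed_tensor_product_def)
qed

text \<open>In degree 0 there are no factors from \<open>H\<close> or \<open>L\<close>, and sending \<open>v\<close> back to \<open>v\<close> is a left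
  inverse.\<close>

lemma chain_map_0_injective:
  assumes x: "x \<in> carrier (A.C 0)" and "chain_map 0 x = \<zero>\<^bsub>B.C 0\<^esub>"
  shows "x = \<zero>\<^bsub>A.C 0\<^esub>"
proof -
  let ?r = "presented_lift K (mixed_tuples V L 0) (A.C 0) (\<lambda>(v, ls). A.t 0 (v, []))"
  have nil: "[] \<in> tuples H 0" by (simp add: tuples_def)
  have "mixed_multilinear K V L 0 (A.C 0) (\<lambda>(v, ls). A.t 0 (v, []))"
    by (rule mixed_multilinearI) (use A.t_closed[OF _ nil] A.t_left[OF nil] in simp_all)
  note r = B.lift_C_hom[OF this A.module_C] and rt = B.lift_C_t[OF this A.module_C]
  have "?r (chain_map 0 x) = x"
  proof (rule A.C_eqI[OF mod_hom_comp[OF chain_map_hom r] mod_hom_id[OF A.module_C] x])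
    fix v hs assume v: "v \<in> carrier V" and hs: "hs \<in> tuples H 0"
    then have "hs = []" by (simp add: tuples_def)
    then show "?r (chain_map 0 (A.t 0 (v, hs))) = A.t 0 (v, hs)"
      using chain_map_t[OF v hs] rt[OF v map_tuple[OF hs]] by simp
  qed
  then show ?thesis using hom_zero[OF r] assms(2) by simp
qed

lemma chain_map_d:
  assumes x: "x \<in> carrier (A.C (Suc k))"
  shows "chain_map k (A.d (Suc k) x) = B.d (Suc k) (chain_map (Suc k) x)"
proof (rule A.C_eqI[OF mod_hom_comp[OF A.d_hom chain_map_hom] mod_hom_comp[OF chain_map_hom B.d_hom] x])
  interpret B': module K "B.C k" by (rule B.module_C)
  interpret A': module K "A.C k" by (rule A.module_C)
  note p = chain_map_hom[of k]
  fix v hs assume v: "v \<in> carrier V" and hs: "hs \<in> tuples H (Suc k)"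
  have len: "length hs = Suc k" by (rule tuples_length[OF hs])
  note ls = map_tuple[OF hs]
  have A: "A.act_term k j (v, hs) \<in> carrier (A.C k)" if "j < Suc k" for j
    by (rule mixed_multilinearD(1)[OF A.act_term_multilinear[OF that] v hs])
  have B: "A.brk_term k j i (v, hs) \<in> carrier (A.C k)" if "j < Suc k" "i < j" for j i
    by (rule mixed_multilinearD(1)[OF A.brk_term_multilinear[OF that] v hs])
  have map_delete: "map q (delete_nth j xs) = delete_nth j (map q xs)" for j xs
    by (simp add: delete_nth_def take_map drop_map)
  have pA: "chain_map k (A.act_term k j (v, hs)) = B.act_term k j (v, map q hs)" if j: "j < Suc k" for j
    unfolding A.act_term_def B.act_term_def prod.case
    using tuples_nth[OF hs j] j len
    by (simp add: chain_map_t A.act_closed v delete_nth_tuple[OF hs j] map_delete q_act)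
  have pB: "chain_map k (A.brk_term k j i (v, hs)) = B.brk_term k j i (v, map q hs)"
    if j: "j < Suc k" and i: "i < j" for j i
  proof -
    have i': "i < Suc k" using i j by simp
    have up: "hs[i := brk (hs ! i) (hs ! j)] \<in> tuples H (Suc k)"
      by (intro tuples_update hs A.brk_closed tuples_nth[OF hs] i' j)
    show ?thesis
      unfolding A.brk_term_def B.brk_term_def prod.case
      using tuples_nth[OF hs j] tuples_nth[OF hs i'] i' j len
      by (simp add: chain_map_t v delete_nth_tuple[OF up j] map_delete map_update q_brk)
  qed
  let ?A = "\<lambda>j. A.sg j \<odot>\<^bsub>A.C k\<^esub> A.act_term k j (v, hs)"
  let ?B = "\<lambda>j i. A.sg j \<odot>\<^bsub>A.C k\<^esub> A.brk_term k j i (v, hs)"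
  have sA: "?A j \<in> carrier (A.C k)" if "j < Suc k" for j using A[OF that] A.sg_closed by simp
  have sB: "?B j i \<in> carrier (A.C k)" if "j < Suc k" "i < j" for j i using B[OF that] A.sg_closed by simp
  have BS: "(\<Oplus>\<^bsub>A.C k\<^esub>i\<in>{..<j}. ?B j i) \<in> carrier (A.C k)" if "j < Suc k" for j
    by (rule A'.M.finsum_closed) (use sB[OF that] in simp)
  have AS: "(\<Oplus>\<^bsub>A.C k\<^esub>j\<in>{..<Suc k}. ?A j) \<in> carrier (A.C k)"
    by (rule A'.M.finsum_closed) (use sA in simp)
  have BSS: "(\<Oplus>\<^bsub>A.C k\<^esub>j\<in>{..<Suc k}. \<Oplus>\<^bsub>A.C k\<^esub>i\<in>{..<j}. ?B j i) \<in> carrier (A.C k)"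
    by (rule A'.M.finsum_closed) (use BS in simp)
  have psA: "chain_map k (?A j) = B.sg j \<odot>\<^bsub>B.C k\<^esub> B.act_term k j (v, map q hs)" if "j < Suc k" for j
    using hom_smult[OF p A.sg_closed A[OF that]] pA[OF that] by (simp add: A.sg_def B.sg_def)
  have psB: "chain_map k (?B j i) = B.sg j \<odot>\<^bsub>B.C k\<^esub> B.brk_term k j i (v, map q hs)"
    if "j < Suc k" "i < j" for j i
    using hom_smult[OF p A.sg_closed B[OF that]] pB[OF that] by (simp add: A.sg_def B.sg_def)
  have sumA: "chain_map k (\<Oplus>\<^bsub>A.C k\<^esub>j\<in>{..<Suc k}. ?A j) =
      (\<Oplus>\<^bsub>B.C k\<^esub>j\<in>{..<Suc k}. B.sg j \<odot>\<^bsub>B.C k\<^esub> B.act_term k j (v, map q hs))"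
  proof -
    have "chain_map k (\<Oplus>\<^bsub>A.C k\<^esub>j\<in>{..<Suc k}. ?A j) = (\<Oplus>\<^bsub>B.C k\<^esub>j\<in>{..<Suc k}. chain_map k (?A j))"
      by (rule finsum_mod_hom[OF p]) (use sA in simp)
    also have "\<dots> = (\<Oplus>\<^bsub>B.C k\<^esub>j\<in>{..<Suc k}. B.sg j \<odot>\<^bsub>B.C k\<^esub> B.act_term k j (v, map q hs))"
    proof (rule B'.M.finsum_cong'[OF refl])
      show "(\<lambda>j. B.sg j \<odot>\<^bsub>B.C k\<^esub> B.act_term k j (v, map q hs)) \<in> {..<Suc k} \<rightarrow> carrier (B.C k)"
        using psA hom_closed[OF p sA] by simp
    qed (use psA in simp)
    finally show ?thesis .
  qed
  have sumBj: "chain_map k (\<Oplus>\<^bsub>A.C k\<^esub>i\<in>{..<j}. ?B j i) =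
      (\<Oplus>\<^bsub>B.C k\<^esub>i\<in>{..<j}. B.sg j \<odot>\<^bsub>B.C k\<^esub> B.brk_term k j i (v, map q hs))" if j: "j < Suc k" for j
  proof -
    have "chain_map k (\<Oplus>\<^bsub>A.C k\<^esub>i\<in>{..<j}. ?B j i) = (\<Oplus>\<^bsub>B.C k\<^esub>i\<in>{..<j}. chain_map k (?B j i))"
      by (rule finsum_mod_hom[OF p]) (use sB[OF j] in simp)
    also have "\<dots> = (\<Oplus>\<^bsub>B.C k\<^esub>i\<in>{..<j}. B.sg j \<odot>\<^bsub>B.C k\<^esub> B.brk_term k j i (v, map q hs))"
    proof (rule B'.M.finsum_cong'[OF refl])
      show "(\<lambda>i. B.sg j \<odot>\<^bsub>B.C k\<^esub> B.brk_term k j i (v, map q hs)) \<in> {..<j} \<rightarrow> carrier (B.C k)"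
        using psB[OF j] hom_closed[OF p sB[OF j]] by simp
    qed (use psB[OF j] in simp)
    finally show ?thesis .
  qed
  have sumB: "chain_map k (\<Oplus>\<^bsub>A.C k\<^esub>j\<in>{..<Suc k}. \<Oplus>\<^bsub>A.C k\<^esub>i\<in>{..<j}. ?B j i) =
      (\<Oplus>\<^bsub>B.C k\<^esub>j\<in>{..<Suc k}. \<Oplus>\<^bsub>B.C k\<^esub>i\<in>{..<j}. B.sg j \<odot>\<^bsub>B.C k\<^esub> B.brk_term k j i (v, map q hs))"
  proof -
    have "chain_map k (\<Oplus>\<^bsub>A.C k\<^esub>j\<in>{..<Suc k}. \<Oplus>\<^bsub>A.C k\<^esub>i\<in>{..<j}. ?B j i) =
        (\<Oplus>\<^bsub>B.C k\<^esub>j\<in>{..<Suc k}. chain_map k (\<Oplus>\<^bsub>A.C k\<^esub>i\<in>{..<j}. ?B j i))"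
      by (rule finsum_mod_hom[OF p]) (use BS in simp)
    also have "\<dots> = (\<Oplus>\<^bsub>B.C k\<^esub>j\<in>{..<Suc k}. \<Oplus>\<^bsub>B.C k\<^esub>i\<in>{..<j}. B.sg j \<odot>\<^bsub>B.C k\<^esub> B.brk_term k j i (v, map q hs))"
    proof (rule B'.M.finsum_cong'[OF refl])
      show "(\<lambda>j. \<Oplus>\<^bsub>B.C k\<^esub>i\<in>{..<j}. B.sg j \<odot>\<^bsub>B.C k\<^esub> B.brk_term k j i (v, map q hs)) \<in> {..<Suc k} \<rightarrow> carrier (B.C k)"
        using sumBj hom_closed[OF p BS] by simp
    qed (use sumBj in simp)
    finally show ?thesis .
  qed
  show "chain_map k (A.d (Suc k) (A.t (Suc k) (v, hs))) = B.d (Suc k) (chain_map (Suc k) (A.t (Suc k) (v, hs)))"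
    unfolding A.d_t[OF v hs] chain_map_t[OF v hs] B.d_t[OF v ls] A.loday_sum_def B.loday_sum_def
      hom_add[OF p AS BSS] sumA sumB ..
qed

end

section \<open>Homology and the long exact sequence\<close>

text \<open>Homology is a quotient of the cycles, whose module structure is that of the chain module
  with a smaller carrier. Cosets do not see the change of carrier.\<close>

lemma a_r_coset_carrier_update: "a_r_coset (M\<lparr>carrier := Z\<rparr>) = a_r_coset M"
  by (intro ext) (simp add: a_r_coset_def')

locale module_complex =
  fixes K and C :: "nat \<Rightarrow> ('k, 'c) module" and d :: "nat \<Rightarrow> 'c \<Rightarrow> 'c"
  assumes module_C: "module K (C k)"
    and d_hom: "mod_hom K (C (Suc k)) (C k) (d (Suc k))"
    and d_d: "x \<in> carrier (C (Suc (Suc k))) \<Longrightarrow> d (Suc k) (d (Suc (Suc k)) x) = \<zero>\<^bsub>C k\<^esub>"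
begin

abbreviation Z where "Z k \<equiv> (C k)\<lparr>carrier := cycles C d k\<rparr>"
abbreviation HH where "HH k \<equiv> homology K C d k"
abbreviation cls where "cls k z \<equiv> boundaries C d k +>\<^bsub>C k\<^esub> z"

lemma cycles_0: "cycles C d 0 = carrier (C 0)"
  by (simp add: cycles_def)

lemma cycles_Suc: "cycles C d (Suc k) = {x \<in> carrier (C (Suc k)). d (Suc k) x = \<zero>\<^bsub>C k\<^esub>}"
  by (simp add: cycles_def a_kernel_eq)

lemma submodule_cycles: "submodule K (cycles C d k) (C k)"
proof (cases k)
  case 0
  then show ?thesis
    using submodule_image[OF mod_hom_id[OF module_C]] by (simp add: cycles_0)
next
  case (Suc j)
  then show ?thesis
    using submodule_kernel[OF d_hom[of j]] by (simp add: cycles_def)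
qed

lemma cycles_closed: "z \<in> cycles C d k \<Longrightarrow> z \<in> carrier (C k)"
  using submodule.subset[OF submodule_cycles] by blast

lemma boundaries_cycles: "boundaries C d k \<subseteq> cycles C d k"
proof (cases k)
  case 0
  then show ?thesis using hom_closed[OF d_hom[of 0]] by (auto simp: boundaries_def cycles_0)
next
  case (Suc j)
  then show ?thesis using hom_closed[OF d_hom[of "Suc j"]] d_d by (auto simp: boundaries_def cycles_Suc)
qed

lemma quotient: "module_quotient K (Z k) (boundaries C d k)"
proof (rule module_quotient.intro, rule submodule_of_md[OF _ submodule_cycles boundaries_cycles])
  show "submodule K (boundaries C d k) (C k)"
    unfolding boundaries_def by (rule submodule_image[OF d_hom])
qed

lemma module_H: "module K (HH k)"
  unfolding homology_def by (rule module_quotient.module_Q[OF quotient])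

lemma cls_hom: "mod_hom K (Z k) (HH k) (cls k)"
  using module_quotient.coset_hom[OF quotient] by (simp add: homology_def a_r_coset_carrier_update)

lemma carrier_H: "carrier (HH k) = cls k ` cycles C d k"
  using module_quotient.carrier_Q[OF quotient] by (simp add: homology_def a_r_coset_carrier_update)

lemma cls_closed: "z \<in> cycles C d k \<Longrightarrow> cls k z \<in> carrier (HH k)"
  by (simp add: carrier_H)

lemma cls_zero_iff:
  assumes "z \<in> cycles C d k"
  shows "cls k z = \<zero>\<^bsub>HH k\<^esub> \<longleftrightarrow> z \<in> boundaries C d k"
  using module_quotient.coset_zero_iff[OF quotient, of z k] module_quotient.zero_Q[OF quotient] assms
  by (simp add: homology_def a_r_coset_carrier_update)

lemma cls_eq_iff:
  assumes "z \<in> cycles C d k" "w \<in> cycles C d k"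
  shows "cls k z = cls k w \<longleftrightarrow> z \<ominus>\<^bsub>C k\<^esub> w \<in> boundaries C d k"
proof -
  interpret Ck: module K "C k" by (rule module_C)
  interpret Zk: module K "Z k" by (rule submodule_md[OF submodule_cycles])
  have "z \<ominus>\<^bsub>Z k\<^esub> w = z \<ominus>\<^bsub>C k\<^esub> w"
  proof -
    have "(z \<ominus>\<^bsub>Z k\<^esub> w) \<oplus>\<^bsub>C k\<^esub> w = z" "z \<ominus>\<^bsub>Z k\<^esub> w \<in> cycles C d k"
      using assms Zk.M.minus_closed[of z w] Zk.M.a_assoc[of z "\<ominus>\<^bsub>Z k\<^esub> w" w] Zk.M.l_neg[of w] Zk.M.r_zero[of z] Zk.M.a_inv_closed[of w]
      by (simp_all add: a_minus_def)
    then show ?thesis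
      using cycles_closed[OF assms(1)] cycles_closed[OF assms(2)] cycles_closed[of "z \<ominus>\<^bsub>Z k\<^esub> w" k]
        Ck.M.a_assoc[of "z \<ominus>\<^bsub>Z k\<^esub> w" w "\<ominus>\<^bsub>C k\<^esub> w"] Ck.M.r_neg[of w]
      by (simp add: a_minus_def[of "C k"])
  qed
  then show ?thesis
    using module_quotient.coset_eq_iff[OF quotient, of z k w] assms
    by (simp add: a_r_coset_carrier_update)
qed

lemma
  assumes f: "mod_hom K (Z k) N f" and "\<And>z. z \<in> boundaries C d k \<Longrightarrow> f z = \<zero>\<^bsub>N\<^esub>"
  shows induced_cls: "z \<in> cycles C d k \<Longrightarrow> the_elem (f ` cls k z) = f z"
    and induced_map_hom: "mod_hom K (HH k) N (\<lambda>A. the_elem (f ` A))"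
  using module_quotient.factor_map_coset[OF quotient f] module_quotient.factor_map_hom[OF quotient f] assms(2)
  by (simp_all add: homology_def a_r_coset_carrier_update)

end

text \<open>Injectivity of \<open>p\<close> in degree 0 is what makes the kernel, shifted down by one, the full
  kernel complex.\<close>

locale surjective_chain_map =
  A: module_complex K A dA + B: module_complex K B dB
  for K and A :: "nat \<Rightarrow> ('k, 'a) module" and dA and B :: "nat \<Rightarrow> ('k, 'b) module" and dB +
  fixes p :: "nat \<Rightarrow> 'a \<Rightarrow> 'b"
  assumes p_hom: "mod_hom K (A k) (B k) (p k)"
    and p_d: "x \<in> carrier (A (Suc k)) \<Longrightarrow> p k (dA (Suc k) x) = dB (Suc k) (p (Suc k) x)"
    and p_surj: "p k ` carrier (A k) = carrier (B k)"
    and p_0: "x \<in> carrier (A 0) \<Longrightarrow> p 0 x = \<zero>\<^bsub>B 0\<^esub> \<Longrightarrow> x = \<zero>\<^bsub>A 0\<^esub>"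
begin

definition rel where
  "rel k = (A (Suc k))\<lparr>carrier := a_kernel (A (Suc k)) (B (Suc k)) (p (Suc k))\<rparr>"

abbreviation rel_d where "rel_d k \<equiv> dA (Suc k)"

lemma carrier_rel: "carrier (rel k) = {x \<in> carrier (A (Suc k)). p (Suc k) x = \<zero>\<^bsub>B (Suc k)\<^esub>}"
  by (simp add: rel_def a_kernel_eq)

lemma rel_closed: "x \<in> carrier (rel k) \<Longrightarrow> x \<in> carrier (A (Suc k))"
  by (simp add: carrier_rel)

lemma rel_ops [simp]:
  "\<zero>\<^bsub>rel k\<^esub> = \<zero>\<^bsub>A (Suc k)\<^esub>" "x \<oplus>\<^bsub>rel k\<^esub> y = x \<oplus>\<^bsub>A (Suc k)\<^esub> y" "a \<odot>\<^bsub>rel k\<^esub> x = a \<odot>\<^bsub>A (Suc k)\<^esub> x"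
  by (simp_all add: rel_def)

lemma submodule_rel: "submodule K (carrier (rel k)) (A (Suc k))"
  using submodule_kernel[OF p_hom] by (simp add: rel_def)

lemma module_rel: "module K (rel k)"
  unfolding rel_def by (rule submodule_md[OF submodule_kernel[OF p_hom]])

lemma d_rel:
  assumes "x \<in> carrier (A (Suc (Suc k)))" "dB (Suc (Suc k)) (p (Suc (Suc k)) x) = \<zero>\<^bsub>B (Suc k)\<^esub>"
  shows "dA (Suc (Suc k)) x \<in> carrier (rel k)"
  using assms hom_closed[OF A.d_hom] p_d by (simp add: carrier_rel)

sublocale R: module_complex K rel rel_d
proof (rule module_complex.intro)
  fix k
  show "module K (rel k)" by (rule module_rel)
  have "mod_hom K (rel (Suc k)) (A (Suc k)) (rel_d (Suc k))"
    using mod_hom_md_dom[OF A.d_hom submodule_kernel[OF p_hom]] by (simp add: rel_def)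
  moreover have "rel_d (Suc k) x \<in> a_kernel (A (Suc k)) (B (Suc k)) (p (Suc k))"
    if "x \<in> carrier (rel (Suc k))" for x
    using d_rel[of x k] that hom_zero[OF B.d_hom] by (simp add: carrier_rel a_kernel_eq)
  ultimately show "mod_hom K (rel (Suc k)) (rel k) (rel_d (Suc k))"
    unfolding rel_def[of k] by (rule mod_hom_md_cod[OF _ submodule_kernel[OF p_hom]])
  show "rel_d (Suc k) (rel_d (Suc (Suc k)) x) = \<zero>\<^bsub>rel k\<^esub>" if "x \<in> carrier (rel (Suc (Suc k)))" for x
    using A.d_d[OF rel_closed[OF that]] by simp
qed

text \<open>Cycles of the shifted complex in degree 0 are all of its elements. They are cycles of \<open>A\<close> as
  well, because the projection is injective in degree 0.\<close>

lemma rel_0_cycle: "x \<in> carrier (rel 0) \<Longrightarrow> dA (Suc 0) x = \<zero>\<^bsub>A 0\<^esub>"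
  using p_d[of x 0] hom_zero[OF B.d_hom[of 0]] hom_closed[OF A.d_hom[of 0], of x]
  by (intro p_0) (simp_all add: carrier_rel)

lemma rel_cycles: "cycles rel rel_d k = carrier (rel k) \<inter> cycles A dA (Suc k)"
proof (cases k)
  case 0
  then show ?thesis using rel_0_cycle rel_closed by (auto simp: R.cycles_0 A.cycles_Suc)
next
  case (Suc j)
  then show ?thesis using rel_closed by (auto simp: R.cycles_Suc A.cycles_Suc)
qed

lemma rel_boundaries: "boundaries rel rel_d k \<subseteq> boundaries A dA (Suc k)"
  using rel_closed by (auto simp: boundaries_def)

lemma rel_minus:
  assumes "x \<in> carrier (rel k)" "y \<in> carrier (rel k)"
  shows "x \<ominus>\<^bsub>rel k\<^esub> y = x \<ominus>\<^bsub>A (Suc k)\<^esub> y"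
proof -
  have "mod_hom K (rel k) (A (Suc k)) (\<lambda>x. x)"
    using mod_hom_md_dom[OF mod_hom_id[OF A.module_C] submodule_kernel[OF p_hom]] by (simp add: rel_def)
  from hom_minus[OF this assms] show ?thesis .
qed

definition inclusion where
  "inclusion k Y = the_elem ((\<lambda>z. A.cls (Suc k) z) ` Y)"

lemma
  shows inclusion_hom: "mod_hom K (R.HH k) (A.HH (Suc k)) (inclusion k)"
    and inclusion_cls: "z \<in> cycles rel rel_d k \<Longrightarrow> inclusion k (R.cls k z) = A.cls (Suc k) z"
proof -
  have sub: "submodule K (cycles rel rel_d k) (A.Z (Suc k))"
  proof (rule submodule_of_md[OF _ A.submodule_cycles])
    show "cycles rel rel_d k \<subseteq> cycles A dA (Suc k)" by (simp add: rel_cycles)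
    interpret a: submodule K "carrier (rel k)" "A (Suc k)" by (rule submodule_rel)
    interpret b: submodule K "cycles A dA (Suc k)" "A (Suc k)" by (rule A.submodule_cycles)
    show "submodule K (cycles rel rel_d k) (A (Suc k))"
      unfolding rel_cycles using a.subset
      by (intro submodule.intro a.module) (auto simp: a.m_closed b.m_closed)
  qed
  have f: "mod_hom K (R.Z k) (A.HH (Suc k)) (\<lambda>z. A.cls (Suc k) z)"
    using mod_hom_md_dom[OF A.cls_hom sub] by (simp add: rel_def)
  have zero: "A.cls (Suc k) z = \<zero>\<^bsub>A.HH (Suc k)\<^esub>" if "z \<in> boundaries rel rel_d k" for z
    using that rel_boundaries A.boundaries_cycles by (subst A.cls_zero_iff) auto
  show "mod_hom K (R.HH k) (A.HH (Suc k)) (inclusion k)"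
    unfolding inclusion_def[abs_def] by (rule R.induced_map_hom[OF f zero])
  show "z \<in> cycles rel rel_d k \<Longrightarrow> inclusion k (R.cls k z) = A.cls (Suc k) z"
    unfolding inclusion_def by (rule R.induced_cls[OF f zero])
qed

lemma p_cycles: "z \<in> cycles A dA k \<Longrightarrow> p k z \<in> cycles B dB k"
proof (cases k)
  case 0
  then show "z \<in> cycles A dA k \<Longrightarrow> ?thesis" using hom_closed[OF p_hom] by (simp add: A.cycles_0 B.cycles_0)
next
  case (Suc j)
  then show "z \<in> cycles A dA k \<Longrightarrow> ?thesis"
    using hom_closed[OF p_hom] p_d[of z j] hom_zero[OF p_hom] by (simp add: A.cycles_Suc B.cycles_Suc)
qed

lemma p_boundaries: "z \<in> boundaries A dA k \<Longrightarrow> p k z \<in> boundaries B dB k"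
  using p_d hom_closed[OF p_hom] by (auto simp: boundaries_def)

abbreviation projection where "projection \<equiv> homology_map B dB p"

lemma
  shows projection_hom: "mod_hom K (A.HH k) (B.HH k) (projection k)"
    and projection_cls: "z \<in> cycles A dA k \<Longrightarrow> projection k (A.cls k z) = B.cls k (p k z)"
proof -
  have f: "mod_hom K (A.Z k) (B.HH k) (\<lambda>z. B.cls k (p k z))"
  proof (rule mod_hom_comp[OF _ B.cls_hom])
    show "mod_hom K (A.Z k) (B.Z k) (p k)"
      by (rule mod_hom_md_cod[OF mod_hom_md_dom[OF p_hom A.submodule_cycles] B.submodule_cycles])
        (simp add: p_cycles)
  qed
  have zero: "B.cls k (p k z) = \<zero>\<^bsub>B.HH k\<^esub>" if "z \<in> boundaries A dA k" for z
    using that p_boundaries B.boundaries_cycles by (subst B.cls_zero_iff) auto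
  show "mod_hom K (A.HH k) (B.HH k) (projection k)"
    unfolding homology_map_def[abs_def] by (rule A.induced_map_hom[OF f zero])
  show "z \<in> cycles A dA k \<Longrightarrow> projection k (A.cls k z) = B.cls k (p k z)"
    unfolding homology_map_def by (rule A.induced_cls[OF f zero])
qed

lemma preimage: "b \<in> carrier (B k) \<Longrightarrow> \<exists>a. a \<in> carrier (A k) \<and> b = p k a"
  unfolding p_surj[symmetric] by blast

definition lift where
  "lift k b = (SOME a. a \<in> carrier (A k) \<and> p k a = b)"

lemma lift:
  assumes "b \<in> carrier (B k)"
  shows "lift k b \<in> carrier (A k)" "p k (lift k b) = b"
proof -
  have "\<exists>a. a \<in> carrier (A k) \<and> p k a = b" using preimage[OF assms] by blast
  from someI_ex[OF this] show "lift k b \<in> carrier (A k)" "p k (lift k b) = b" unfolding lift_def by auto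
qed

definition connecting where
  "connecting k Y = the_elem ((\<lambda>b. R.cls k (dA (Suc (Suc k)) (lift (Suc (Suc k)) b))) ` Y)"

lemma d_lift_cycle:
  assumes "a \<in> carrier (A (Suc (Suc k)))" "p (Suc (Suc k)) a \<in> cycles B dB (Suc (Suc k))"
  shows "dA (Suc (Suc k)) a \<in> cycles rel rel_d k"
  using d_rel[OF assms(1)] assms hom_closed[OF A.d_hom] A.d_d
  by (simp add: rel_cycles B.cycles_Suc A.cycles_Suc)

text \<open>Two lifts of the same cycle differ by an element of the relative complex, so their
  boundaries differ by a relative boundary.\<close>

lemma d_lift_independent:
  assumes a: "a \<in> carrier (A (Suc (Suc k)))" and b: "p (Suc (Suc k)) a \<in> cycles B dB (Suc (Suc k))"
    and a': "a' \<in> carrier (A (Suc (Suc k)))" and eq: "p (Suc (Suc k)) a' = p (Suc (Suc k)) a"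
  shows "R.cls k (dA (Suc (Suc k)) a) = R.cls k (dA (Suc (Suc k)) a')"
proof -
  let ?m = "Suc (Suc k)"
  interpret A': module K "A ?m" by (rule A.module_C)
  interpret B': module K "B ?m" by (rule B.module_C)
  have z: "dA ?m a \<in> cycles rel rel_d k" and z': "dA ?m a' \<in> cycles rel rel_d k"
    using d_lift_cycle a b a' eq by simp_all
  have "dA ?m a \<ominus>\<^bsub>rel k\<^esub> dA ?m a' = dA ?m (a \<ominus>\<^bsub>A ?m\<^esub> a')"
    using rel_minus[of "dA ?m a" k "dA ?m a'"] z z' hom_minus[OF A.d_hom a a']
    by (simp add: rel_cycles)
  moreover have "a \<ominus>\<^bsub>A ?m\<^esub> a' \<in> carrier (rel (Suc k))"
    using a a' hom_minus[OF p_hom a a'] eq hom_closed[OF p_hom a]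
    by (simp add: carrier_rel a_minus_def[of "B ?m"] B'.M.r_neg)
  ultimately show ?thesis
    unfolding R.cls_eq_iff[OF z z'] by (simp add: boundaries_def)
qed

lemma
  shows connecting_hom: "mod_hom K (B.HH (Suc (Suc k))) (R.HH k) (connecting k)"
    and connecting_cls: "a \<in> carrier (A (Suc (Suc k))) \<Longrightarrow> p (Suc (Suc k)) a \<in> cycles B dB (Suc (Suc k)) \<Longrightarrow>
      connecting k (B.cls (Suc (Suc k)) (p (Suc (Suc k)) a)) = R.cls k (dA (Suc (Suc k)) a)"
proof -
  let ?m = "Suc (Suc k)"
  let ?f = "\<lambda>b. R.cls k (dA ?m (lift ?m b))"
  interpret A': module K "A ?m" by (rule A.module_C)
  interpret BZ: module K "B.Z ?m" by (rule submodule_md[OF B.submodule_cycles])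
  have l: "lift ?m b \<in> carrier (A ?m)" "p ?m (lift ?m b) = b" if "b \<in> cycles B dB ?m" for b
    using lift B.cycles_closed[OF that] by simp_all
  have fa: "?f (p ?m a) = R.cls k (dA ?m a)" if "a \<in> carrier (A ?m)" "p ?m a \<in> cycles B dB ?m" for a
    using l[OF that(2)] that by (intro d_lift_independent) simp_all
  have cyc: "dA ?m (lift ?m b) \<in> cycles rel rel_d k" if "b \<in> cycles B dB ?m" for b
    using l[OF that] that by (intro d_lift_cycle) simp_all
  have f: "mod_hom K (B.Z ?m) (R.HH k) ?f"
  proof (rule mod_homI)
    show "module K (B.Z ?m)" by (rule submodule_md[OF B.submodule_cycles])
    show "module K (R.HH k)" by (rule R.module_H)
    show "?f b \<in> carrier (R.HH k)" if "b \<in> carrier (B.Z ?m)" for b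
      using R.cls_closed[OF cyc] that by simp
  next
    fix b c assume "b \<in> carrier (B.Z ?m)" "c \<in> carrier (B.Z ?m)"
    then have b: "b \<in> cycles B dB ?m" and c: "c \<in> cycles B dB ?m" and bc: "b \<oplus>\<^bsub>B ?m\<^esub> c \<in> cycles B dB ?m"
      using BZ.M.a_closed[of b c] by simp_all
    let ?a = "lift ?m b \<oplus>\<^bsub>A ?m\<^esub> lift ?m c"
    have "p ?m ?a = b \<oplus>\<^bsub>B ?m\<^esub> c" using hom_add[OF p_hom] l b c by simp
    then have "?f (b \<oplus>\<^bsub>B ?m\<^esub> c) = R.cls k (dA ?m ?a)"
      using fa[of ?a] bc l b c by simp
    also have "\<dots> = R.cls k (dA ?m (lift ?m b) \<oplus>\<^bsub>rel k\<^esub> dA ?m (lift ?m c))"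
      using hom_add[OF A.d_hom] l b c by simp
    also have "\<dots> = ?f b \<oplus>\<^bsub>R.HH k\<^esub> ?f c"
      using hom_add[OF R.cls_hom[of k], of "dA ?m (lift ?m b)" "dA ?m (lift ?m c)"] cyc b c by simp
    finally show "?f (b \<oplus>\<^bsub>B.Z ?m\<^esub> c) = ?f b \<oplus>\<^bsub>R.HH k\<^esub> ?f c" by simp
  next
    fix s b assume s: "s \<in> carrier K" and "b \<in> carrier (B.Z ?m)"
    then have b: "b \<in> cycles B dB ?m" and sb: "s \<odot>\<^bsub>B ?m\<^esub> b \<in> cycles B dB ?m"
      using BZ.smult_closed[of s b] by simp_all
    let ?a = "s \<odot>\<^bsub>A ?m\<^esub> lift ?m b"
    have "p ?m ?a = s \<odot>\<^bsub>B ?m\<^esub> b" using hom_smult[OF p_hom s] l b by simp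
    then have "?f (s \<odot>\<^bsub>B ?m\<^esub> b) = R.cls k (dA ?m ?a)"
      using fa[of ?a] sb l b s by simp
    also have "\<dots> = R.cls k (s \<odot>\<^bsub>rel k\<^esub> dA ?m (lift ?m b))"
      using hom_smult[OF A.d_hom s] l b by simp
    also have "\<dots> = s \<odot>\<^bsub>R.HH k\<^esub> ?f b"
      using hom_smult[OF R.cls_hom[of k] s, of "dA ?m (lift ?m b)"] cyc b by simp
    finally show "?f (s \<odot>\<^bsub>B.Z ?m\<^esub> b) = s \<odot>\<^bsub>R.HH k\<^esub> ?f b" by simp
  qed
  have zero: "?f b = \<zero>\<^bsub>R.HH k\<^esub>" if bd: "b \<in> boundaries B dB ?m" for b
  proof -
    obtain c where c: "c \<in> carrier (B (Suc ?m))" "b = dB (Suc ?m) c" using bd by (auto simp: boundaries_def)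
    obtain e where e: "e \<in> carrier (A (Suc ?m))" "c = p (Suc ?m) e" using preimage[OF c(1)] by blast
    have de: "dA (Suc ?m) e \<in> carrier (A ?m)" by (rule hom_closed[OF A.d_hom e(1)])
    have b: "b = p ?m (dA (Suc ?m) e)" using c e p_d by simp
    have "?f b = R.cls k (dA ?m (dA (Suc ?m) e))"
      using fa[OF de] b bd B.boundaries_cycles by auto
    also have "\<dots> = R.cls k \<zero>\<^bsub>rel k\<^esub>" using A.d_d[OF e(1)] by simp
    also have "\<dots> = \<zero>\<^bsub>R.HH k\<^esub>" using hom_zero[OF R.cls_hom[of k]] by simp
    finally show ?thesis .
  qed
  show "mod_hom K (B.HH ?m) (R.HH k) (connecting k)"
    unfolding connecting_def[abs_def] by (rule B.induced_map_hom[OF f zero])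
  show "connecting k (B.cls ?m (p ?m a)) = R.cls k (dA ?m a)"
    if "a \<in> carrier (A ?m)" "p ?m a \<in> cycles B dB ?m"
    unfolding connecting_def using B.induced_cls[OF f zero that(2)] fa[OF that] by simp
qed

text \<open>If a cycle \<open>z\<close> of \<open>A\<close> projects to the boundary of \<open>p a\<close>, then \<open>z - d a\<close> is a relative cycle
  in the same class.\<close>

lemma exact_at_total:
  "exact_at (R.HH k) (inclusion k) (A.HH (Suc k)) (projection (Suc k)) (B.HH (Suc k))"
  unfolding exact_at_def a_kernel_eq
proof (rule equalityI; rule subsetI)
  fix Y assume "Y \<in> inclusion k ` carrier (R.HH k)"
  then obtain z where z: "z \<in> cycles rel rel_d k" "Y = A.cls (Suc k) z"
    by (auto simp: R.carrier_H inclusion_cls)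
  then have zA: "z \<in> cycles A dA (Suc k)" "p (Suc k) z = \<zero>\<^bsub>B (Suc k)\<^esub>"
    by (simp_all add: rel_cycles carrier_rel)
  have "projection (Suc k) Y = \<zero>\<^bsub>B.HH (Suc k)\<^esub>"
    using z(2) projection_cls[OF zA(1)] zA(2) hom_zero[OF B.cls_hom[of "Suc k"]] by simp
  then show "Y \<in> {Y \<in> carrier (A.HH (Suc k)). projection (Suc k) Y = \<zero>\<^bsub>B.HH (Suc k)\<^esub>}"
    using z(2) A.cls_closed[OF zA(1)] by simp
next
  let ?m = "Suc k"
  interpret A': module K "A ?m" by (rule A.module_C)
  interpret B': module K "B ?m" by (rule B.module_C)
  fix Y assume "Y \<in> {Y \<in> carrier (A.HH ?m). projection ?m Y = \<zero>\<^bsub>B.HH ?m\<^esub>}"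
  then obtain z where z: "z \<in> cycles A dA ?m" "Y = A.cls ?m z" and "projection ?m Y = \<zero>\<^bsub>B.HH ?m\<^esub>"
    by (auto simp: A.carrier_H)
  then have "p ?m z \<in> boundaries B dB ?m"
    using projection_cls[OF z(1)] B.cls_zero_iff[OF p_cycles[OF z(1)]] by simp
  then obtain b where b: "b \<in> carrier (B (Suc ?m))" "p ?m z = dB (Suc ?m) b" by (auto simp: boundaries_def)
  obtain a where a: "a \<in> carrier (A (Suc ?m))" "b = p (Suc ?m) a" using preimage[OF b(1)] by blast
  let ?da = "dA (Suc ?m) a" and ?w = "z \<ominus>\<^bsub>A ?m\<^esub> dA (Suc ?m) a"
  have zc: "z \<in> carrier (A ?m)" by (rule A.cycles_closed[OF z(1)])
  have da: "?da \<in> carrier (A ?m)" by (rule hom_closed[OF A.d_hom a(1)])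
  have dab: "?da \<in> boundaries A dA ?m" using a(1) by (simp add: boundaries_def)
  have wc: "?w \<in> carrier (A ?m)" using zc da by simp
  have "p ?m ?w = \<zero>\<^bsub>B ?m\<^esub>"
    using hom_minus[OF p_hom zc da] b a p_d[OF a(1)] hom_closed[OF p_hom da]
    by (simp add: a_minus_def[of "B ?m"] B'.M.r_neg)
  then have wr: "?w \<in> carrier (rel k)" using wc by (simp add: carrier_rel)
  have "dA ?m ?w = \<zero>\<^bsub>A k\<^esub>"
  proof -
    interpret A'': module K "A k" by (rule A.module_C)
    show ?thesis
      using hom_minus[OF A.d_hom zc da] z(1) A.d_d[OF a(1)]
      by (simp add: A.cycles_Suc a_minus_def[of "A k"] A''.M.r_neg)
  qed
  then have wz: "?w \<in> cycles A dA ?m" using wc by (simp add: A.cycles_Suc)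
  have "z \<ominus>\<^bsub>A ?m\<^esub> ?w = ?da"
    using zc da by (simp add: a_minus_def A'.M.minus_add A'.M.r_neg1 A'.M.r_neg2)
  then have "A.cls ?m z = A.cls ?m ?w" using A.cls_eq_iff[OF z(1) wz] dab by simp
  moreover have wR: "?w \<in> cycles rel rel_d k" using wr wz by (simp add: rel_cycles)
  ultimately have "Y = inclusion k (R.cls k ?w)" using inclusion_cls[OF wR] z(2) by simp
  then show "Y \<in> inclusion k ` carrier (R.HH k)" using R.cls_closed[OF wR] by simp
qed

text \<open>If \<open>d a = d r\<close> with \<open>r\<close> relative, then \<open>a - r\<close> is a cycle of \<open>A\<close> over the same cycle of \<open>B\<close>.\<close>

lemma exact_at_target:
  "exact_at (A.HH (Suc (Suc k))) (projection (Suc (Suc k))) (B.HH (Suc (Suc k))) (connecting k) (R.HH k)"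
  unfolding exact_at_def a_kernel_eq
proof (rule equalityI; rule subsetI)
  let ?m = "Suc (Suc k)"
  fix Y assume "Y \<in> projection ?m ` carrier (A.HH ?m)"
  then obtain z where z: "z \<in> cycles A dA ?m" "Y = B.cls ?m (p ?m z)"
    by (auto simp: A.carrier_H projection_cls)
  have "connecting k Y = R.cls k (dA ?m z)"
    using connecting_cls[OF A.cycles_closed[OF z(1)] p_cycles[OF z(1)]] z(2) by simp
  also have "dA ?m z = \<zero>\<^bsub>rel k\<^esub>" using z(1) by (simp add: A.cycles_Suc)
  also have "R.cls k \<zero>\<^bsub>rel k\<^esub> = \<zero>\<^bsub>R.HH k\<^esub>" using hom_zero[OF R.cls_hom[of k]] by simp
  finally show "Y \<in> {Y \<in> carrier (B.HH ?m). connecting k Y = \<zero>\<^bsub>R.HH k\<^esub>}"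
    using z(2) B.cls_closed[OF p_cycles[OF z(1)]] by simp
next
  let ?m = "Suc (Suc k)"
  interpret A': module K "A ?m" by (rule A.module_C)
  interpret B': module K "B ?m" by (rule B.module_C)
  fix Y assume "Y \<in> {Y \<in> carrier (B.HH ?m). connecting k Y = \<zero>\<^bsub>R.HH k\<^esub>}"
  then obtain b where b: "b \<in> cycles B dB ?m" "Y = B.cls ?m b" and 0: "connecting k Y = \<zero>\<^bsub>R.HH k\<^esub>"
    by (auto simp: B.carrier_H)
  obtain a where a: "a \<in> carrier (A ?m)" "b = p ?m a" using preimage[OF B.cycles_closed[OF b(1)]] by blast
  have "R.cls k (dA ?m a) = \<zero>\<^bsub>R.HH k\<^esub>" using connecting_cls[OF a(1)] 0 a b by simp
  then have "dA ?m a \<in> boundaries rel rel_d k"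
    using R.cls_zero_iff d_lift_cycle[OF a(1)] a(2) b(1) by simp
  then obtain r where r: "r \<in> carrier (rel (Suc k))" "dA ?m a = dA ?m r" by (auto simp: boundaries_def)
  note rA = rel_closed[OF r(1)]
  let ?z = "a \<ominus>\<^bsub>A ?m\<^esub> r"
  have zc: "?z \<in> carrier (A ?m)" using a rA by simp
  have "dA ?m ?z = \<zero>\<^bsub>A (Suc k)\<^esub>"
  proof -
    interpret A'': module K "A (Suc k)" by (rule A.module_C)
    show ?thesis
      using hom_minus[OF A.d_hom a(1) rA] r(2) hom_closed[OF A.d_hom rA]
      by (simp add: a_minus_def[of "A (Suc k)"] A''.M.r_neg)
  qed
  then have z: "?z \<in> cycles A dA ?m" using zc by (simp add: A.cycles_Suc)
  have "p ?m ?z = b"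
    using hom_minus[OF p_hom a(1) rA] r(1) a(2) hom_closed[OF p_hom a(1)]
      B'.M.add.inv_one
    by (simp add: carrier_rel a_minus_def[of "B ?m"] a_inv_def[of "B ?m"])
  then have "Y = projection ?m (A.cls ?m ?z)" using projection_cls[OF z] b(2) by simp
  then show "Y \<in> projection ?m ` carrier (A.HH ?m)" using A.cls_closed[OF z] by simp
qed

text \<open>If a relative cycle is the boundary \<open>d a\<close> of an element of \<open>A\<close>, then \<open>p a\<close> is a cycle of
  \<open>B\<close>, and its connecting image is the class of \<open>d a\<close>.\<close>

lemma exact_at_relative:
  "exact_at (B.HH (Suc (Suc k))) (connecting k) (R.HH k) (inclusion k) (A.HH (Suc k))"
  unfolding exact_at_def a_kernel_eq
proof (rule equalityI; rule subsetI)
  let ?m = "Suc (Suc k)"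
  fix Y assume "Y \<in> connecting k ` carrier (B.HH ?m)"
  then obtain b where b: "b \<in> cycles B dB ?m" "Y = connecting k (B.cls ?m b)"
    by (auto simp: B.carrier_H)
  obtain a where a: "a \<in> carrier (A ?m)" "b = p ?m a" using preimage[OF B.cycles_closed[OF b(1)]] by blast
  have Y: "Y = R.cls k (dA ?m a)" using connecting_cls[OF a(1)] a b by simp
  have z: "dA ?m a \<in> cycles rel rel_d k" using d_lift_cycle[OF a(1)] a(2) b(1) by simp
  have "inclusion k Y = \<zero>\<^bsub>A.HH (Suc k)\<^esub>"
    using inclusion_cls[OF z] A.cls_zero_iff[of "dA ?m a" "Suc k"] z Y a(1)
    by (simp add: rel_cycles boundaries_def)
  then show "Y \<in> {Y \<in> carrier (R.HH k). inclusion k Y = \<zero>\<^bsub>A.HH (Suc k)\<^esub>}"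
    using Y R.cls_closed[OF z] by simp
next
  let ?m = "Suc (Suc k)"
  fix Y assume "Y \<in> {Y \<in> carrier (R.HH k). inclusion k Y = \<zero>\<^bsub>A.HH (Suc k)\<^esub>}"
  then obtain z where z: "z \<in> cycles rel rel_d k" "Y = R.cls k z" and 0: "inclusion k Y = \<zero>\<^bsub>A.HH (Suc k)\<^esub>"
    by (auto simp: R.carrier_H)
  have "z \<in> boundaries A dA (Suc k)"
    using inclusion_cls[OF z(1)] A.cls_zero_iff[of z "Suc k"] z 0 by (simp add: rel_cycles)
  then obtain a where a: "a \<in> carrier (A ?m)" "z = dA ?m a" by (auto simp: boundaries_def)
  have "dB ?m (p ?m a) = \<zero>\<^bsub>B (Suc k)\<^esub>"
    using p_d[OF a(1)] a(2) z(1) by (simp add: rel_cycles carrier_rel)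
  then have b: "p ?m a \<in> cycles B dB ?m" using hom_closed[OF p_hom a(1)] by (simp add: B.cycles_Suc)
  have "Y = connecting k (B.cls ?m (p ?m a))" using connecting_cls[OF a(1) b] z(2) a(2) by simp
  then show "Y \<in> connecting k ` carrier (B.HH ?m)" using B.cls_closed[OF b] by simp
qed

lemma projection_1_surj: "projection (Suc 0) ` carrier (A.HH (Suc 0)) = carrier (B.HH (Suc 0))"
proof
  show "projection (Suc 0) ` carrier (A.HH (Suc 0)) \<subseteq> carrier (B.HH (Suc 0))"
    using hom_closed[OF projection_hom] by blast
  show "carrier (B.HH (Suc 0)) \<subseteq> projection (Suc 0) ` carrier (A.HH (Suc 0))"
  proof
    fix Y assume "Y \<in> carrier (B.HH (Suc 0))"
    then obtain b where b: "b \<in> cycles B dB (Suc 0)" "Y = B.cls (Suc 0) b" by (auto simp: B.carrier_H)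
    obtain a where a: "a \<in> carrier (A (Suc 0))" "b = p (Suc 0) a"
      using preimage[OF B.cycles_closed[OF b(1)]] by blast
    have "dA (Suc 0) a = \<zero>\<^bsub>A 0\<^esub>"
      using p_d[OF a(1)] a(2) b(1) hom_closed[OF A.d_hom a(1)] by (intro p_0) (simp_all add: B.cycles_Suc)
    then have z: "a \<in> cycles A dA (Suc 0)" using a(1) by (simp add: A.cycles_Suc)
    then have "Y = projection (Suc 0) (A.cls (Suc 0) a)" using projection_cls[OF z] a(2) b(2) by simp
    then show "Y \<in> projection (Suc 0) ` carrier (A.HH (Suc 0))" using A.cls_closed[OF z] by simp
  qed
qed

lemma p_0_inj:
  assumes "x \<in> carrier (A 0)" "y \<in> carrier (A 0)" "p 0 x = p 0 y"
  shows "x = y"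
proof -
  interpret A': module K "A 0" by (rule A.module_C)
  interpret B': module K "B 0" by (rule B.module_C)
  have "p 0 (x \<ominus>\<^bsub>A 0\<^esub> y) = \<zero>\<^bsub>B 0\<^esub>"
    using hom_minus[OF p_hom assms(1,2)] assms hom_closed[OF p_hom assms(2)]
    by (simp add: a_minus_def[of "B 0"] B'.M.r_neg)
  then have "x \<ominus>\<^bsub>A 0\<^esub> y = \<zero>\<^bsub>A 0\<^esub>" using p_0[of "x \<ominus>\<^bsub>A 0\<^esub> y"] assms by simp
  then show ?thesis using assms by simp
qed

lemma projection_0_bij: "bij_betw (projection 0) (carrier (A.HH 0)) (carrier (B.HH 0))"
  unfolding bij_betw_def
proof
  show "projection 0 ` carrier (A.HH 0) = carrier (B.HH 0)"
  proof
    show "projection 0 ` carrier (A.HH 0) \<subseteq> carrier (B.HH 0)"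
      using hom_closed[OF projection_hom] by blast
    show "carrier (B.HH 0) \<subseteq> projection 0 ` carrier (A.HH 0)"
    proof
      fix Y assume "Y \<in> carrier (B.HH 0)"
      then obtain b where b: "b \<in> carrier (B 0)" "Y = B.cls 0 b" by (auto simp: B.carrier_H B.cycles_0)
      obtain a where a: "a \<in> carrier (A 0)" "b = p 0 a" using preimage[OF b(1)] by blast
      then have z: "a \<in> cycles A dA 0" by (simp add: A.cycles_0)
      then have "Y = projection 0 (A.cls 0 a)" using projection_cls[OF z] a(2) b(2) by simp
      then show "Y \<in> projection 0 ` carrier (A.HH 0)" using A.cls_closed[OF z] by simp
    qed
  qed
  show "inj_on (projection 0) (carrier (A.HH 0))"
  proof (rule inj_onI)
    fix X Y assume "X \<in> carrier (A.HH 0)" "Y \<in> carrier (A.HH 0)" and eq: "projection 0 X = projection 0 Y"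
    then obtain x y where x: "x \<in> cycles A dA 0" "X = A.cls 0 x" and y: "y \<in> cycles A dA 0" "Y = A.cls 0 y"
      by (auto simp: A.carrier_H)
    have xc: "x \<in> carrier (A 0)" and yc: "y \<in> carrier (A 0)" using x y by (simp_all add: A.cycles_0)
    interpret A': module K "A 0" by (rule A.module_C)
    have "B.cls 0 (p 0 x) = B.cls 0 (p 0 y)" using eq projection_cls x y by simp
    then have "p 0 x \<ominus>\<^bsub>B 0\<^esub> p 0 y \<in> boundaries B dB 0"
      using B.cls_eq_iff[OF p_cycles[OF x(1)] p_cycles[OF y(1)]] by simp
    then obtain b where b: "b \<in> carrier (B (Suc 0))" "p 0 (x \<ominus>\<^bsub>A 0\<^esub> y) = dB (Suc 0) b"
      using hom_minus[OF p_hom xc yc] by (auto simp: boundaries_def)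
    obtain a where a: "a \<in> carrier (A (Suc 0))" "b = p (Suc 0) a" using preimage[OF b(1)] by blast
    have "x \<ominus>\<^bsub>A 0\<^esub> y = dA (Suc 0) a"
      using p_d[OF a(1)] a b xc yc hom_closed[OF A.d_hom a(1)] by (intro p_0_inj) simp_all
    then have "x \<ominus>\<^bsub>A 0\<^esub> y \<in> boundaries A dA 0" using a(1) by (simp add: boundaries_def)
    then show "X = Y" using A.cls_eq_iff[OF x(1) y(1)] x(2) y(2) by simp
  qed
qed

end

section \<open>Comparison of \<open>D\<^sub>n(g)\<close> and \<open>L\<^sub>n(g)\<close>\<close>

lemma linear_map_of_mod_hom:
  assumes "field K" "mod_hom K M N f"
  shows "linear_map K M N f"
  unfolding linear_map_def vectorspace_def using assms hom_dom[OF assms(2)] hom_cod[OF assms(2)] by simp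

lemma (in leibniz_representation) module_complex: "module_complex K C d"
proof (rule module_complex.intro)
  show "module K (C k)" for k by (rule module_C)
  show "mod_hom K (C (Suc k)) (C k) (d (Suc k))" for k by (rule d_hom)
  show "x \<in> carrier (C (Suc (Suc k))) \<Longrightarrow> d (Suc k) (d (Suc (Suc k)) x) = \<zero>\<^bsub>C k\<^esub>" for k x
    by (rule d_d)
qed

lemma (in representation_surjection) surjective_chain_map:
  "surjective_chain_map K A.C A.d B.C B.d chain_map"
  by (intro surjective_chain_map.intro surjective_chain_map_axioms.intro A.module_complex B.module_complex
      chain_map_hom chain_map_d chain_map_surj chain_map_0_injective)

lemma (in filippov_power) leibniz_representation: "leibniz_representation K g H act brk"
  by (rule leibniz_representation.intro[OF pw.module_M pw.P.module_axioms act_hom_left act_hom_right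
        brk_hom_left brk_hom_right act_act brk_brk])

locale filippov_comparison =
  filippov_n_algebra K g n br for K (structure) and g (structure) and n and br :: "'c list \<Rightarrow> 'c" +
  assumes n_pos: "0 < n"
    and char_not_2: "\<one>\<^bsub>K\<^esub> \<oplus>\<^bsub>K\<^esub> \<one>\<^bsub>K\<^esub> \<noteq> \<zero>\<^bsub>K\<^esub>"
begin

sublocale D: filippov_power K g n br "n - 1" False
  by unfold_locales (simp_all add: n_pos char_not_2)

sublocale L: filippov_power K g n br "n - 1" True
  by unfold_locales (simp_all add: n_pos char_not_2)

text \<open>The following equations identify the constants of the statement with the instances of the
  general constructions.\<close>

lemma D_alg_eq: "D_alg K g n = D.H"
  by (simp only: D_alg_def tensor_power_def D.pw.R_def if_False Un_empty_right)

lemma L_alg_eq: "L_alg K g n = L.H"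
  by (simp only: L_alg_def exterior_power_def L.pw.R_def if_True)

lemma tensor_eq: "tensor K g (n - 1) = D.cls"
  by (simp only: tensor_def D.pw.R_def if_False Un_empty_right)

lemma wedge_eq: "wedge K g (n - 1) = L.cls"
  by (simp only: wedge_def L.pw.R_def if_True)

lemma D_bracket_eq: "D_bracket K g n br = D.brk"
  by (simp only: D_bracket_def D_alg_eq tensor_eq)

lemma L_bracket_eq: "L_bracket K g n br = L.brk"
  by (simp only: L_bracket_def L_alg_eq wedge_eq)

lemma D_to_L_eq: "D_to_L K g n = presented_lift K (tuples g (n - 1)) L.H L.cls"
  by (simp only: D_to_L_def L_alg_eq wedge_eq)

lemma
  shows D_to_L_hom: "mod_hom K D.H L.H (D_to_L K g n)"
    and D_to_L_cls: "xs \<in> tuples g (n - 1) \<Longrightarrow> D_to_L K g n (D.cls xs) = L.cls xs"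
proof -
  have m: "multilinear K g (n - 1) L.H L.cls"
    by (rule D.pw.multilinearI[OF L.pw.cls_closed L.pw.P.module_axioms L.pw.cls_slot])
  show "mod_hom K D.H L.H (D_to_L K g n)"
    unfolding D_to_L_eq by (rule D.pw.lift_hom[OF m L.pw.P.module_axioms]) simp
  show "xs \<in> tuples g (n - 1) \<Longrightarrow> D_to_L K g n (D.cls xs) = L.cls xs"
    unfolding D_to_L_eq by (rule D.pw.lift_cls[OF m L.pw.P.module_axioms]) simp_all
qed

lemma D_to_L_closed: "A \<in> carrier D.H \<Longrightarrow> D_to_L K g n A \<in> carrier L.H"
  by (rule hom_closed[OF D_to_L_hom])

lemma act_D_to_L:
  assumes v: "v \<in> carrier g" and A: "A \<in> carrier D.H"
  shows "L.act v (D_to_L K g n A) = D.act v A"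
  by (rule D.pw.hom_eqI[OF mod_hom_comp[OF D_to_L_hom L.act_hom_right[OF v]] D.act_hom_right[OF v] _ A])
    (simp only: D_to_L_cls L.act_cls[OF v] D.act_cls[OF v])

text \<open>On both sides the bracket with \<open>B\<close> is a derivation, and these derivations extend the same
  endomorphism of \<open>g\<close> by \<open>act_D_to_L\<close>.\<close>

lemma brk_D_to_L:
  assumes A: "A \<in> carrier D.H" and B: "B \<in> carrier D.H"
  shows "D_to_L K g n (D.brk A B) = L.brk (D_to_L K g n A) (D_to_L K g n B)"
proof (rule D.pw.hom_eqI[OF mod_hom_comp[OF D.brk_hom_left[OF B] D_to_L_hom]
      mod_hom_comp[OF D_to_L_hom L.brk_hom_left[OF D_to_L_closed[OF B]]] _ A])
  fix as assume as: "as \<in> tuples g (n - 1)"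
  have up: "as[i := D.act (as ! i) B] \<in> tuples g (n - 1)" if "i < n - 1" for i
    by (intro tuples_update as D.act_closed tuples_nth[OF as that] B)
  have "D_to_L K g n (D.brk (D.cls as) B) =
      (\<Oplus>\<^bsub>L.H\<^esub>i\<in>{..<n - 1}. D_to_L K g n (D.cls (as[i := D.act (as ! i) B])))"
    unfolding D.brk_cls[OF as B]
    by (rule finsum_mod_hom[OF D_to_L_hom]) (use up D.pw.cls_closed in blast)
  also have "\<dots> = (\<Oplus>\<^bsub>L.H\<^esub>i\<in>{..<n - 1}. L.cls (as[i := L.act (as ! i) (D_to_L K g n B)]))"
  proof (rule L.pw.P.M.finsum_cong'[OF refl])
    show "(\<lambda>i. L.cls (as[i := L.act (as ! i) (D_to_L K g n B)])) \<in> {..<n - 1} \<rightarrow> carrier L.H"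
      using act_D_to_L[OF tuples_nth[OF as] B] L.pw.cls_closed[OF up]
      by (simp add: Pi_iff del: One_nat_def)
    show "D_to_L K g n (D.cls (as[i := D.act (as ! i) B])) = L.cls (as[i := L.act (as ! i) (D_to_L K g n B)])"
      if "i \<in> {..<n - 1}" for i
      using that D_to_L_cls[OF up] act_D_to_L[OF tuples_nth[OF as] B]
      by (simp del: One_nat_def)
  qed
  also have "\<dots> = L.brk (D_to_L K g n (D.cls as)) (D_to_L K g n B)"
    unfolding D_to_L_cls[OF as] by (rule L.brk_cls[OF as D_to_L_closed[OF B], symmetric])
  finally show "D_to_L K g n (D.brk (D.cls as) B) = L.brk (D_to_L K g n (D.cls as)) (D_to_L K g n B)" .
qed

lemma D_to_L_surj: "D_to_L K g n ` carrier D.H = carrier L.H"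
proof (rule L.pw.hom_surj[OF D_to_L_hom])
  fix xs assume xs: "xs \<in> tuples g (n - 1)"
  show "L.cls xs \<in> D_to_L K g n ` carrier D.H"
    using D_to_L_cls[OF xs] D.pw.cls_closed[OF xs] by (metis imageI)
qed

sublocale S: representation_surjection K g D.H D.act D.brk L.H L.act L.brk "D_to_L K g n"
  by (intro representation_surjection.intro representation_surjection_axioms.intro
      D.leibniz_representation L.leibniz_representation D_to_L_hom act_D_to_L brk_D_to_L D_to_L_surj)

lemma nCL_eq: "nCL K g n = S.A.C"
  by (simp only: nCL_def[abs_def] D_alg_eq)

lemma nC_eq: "nC K g n = S.B.C"
  by (simp only: nC_def[abs_def] L_alg_eq)

lemma nCL_d_eq: "nCL_d K g n br = S.A.d"
  by (simp only: nCL_d_def D_alg_eq D_bracket_eq)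

lemma nC_d_eq: "nC_d K g n br = S.B.d"
  by (simp only: nC_d_def L_alg_eq L_bracket_eq)

lemma chain_projection_eq: "chain_projection K g n = S.chain_map"
  by (intro ext) (simp only: chain_projection_def S.chain_map_def D_alg_eq L_alg_eq nC_eq)

sublocale E: surjective_chain_map K S.A.C S.A.d S.B.C S.B.d S.chain_map
  by (rule S.surjective_chain_map)

lemma nC_rel_eq: "nC_rel K g n = E.rel"
  by (intro ext) (simp only: nC_rel_def E.rel_def nCL_eq nC_eq chain_projection_eq)

lemma nC_rel_d_eq: "nC_rel_d K g n br = E.rel_d"
  by (intro ext) (simp only: nC_rel_d_def nCL_d_eq)

lemma nHL_eq: "nHL K g n br = E.A.HH"
  by (intro ext) (simp only: nHL_def nCL_eq nCL_d_eq)

lemma nHLie_eq: "nHLie K g n br = E.B.HH"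
  by (intro ext) (simp only: nHLie_def nC_eq nC_d_eq)

lemma nHrel_eq: "nHrel K g n br = E.R.HH"
  by (intro ext) (simp only: nHrel_def nC_rel_eq nC_rel_d_eq)

lemma HL_to_HLie_eq: "HL_to_HLie K g n br = E.projection"
  by (simp only: HL_to_HLie_def nC_eq nC_d_eq chain_projection_eq)

end

theorem proposition3p1:
  fixes K :: "('k, 'r) ring_scheme" and g :: "('k, 'a, 'm) module_scheme"
    and n :: nat and br :: "'a list \<Rightarrow> 'a"
  assumes "filippov_n_algebra K g n br"
    and "n > 2"
    and char_not_2: "\<one>\<^bsub>K\<^esub> \<oplus>\<^bsub>K\<^esub> \<one>\<^bsub>K\<^esub> \<noteq> \<zero>\<^bsub>K\<^esub>"
    and dim_ge_n: "vectorspace.fin_dim K g \<longrightarrow> n \<le> vectorspace.dim K g"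
  shows "\<exists>\<iota> \<delta>.
      (\<forall>k. linear_map K (nHrel K g n br k) (nHL K g n br (Suc k)) (\<iota> k)) \<and>
      (\<forall>k. linear_map K (nHL K g n br k) (nHLie K g n br k) (HL_to_HLie K g n br k)) \<and>
      (\<forall>k. linear_map K (nHLie K g n br (k + 2)) (nHrel K g n br k) (\<delta> k)) \<and>
      (\<forall>k. exact_at (nHrel K g n br k) (\<iota> k)
             (nHL K g n br (Suc k)) (HL_to_HLie K g n br (Suc k)) (nHLie K g n br (Suc k))) \<and>
      (\<forall>k. exact_at (nHL K g n br (k + 2)) (HL_to_HLie K g n br (k + 2))
             (nHLie K g n br (k + 2)) (\<delta> k) (nHrel K g n br k)) \<and>
      (\<forall>k. exact_at (nHLie K g n br (k + 2)) (\<delta> k)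
             (nHrel K g n br k) (\<iota> k) (nHL K g n br (Suc k))) \<and>
      HL_to_HLie K g n br 1 ` carrier (nHL K g n br 1) = carrier (nHLie K g n br 1) \<and>
      bij_betw (HL_to_HLie K g n br 0) (carrier (nHL K g n br 0)) (carrier (nHLie K g n br 0))"
proof -
  interpret filippov_comparison K g n br
    by (rule filippov_comparison.intro[OF assms(1)]) (rule filippov_comparison_axioms.intro, use assms(2) char_not_2 in simp_all)
  have field: "field K" by unfold_locales
  show ?thesis
    unfolding nHL_eq nHLie_eq nHrel_eq HL_to_HLie_eq add_2_eq_Suc'
    by (rule exI[of _ E.inclusion], rule exI[of _ E.connecting])
      (intro conjI allI linear_map_of_mod_hom[OF field] E.inclusion_hom E.projection_hom E.connecting_hom
        E.exact_at_total E.exact_at_target E.exact_at_relative E.projection_1_surj[folded One_nat_def] E.projection_0_bij)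
qed

end
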